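(* Consider a linear Gaussian covariance model given by $\mathcal G=(G_0,\dots,G_r)$, let $v^*\in\Theta_{\mathcal G}$, and let $X_1,\dots,X_n$ be i.i.d. $\mathcal N_p(\mu,\Sigma_{v^*})$. Let $\kappa=\|\Sigma_{v^*}^{-1}\|\,\|\Sigma_{v^*}\|$ be the condition number of $\Sigma_{v^*}$ ($\|\cdot\|$ the spectral norm), and let $\Sigma_{\bar v}$ be the least squares estimator. Fix $p$ and suppose $n\ge15$ and $n$ is large enough that $$\epsilon=\epsilon(n):=\sqrt{\frac{2+\kappa\sqrt p}{1+\kappa\sqrt p}}-\sqrt{\frac{n-1}{n}}-\sqrt{\frac pn}>0.$$ Then $\mathbb P(2S_n-\Sigma_{\bar v}\succ0)\ge1-2\exp(-n\epsilon^2/2)$ and $\mathbb P(\Sigma_{\bar v}\succ0)\ge1-2\exp(-n\epsilon^2/2)$. Consequently $\mathbb P(0\prec\Sigma_{\bar v}\prec2S_n)\ge1-4\exp(-n\epsilon^2/2)$.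
   Context: A linear Gaussian covariance model is specified by symmetric $G_0,G_1,\dots,G_r\in\mathbb{R}^{p\times p}$ with $G_1,\dots,G_r$ linearly independent and $\mathrm{tr}(G_0G_i)=0$ for $i\ge1$; $\Sigma_v=G_0+\sum_{i=1}^r v_iG_i$ and $\Theta_{\mathcal G}=\{v\in\mathbb{R}^r:\Sigma_v\succ0\}$. $S_n=\frac1n\sum_{i=1}^n(X_i-\bar X)(X_i-\bar X)^T$. The least squares estimator $\bar v\in\mathbb{R}^r$ is the unique solution of $\sum_{i=1}^r\bar v_i\,\mathrm{tr}(G_iG_j)=\mathrm{tr}(S_nG_j)$, $j=1,\dots,r$, and $\Sigma_{\bar v}=G_0+\sum_i\bar v_iG_i$ (equivalently, $\Sigma_{\bar v}$ is the Frobenius-orthogonal projection of $S_n$ onto the affine space $G_0+\mathrm{span}(G_1,\dots,G_r)$). $A\succ B$ means $A-B$ is positive definite. *)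

theory Defs
  imports "HOL-Probability.Probability"
begin

type_synonym 'p mat = "real^'p^'p"

definition sym_mat :: "'p::finite mat \<Rightarrow> bool" where
  "sym_mat A \<longleftrightarrow> transpose A = A"

definition pos_def :: "'p::finite mat \<Rightarrow> bool" where
  "pos_def A \<longleftrightarrow> sym_mat A \<and> (\<forall>x. x \<noteq> 0 \<longrightarrow> x \<bullet> (A *v x) > 0)"

definition spec_norm :: "'p::finite mat \<Rightarrow> real" where
  "spec_norm A = onorm (\<lambda>x. A *v x)"

definition outer :: "real^'p \<Rightarrow> real^'p \<Rightarrow> 'p::finite mat" where
  "outer u w = (\<chi> a b. u $ a * w $ b)"

definition Sigma_of :: "(nat \<Rightarrow> 'p::finite mat) \<Rightarrow> nat \<Rightarrow> (nat \<Rightarrow> real) \<Rightarrow> 'p mat" where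
  "Sigma_of G r v = G 0 + (\<Sum>i=1..r. v i *\<^sub>R G i)"

definition LGCM :: "(nat \<Rightarrow> 'p::finite mat) \<Rightarrow> nat \<Rightarrow> bool" where
  "LGCM G r \<longleftrightarrow> (\<forall>i\<in>{0..r}. sym_mat (G i))
     \<and> (\<forall>c. (\<Sum>i=1..r. c i *\<^sub>R G i) = 0 \<longrightarrow> (\<forall>i\<in>{1..r}. c i = 0))
     \<and> (\<forall>i\<in>{1..r}. trace (G 0 ** G i) = 0)"

definition sample_mean :: "nat \<Rightarrow> (nat \<Rightarrow> real^'p::finite) \<Rightarrow> real^'p" where
  "sample_mean n x = (1 / real n) *\<^sub>R (\<Sum>i<n. x i)"

definition sample_cov :: "nat \<Rightarrow> (nat \<Rightarrow> real^'p::finite) \<Rightarrow> 'p mat" where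
  "sample_cov n x = (1 / real n) *\<^sub>R
     (\<Sum>i<n. outer (x i - sample_mean n x) (x i - sample_mean n x))"

(* least squares estimator: unique solution (on indices 1..r) of the normal equations *)
definition lse :: "(nat \<Rightarrow> 'p::finite mat) \<Rightarrow> nat \<Rightarrow> 'p mat \<Rightarrow> (nat \<Rightarrow> real)" where
  "lse G r S = (THE v. (\<forall>j\<in>{1..r}. (\<Sum>i=1..r. v i * trace (G i ** G j)) = trace (S ** G j))
                   \<and> (\<forall>i. i \<notin> {1..r} \<longrightarrow> v i = 0))"

(* multivariate normal N_p(mu, Sigma), Sigma positive definite, via its Lebesgue density *)
definition mvn_density :: "real^'p \<Rightarrow> 'p::finite mat \<Rightarrow> real^'p \<Rightarrow> real" where
  "mvn_density mu Sig x =
     exp (- (1/2) * ((x - mu) \<bullet> (matrix_inv Sig *v (x - mu))))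
     / sqrt ((2 * pi) ^ CARD('p) * det Sig)"

definition mvn :: "real^'p \<Rightarrow> 'p::finite mat \<Rightarrow> (real^'p) measure" where
  "mvn mu Sig = density lborel (\<lambda>x. ennreal (mvn_density mu Sig x))"

definition cond_num :: "'p::finite mat \<Rightarrow> real" where
  "cond_num Sig = spec_norm (matrix_inv Sig) * spec_norm Sig"

definition eps_n :: "nat \<Rightarrow> real \<Rightarrow> nat \<Rightarrow> real" where
  "eps_n p \<kappa> n = sqrt ((2 + \<kappa> * sqrt (real p)) / (1 + \<kappa> * sqrt (real p)))
                   - sqrt ((real n - 1) / real n) - sqrt (real p / real n)"

end

(* Whitening turns the observations into standard normal vectors y_i, and both events follow from the
   single bound F < 1 / (1 + kappa) on the Frobenius norm F of the whitened sample covariance minus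
   the identity: projecting onto the model is a contraction in the Frobenius norm, so both
   Sigma_vbar - Sigma and S_n - Sigma_vbar have norm at most F times the largest eigenvalue of Sigma.

   The function sqrt (1 + F) is (1 / sqrt n)-Lipschitz in (y_1, ..., y_n), so Gaussian concentration
   applies to it with the sharp constant exp (- n t^2 / 2). Working with the Frobenius norm instead
   of the spectral norm keeps the mean elementary: E F is at most sqrt (p (p + 1) / n) + p / n by
   second moments, and an inequality between real numbers shows that the slack in F, compared with
   the spectral norm, pays for the larger mean.

   Gaussian concentration comes from the Prekopa-Leindler inequality at the midpoint, which
   tensorizes: for 1-Lipschitz f it gives E exp (s f) <= exp (s^2 / 4) (E exp (s f / 2))^2, and
   iterating s -> s / 2 yields E exp (s f) <= exp (s E f + s^2 / 2). *)

theory Submission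
  imports Defs
begin

section \<open>The Prekopa-Leindler inequality at the midpoint\<close>

text \<open>The parallelogram identity explains the constants of the concentration bound: the
  product of the normal densities at x and y, times exp ((x - y)^2 / 4), is exactly the square of
  the density at the midpoint. Such costs add over coordinates, so nothing depends on the dimension.
  The root of the cost is the distance from x to the midpoint, hence a 1-Lipschitz f loses s * sqrt
  c, which Young's inequality pays with s^2 / 4 and the cost itself. Over s, s / 2, s / 4, ... this
  sums to s^2 / 4 * (1 + 1/2 + 1/4 + ...) = s^2 / 2. The threshold 1 / (1 + kappa) comes from 2 S_n
  - Sigma_vbar = S_n + (S_n - Sigma_vbar): relative to Sigma the first summand loses F, the second
  kappa * F. The obstacle is that eps is tailored to a spectral norm bound, with threshold 1 / (1 +
  kappa sqrt p) and with sqrt ((n - 1) / n) + sqrt (p / n) in the role of the mean of the largest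
  singular value. The same eps has to be reached with Frobenius norms. The ratio of the two
  thresholds is at least (1 + sqrt p) / 2, a gain that grows with p, so that p = 1 and p = 2 need
  estimates of their own.\<close>

lemma emeasure_lborel_shift:
  fixes C :: "real set" and c :: real
  assumes [measurable]: "C \<in> sets borel"
  shows "emeasure lborel {x. c + x \<in> C} = emeasure lborel C"
proof -
  have "emeasure lborel C = emeasure (distr lborel borel ((+) c)) C"
    by (simp add: lborel_distr_plus)
  also have "\<dots> = emeasure lborel ((+) c -` C \<inter> space lborel)"
    by (rule emeasure_distr) auto
  finally show ?thesis by (simp add: vimage_def)
qed

text \<open>Doubling removes the midpoint: with \<open>D\<close> = 2C, the translates b + A and a +
  B lie in \<open>D\<close>. If \<open>a\<close> is nearly the supremum of \<open>A\<close> and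
  \<open>b\<close> nearly the infimum of \<open>B\<close>, the first translate ends where the second
  begins, up to an overlap of length \<open>e\<close>.\<close>

lemma brunn_minkowski_midpoint_half_bounded:
  fixes A B C :: "real set"
  assumes [measurable]: "A \<in> sets borel" "B \<in> sets borel" "C \<in> sets borel"
    and ne: "A \<noteq> {}" "B \<noteq> {}"
    and bd: "bdd_above A" "bdd_below B"
    and mid: "\<And>x y. x \<in> A \<Longrightarrow> y \<in> B \<Longrightarrow> (x + y) / 2 \<in> C"
  shows "emeasure lborel A + emeasure lborel B \<le> 2 * emeasure lborel C"
proof -
  define D where "D = {z. z / 2 \<in> C}"
  have D[measurable]: "D \<in> sets borel" unfolding D_def by measurable
  have "emeasure lborel D = ennreal \<bar>2\<bar> * (\<integral>\<^sup>+x. indicator D (0 + 2 * x) \<partial>lborel)"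
    by (subst nn_integral_indicator[symmetric], simp, subst nn_integral_real_affine[where c=2 and t=0]) auto
  also have "(\<lambda>x. indicator D (0 + 2 * x) :: ennreal) = indicator C"
    by (auto simp: D_def indicator_def)
  finally have CD: "2 * emeasure lborel C = emeasure lborel D"
    by simp
  have eps: "emeasure lborel A + emeasure lborel B \<le> emeasure lborel D + ennreal e" if e: "e > 0" for e
  proof -
    obtain a where a: "a \<in> A" "Sup A - e/2 < a"
      using less_cSupD[OF ne(1), of "Sup A - e/2"] e by auto
    obtain b where b: "b \<in> B" "b < Inf B + e/2"
      using cInf_lessD[OF ne(2), of "Inf B + e/2"] e by auto
    have Aa: "x < a + e/2" if "x \<in> A" for x using cSup_upper[OF that bd(1)] a by linarith
    have Bb: "b - e/2 < y" if "y \<in> B" for y using cInf_lower[OF that bd(2)] b by linarith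
    have "emeasure lborel A \<le> emeasure lborel {x. b + x \<in> D \<inter> {..a + b + e/2}}"
      by (rule emeasure_mono) (use Aa mid b in \<open>fastforce simp: D_def add.commute\<close>, measurable)
    also have "\<dots> = emeasure lborel (D \<inter> {..a + b + e/2})"
      by (rule emeasure_lborel_shift) auto
    finally have 1: "emeasure lborel A \<le> emeasure lborel (D \<inter> {..a + b + e/2})" .
    have "emeasure lborel B \<le> emeasure lborel {x. a + x \<in> D \<inter> {a + b - e/2..}}"
      by (rule emeasure_mono) (use Bb mid a in \<open>fastforce simp: D_def\<close>, measurable)
    also have "\<dots> = emeasure lborel (D \<inter> {a + b - e/2..})"
      by (rule emeasure_lborel_shift) auto
    \<comment> \<open>What reaches beyond the end of b + A is charged to a part of \<open>D\<close>
      disjoint from the first one; the rest sits in an interval of length \<open>e\<close>.\<close>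
    also have "\<dots> \<le> emeasure lborel ((D \<inter> {a + b + e/2<..}) \<union> {a + b - e/2..a + b + e/2})"
      by (rule emeasure_mono) auto
    also have "\<dots> \<le> emeasure lborel (D \<inter> {a + b + e/2<..}) + emeasure lborel {a + b - e/2..a + b + e/2}"
      by (rule emeasure_subadditive) auto
    also have "\<dots> = emeasure lborel (D \<inter> {a + b + e/2<..}) + ennreal e"
      using e by simp
    finally have 2: "emeasure lborel B \<le> emeasure lborel (D \<inter> {a + b + e/2<..}) + ennreal e" .
    have "emeasure lborel (D \<inter> {..a + b + e/2}) + emeasure lborel (D \<inter> {a + b + e/2<..})
        = emeasure lborel ((D \<inter> {..a + b + e/2}) \<union> (D \<inter> {a + b + e/2<..}))"
      by (rule plus_emeasure) auto
    also have "(D \<inter> {..a + b + e/2}) \<union> (D \<inter> {a + b + e/2<..}) = D" by auto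
    finally have 3: "emeasure lborel (D \<inter> {..a + b + e/2}) + emeasure lborel (D \<inter> {a + b + e/2<..}) = emeasure lborel D" .
    show ?thesis using add_mono[OF 1 2] unfolding add.assoc[symmetric, of "emeasure lborel (D \<inter> {..a + b + e/2})"] 3 .
  qed
  show ?thesis
    unfolding CD by (rule ennreal_le_epsilon) (rule eps)
qed

text \<open>Monotone approximation by truncations. The cutoffs start at a point of each set, so that
  no truncation is empty.\<close>

lemma brunn_minkowski_midpoint:
  fixes A B C :: "real set"
  assumes [measurable]: "A \<in> sets borel" "B \<in> sets borel" "C \<in> sets borel"
    and ne: "A \<noteq> {}" "B \<noteq> {}"
    and mid: "\<And>x y. x \<in> A \<Longrightarrow> y \<in> B \<Longrightarrow> (x + y) / 2 \<in> C"
  shows "emeasure lborel A + emeasure lborel B \<le> 2 * emeasure lborel C"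
proof -
  obtain a b where ab: "a \<in> A" "b \<in> B" using ne by auto
  define A' where "A' k = A \<inter> {..a + real k}" for k
  define B' where "B' k = B \<inter> {b - real k..}" for k
  have UA: "(\<Union>k. A' k) = A"
  proof -
    have "\<exists>k. x \<le> a + real k" for x using real_arch_simple[of "x - a"] by (auto simp: algebra_simps)
    then show ?thesis by (auto simp: A'_def)
  qed
  have UB: "(\<Union>k. B' k) = B"
  proof -
    have "\<exists>k. b - real k \<le> x" for x using real_arch_simple[of "b - x"] by (auto simp: algebra_simps)
    then show ?thesis by (auto simp: B'_def)
  qed
  have [measurable]: "A' k \<in> sets borel" "B' k \<in> sets borel" for k
    by (auto simp: A'_def B'_def)
  have inc: "incseq A'" "incseq B'" by (auto simp: A'_def B'_def incseq_def)
  have lA: "(\<lambda>k. emeasure lborel (A' k)) \<longlonglongrightarrow> emeasure lborel A"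
    using Lim_emeasure_incseq[of A' lborel] inc by (simp add: UA image_subset_iff)
  have lB: "(\<lambda>k. emeasure lborel (B' k)) \<longlonglongrightarrow> emeasure lborel B"
    using Lim_emeasure_incseq[of B' lborel] inc by (simp add: UB image_subset_iff)
  have "emeasure lborel (A' k) + emeasure lborel (B' k) \<le> 2 * emeasure lborel C" for k
    by (rule brunn_minkowski_midpoint_half_bounded)
       (use ab mid in \<open>auto simp: A'_def B'_def intro: bdd_belowI[of _ "b - real k"] bdd_aboveI[of _ "a + real k"]\<close>)
  then show ?thesis
    by (intro LIMSEQ_le_const2[OF tendsto_add[OF lA lB]]) auto
qed

text \<open>The levels are kept in the open unit interval because there the superlevel sets of a
  function with supremum 1 are nonempty, as \<open>brunn_minkowski_midpoint\<close>
  requires.\<close>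

lemma nn_integral_layer_cake_unit:
  fixes u :: "real \<Rightarrow> ennreal"
  assumes [measurable]: "u \<in> borel_measurable borel" and le: "\<And>x. u x \<le> 1"
  shows "(\<integral>\<^sup>+x. u x \<partial>lborel) = (\<integral>\<^sup>+t. indicator {0<..<1::real} t * emeasure lborel {x. ennreal t < u x} \<partial>lborel)"
proof -
  have "u x = (\<integral>\<^sup>+t. (if 0 < t \<and> t < 1 \<and> ennreal t < u x then 1 else 0) \<partial>lborel)" for x
  proof -
    obtain r where r: "0 \<le> r" "r \<le> 1" "u x = ennreal r"
      using le[of x] by (cases "u x") (auto simp: top_unique)
    have "(\<integral>\<^sup>+t. (if 0 < t \<and> t < 1 \<and> ennreal t < u x then 1 else 0) \<partial>lborel)
        = (\<integral>\<^sup>+t. indicator {0<..<r} t \<partial>lborel)"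
      using r by (intro nn_integral_cong) (auto simp: indicator_def ennreal_less_iff)
    then show ?thesis using r by simp
  qed
  then have "(\<integral>\<^sup>+x. u x \<partial>lborel)
      = (\<integral>\<^sup>+x. \<integral>\<^sup>+t. (if 0 < t \<and> t < 1 \<and> ennreal t < u x then 1 else 0) \<partial>lborel \<partial>lborel)"
    by (intro nn_integral_cong) simp
  also have "\<dots> = (\<integral>\<^sup>+t. \<integral>\<^sup>+x. (if 0 < t \<and> t < 1 \<and> ennreal t < u x then 1 else 0) \<partial>lborel \<partial>lborel)"
    by (rule lborel_pair.Fubini') measurable
  also have "\<dots> = (\<integral>\<^sup>+t. indicator {0<..<1} t * emeasure lborel {x. ennreal t < u x} \<partial>lborel)"
  proof (rule nn_integral_cong)
    fix t :: real
    have "(\<integral>\<^sup>+x. (if 0 < t \<and> t < 1 \<and> ennreal t < u x then 1 else 0) \<partial>lborel)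
        = (\<integral>\<^sup>+x. indicator {0<..<1} t * indicator {x. ennreal t < u x} x \<partial>lborel)"
      by (intro nn_integral_cong) (auto simp: indicator_def)
    also have "\<dots> = indicator {0<..<1} t * emeasure lborel {x. ennreal t < u x}"
      by (subst nn_integral_cmult) auto
    finally show "(\<integral>\<^sup>+x. (if 0 < t \<and> t < 1 \<and> ennreal t < u x then 1 else 0) \<partial>lborel)
        = indicator {0<..<1} t * emeasure lborel {x. ennreal t < u x}" .
  qed
  finally show ?thesis .
qed

text \<open>For functions with supremum 1 even the additive form holds: at each level, midpoints of
  the superlevel sets of \<open>u\<close> and \<open>v\<close> lie in that of \<open>w\<close>, and
  Brunn-Minkowski is integrated over the level.\<close>

lemma midpoint_integral_unit:
  fixes u v w :: "real \<Rightarrow> ennreal"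
  assumes [measurable]: "u \<in> borel_measurable borel" "v \<in> borel_measurable borel" "w \<in> borel_measurable borel"
    and le: "\<And>x. u x \<le> 1" "\<And>x. v x \<le> 1"
    and sup: "\<And>t::real. 0 < t \<Longrightarrow> t < 1 \<Longrightarrow> \<exists>x. ennreal t < u x" "\<And>t::real. 0 < t \<Longrightarrow> t < 1 \<Longrightarrow> \<exists>x. ennreal t < v x"
    and uvw: "\<And>x y. u x * v y \<le> (w ((x + y) / 2))\<^sup>2"
  shows "(\<integral>\<^sup>+x. u x \<partial>lborel) + (\<integral>\<^sup>+x. v x \<partial>lborel) \<le> 2 * (\<integral>\<^sup>+x. w x \<partial>lborel)"
proof -
  \<comment> \<open>Truncation at 1 opens the layer-cake formula to \<open>w\<close> and changes no
    superlevel set at a level below 1.\<close>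
  define w' where "w' x = min 1 (w x)" for x
  have [measurable]: "w' \<in> borel_measurable borel" unfolding w'_def by measurable
  have level: "emeasure lborel {x. ennreal t < u x} + emeasure lborel {x. ennreal t < v x}
      \<le> 2 * emeasure lborel {x. ennreal t < w' x}" if t: "0 < t" "t < 1" for t :: real
  proof (rule brunn_minkowski_midpoint)
    fix x y assume "x \<in> {x. ennreal t < u x}" "y \<in> {x. ennreal t < v x}"
    then have "ennreal t * ennreal t < u x * v y"
      using t le(1)[of x] le(2)[of y]
      by (cases "u x"; cases "v y")
         (auto simp: ennreal_less_iff top_unique ennreal_mult[symmetric] intro!: mult_strict_mono)
    also have "\<dots> \<le> (w ((x + y) / 2))\<^sup>2" by (rule uvw)
    finally have "(ennreal t)\<^sup>2 < (w ((x + y) / 2))\<^sup>2" by (simp add: power2_eq_square)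
    then have "ennreal t < w ((x + y) / 2)"
      using power_mono[of "w ((x + y) / 2)" "ennreal t" 2] by (meson not_le zero_le)
    then show "(x + y) / 2 \<in> {x. ennreal t < w' x}"
      using t by (auto simp: w'_def ennreal_less_iff)
  qed (use sup t in auto)
  have "(\<integral>\<^sup>+x. u x \<partial>lborel) + (\<integral>\<^sup>+x. v x \<partial>lborel)
     = (\<integral>\<^sup>+t. indicator {0<..<1} t * (emeasure lborel {x. ennreal t < u x} + emeasure lborel {x. ennreal t < v x}) \<partial>lborel)"
    unfolding distrib_left
    by (subst nn_integral_add)
       (auto simp: nn_integral_layer_cake_unit[of u] nn_integral_layer_cake_unit[of v] le)
  also have "\<dots> \<le> (\<integral>\<^sup>+t. indicator {0<..<1} t * (2 * emeasure lborel {x. ennreal t < w' x}) \<partial>lborel)"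
    using level by (intro nn_integral_mono) (auto simp: indicator_def)
  also have "\<dots> = 2 * (\<integral>\<^sup>+t. indicator {0<..<1} t * emeasure lborel {x. ennreal t < w' x} \<partial>lborel)"
    by (subst nn_integral_cmult[symmetric]) (auto simp: mult_ac)
  also have "\<dots> = 2 * (\<integral>\<^sup>+x. w' x \<partial>lborel)"
    by (subst nn_integral_layer_cake_unit[of w']) (auto simp: w'_def)
  also have "\<dots> \<le> 2 * (\<integral>\<^sup>+x. w x \<partial>lborel)"
    by (intro mult_left_mono nn_integral_mono) (auto simp: w'_def)
  finally show ?thesis .
qed

text \<open>The Prekopa-Leindler inequality with weight 1/2 for the midpoint operation m, its hypothesis
  relaxed by the transport cost c. In this form it passes to product measures.\<close>

definition midpoint_ineq :: "'b measure \<Rightarrow> ('b \<Rightarrow> 'b \<Rightarrow> 'b) \<Rightarrow> ('b \<Rightarrow> 'b \<Rightarrow> real) \<Rightarrow> bool" where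
  "midpoint_ineq N m c \<longleftrightarrow> (\<forall>u\<in>borel_measurable N. \<forall>v\<in>borel_measurable N. \<forall>w\<in>borel_measurable N.
     (\<forall>x\<in>space N. \<forall>y\<in>space N. u x * v y \<le> (w (m x y))\<^sup>2 * ennreal (exp (c x y)))
     \<longrightarrow> (\<integral>\<^sup>+x. u x \<partial>N) * (\<integral>\<^sup>+x. v x \<partial>N) \<le> (\<integral>\<^sup>+x. w x \<partial>N)\<^sup>2)"

lemma midpoint_ineqD:
  assumes "midpoint_ineq N m c" "u \<in> borel_measurable N" "v \<in> borel_measurable N" "w \<in> borel_measurable N"
    and "\<And>x y. x \<in> space N \<Longrightarrow> y \<in> space N \<Longrightarrow> u x * v y \<le> (w (m x y))\<^sup>2 * ennreal (exp (c x y))"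
  shows "(\<integral>\<^sup>+x. u x \<partial>N) * (\<integral>\<^sup>+x. v x \<partial>N) \<le> (\<integral>\<^sup>+x. w x \<partial>N)\<^sup>2"
  using assms unfolding midpoint_ineq_def by blast

lemma ennreal_arith_geo_mean:
  fixes a b :: ennreal
  shows "4 * (a * b) \<le> (a + b)\<^sup>2"
proof (cases a; cases b)
  fix r s assume rs: "a = ennreal r" "0 \<le> r" "b = ennreal s" "0 \<le> s"
  have "4 * (r * s) \<le> (r + s)\<^sup>2"
    using zero_le_power2[of "r - s"] by (simp add: power2_eq_square algebra_simps)
  then have "ennreal (4 * (r * s)) \<le> ennreal ((r + s)\<^sup>2)" by (rule ennreal_leI)
  then show ?thesis using rs by (simp add: ennreal_mult ennreal_power[symmetric])
qed (auto simp: power2_eq_square)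

text \<open>Dividing \<open>u\<close> and \<open>v\<close> by their suprema, and \<open>w\<close> by
  the geometric mean of these, reduces to supremum 1. The arithmetic-geometric mean inequality then
  turns the sum of the integrals into their product. Boundedness keeps the suprema finite.\<close>

lemma midpoint_integral_bounded:
  fixes u v w :: "real \<Rightarrow> ennreal"
  assumes [measurable]: "u \<in> borel_measurable borel" "v \<in> borel_measurable borel" "w \<in> borel_measurable borel"
    and bd: "\<And>x. u x \<le> ennreal K" "\<And>x. v x \<le> ennreal L"
    and uvw: "\<And>x y. u x * v y \<le> (w ((x + y) / 2))\<^sup>2"
  shows "(\<integral>\<^sup>+x. u x \<partial>lborel) * (\<integral>\<^sup>+x. v x \<partial>lborel) \<le> (\<integral>\<^sup>+x. w x \<partial>lborel)\<^sup>2"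
proof -
  define a where "a = (SUP x. u x)"
  define b where "b = (SUP x. v x)"
  have ua: "u x \<le> a" and vb: "v x \<le> b" for x
    by (auto simp: a_def b_def intro: SUP_upper)
  have "a \<le> ennreal K" "b \<le> ennreal L" unfolding a_def b_def using bd by (auto intro: SUP_least)
  then obtain \<alpha> \<beta> where ab: "a = ennreal \<alpha>" "0 \<le> \<alpha>" "b = ennreal \<beta>" "0 \<le> \<beta>"
    by (cases a; cases b) (auto simp: top_unique)
  show ?thesis
  proof (cases "\<alpha> = 0 \<or> \<beta> = 0")
    case True
    then have "(\<forall>x. u x = 0) \<or> (\<forall>x. v x = 0)" using ua vb ab by auto
    then show ?thesis by auto
  next
    case False
    then have pos: "0 < \<alpha>" "0 < \<beta>" using ab by auto
    define c where "c = sqrt (\<alpha> * \<beta>)"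
    have c: "0 < c" "c\<^sup>2 = \<alpha> * \<beta>" using pos by (auto simp: c_def)
    define A where "A = (\<integral>\<^sup>+x. u x \<partial>lborel)"
    define B where "B = (\<integral>\<^sup>+x. v x \<partial>lborel)"
    define W where "W = (\<integral>\<^sup>+x. w x \<partial>lborel)"
    have sup: "\<exists>x. ennreal t < ennreal (1 / \<gamma>) * f x"
      if t: "0 < t" "t < 1" and g: "0 < \<gamma>" "(SUP x. f x) = ennreal \<gamma>" for t \<gamma> and f :: "real \<Rightarrow> ennreal"
    proof -
      have "ennreal (t * \<gamma>) < (SUP x. f x)"
        unfolding g(2) using t g by (simp add: ennreal_less_iff)
      then obtain x where x: "ennreal (t * \<gamma>) < f x" by (auto simp: less_SUP_iff)
      have "ennreal t < ennreal (1 / \<gamma>) * f x"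
        using x t g by (cases "f x") (auto simp: ennreal_less_iff ennreal_mult[symmetric] field_simps ennreal_mult_top)
      then show ?thesis ..
    qed
    have le1: "ennreal (1 / \<gamma>) * y \<le> 1" if "0 < \<gamma>" "y \<le> ennreal \<gamma>" for \<gamma> y
    proof -
      have "ennreal (1 / \<gamma>) * y \<le> ennreal (1 / \<gamma>) * ennreal \<gamma>" by (rule mult_left_mono) (use that in auto)
      also have "\<dots> = 1" using that by (simp add: ennreal_mult[symmetric])
      finally show ?thesis .
    qed
    have inv: "ennreal (1 / \<alpha>) * ennreal (1 / \<beta>) = (ennreal (1 / c))\<^sup>2"
      using pos c by (simp add: ennreal_mult[symmetric] ennreal_power power_divide)
    have "(\<integral>\<^sup>+x. ennreal (1 / \<alpha>) * u x \<partial>lborel) + (\<integral>\<^sup>+x. ennreal (1 / \<beta>) * v x \<partial>lborel)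
        \<le> 2 * (\<integral>\<^sup>+x. ennreal (1 / c) * w x \<partial>lborel)"
    proof (rule midpoint_integral_unit)
      fix x y
      have "ennreal (1 / \<alpha>) * u x * (ennreal (1 / \<beta>) * v y) = (ennreal (1 / c))\<^sup>2 * (u x * v y)"
        by (simp add: inv[symmetric] mult_ac)
      also have "\<dots> \<le> (ennreal (1 / c))\<^sup>2 * (w ((x + y) / 2))\<^sup>2"
        by (intro mult_left_mono uvw) auto
      finally show "ennreal (1 / \<alpha>) * u x * (ennreal (1 / \<beta>) * v y) \<le> (ennreal (1 / c) * w ((x + y) / 2))\<^sup>2"
        by (simp add: power_mult_distrib)
    qed (use ua vb ab pos le1 sup in \<open>auto simp: a_def b_def\<close>)
    then have s: "ennreal (1 / \<alpha>) * A + ennreal (1 / \<beta>) * B \<le> 2 * (ennreal (1 / c) * W)"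
      by (simp add: nn_integral_cmult A_def B_def W_def)
    have "4 * ((ennreal (1 / c))\<^sup>2 * (A * B)) = 4 * ((ennreal (1 / \<alpha>) * A) * (ennreal (1 / \<beta>) * B))"
      by (simp add: inv[symmetric] mult_ac)
    also have "\<dots> \<le> (ennreal (1 / \<alpha>) * A + ennreal (1 / \<beta>) * B)\<^sup>2" by (rule ennreal_arith_geo_mean)
    also have "\<dots> \<le> (2 * (ennreal (1 / c) * W))\<^sup>2" by (rule power_mono[OF s]) auto
    also have "\<dots> = 4 * ((ennreal (1 / c))\<^sup>2 * W\<^sup>2)" by (simp add: power_mult_distrib)
    finally have "ennreal (c\<^sup>2 / 4) * (4 * ((ennreal (1 / c))\<^sup>2 * (A * B)))
        \<le> ennreal (c\<^sup>2 / 4) * (4 * ((ennreal (1 / c))\<^sup>2 * W\<^sup>2))"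
      by (rule mult_left_mono) auto
    moreover have "ennreal (c\<^sup>2 / 4) * (4 * ((ennreal (1 / c))\<^sup>2 * z)) = z" for z
    proof -
      have "ennreal (c\<^sup>2 / 4) * (4 * ((ennreal (1 / c))\<^sup>2 * z)) = (ennreal (c\<^sup>2 / 4) * ennreal 4 * (ennreal (1 / c))\<^sup>2) * z"
        by (simp add: mult_ac)
      also have "ennreal (c\<^sup>2 / 4) * ennreal 4 * (ennreal (1 / c))\<^sup>2 = ennreal (c\<^sup>2 / 4 * 4 * (1 / c)\<^sup>2)"
        using c(1) by (simp add: ennreal_mult[symmetric] ennreal_power del: ennreal_numeral)
      also have "\<dots> = 1" using c(1) by (simp add: power_divide)
      finally show ?thesis by simp
    qed
    ultimately show ?thesis by (simp add: A_def B_def W_def)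
  qed
qed

text \<open>Truncation lowers \<open>u\<close> and \<open>v\<close> and so preserves the hypothesis
  with \<open>w\<close> unchanged. The two cutoffs go to infinity independently, as the product of
  the integrals is a double supremum.\<close>

lemma midpoint_ineq_lborel: "midpoint_ineq (lborel :: real measure) (\<lambda>x y. (x + y) / 2) (\<lambda>x y. 0)"
  unfolding midpoint_ineq_def
proof (intro ballI impI)
  fix u v w :: "real \<Rightarrow> ennreal"
  assume uvw[measurable]: "u \<in> borel_measurable lborel" "v \<in> borel_measurable lborel" "w \<in> borel_measurable lborel"
    and le: "\<forall>x\<in>space lborel. \<forall>y\<in>space lborel. u x * v y \<le> (w ((x + y) / 2))\<^sup>2 * ennreal (exp 0)"
  define U where "U k x = min (u x) (of_nat k)" for k x
  define V where "V k x = min (v x) (of_nat k)" for k x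
  have [measurable]: "U k \<in> borel_measurable borel" "V k \<in> borel_measurable borel" for k
    using uvw unfolding U_def V_def by auto
  have sup: "(SUP k. min y (of_nat k)) = y" for y :: ennreal
  proof (rule antisym)
    show "y \<le> (SUP k. min y (of_nat k))"
    proof (cases y)
      case (real r)
      obtain k where "r \<le> real k" using real_arch_simple by blast
      then have "y \<le> min y (of_nat k)" using real by (simp add: ennreal_of_nat_eq_real_of_nat ennreal_leI)
      then show ?thesis by (meson SUP_upper2 UNIV_I)
    next
      case top
      then show ?thesis by (simp add: ennreal_SUP_of_nat_eq_top)
    qed
  qed (auto intro: SUP_least)
  have I: "(\<integral>\<^sup>+x. f x \<partial>lborel) = (SUP k. \<integral>\<^sup>+x. min (f x) (of_nat k) \<partial>lborel)"
    if [measurable]: "f \<in> borel_measurable borel" for f :: "real \<Rightarrow> ennreal"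
    by (subst nn_integral_monotone_convergence_SUP[symmetric])
       (auto simp: sup incseq_def le_fun_def min.coboundedI2 intro!: min.mono)
  have "(\<integral>\<^sup>+x. U j x \<partial>lborel) * (\<integral>\<^sup>+x. V k x \<partial>lborel) \<le> (\<integral>\<^sup>+x. w x \<partial>lborel)\<^sup>2" for j k
  proof (rule midpoint_integral_bounded[where K="real j" and L="real k"])
    fix x y
    have "U j x * V k y \<le> u x * v y" by (intro mult_mono) (auto simp: U_def V_def)
    then show "U j x * V k y \<le> (w ((x + y) / 2))\<^sup>2" using le by (auto intro: order_trans)
  qed (use uvw in \<open>auto simp: U_def V_def ennreal_of_nat_eq_real_of_nat\<close>)
  then have "(SUP k. SUP j. (\<integral>\<^sup>+x. U j x \<partial>lborel) * (\<integral>\<^sup>+x. V k x \<partial>lborel)) \<le> (\<integral>\<^sup>+x. w x \<partial>lborel)\<^sup>2"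
    by (intro SUP_least)
  then show "(\<integral>\<^sup>+x. u x \<partial>lborel) * (\<integral>\<^sup>+x. v x \<partial>lborel) \<le> (\<integral>\<^sup>+x. w x \<partial>lborel)\<^sup>2"
    using uvw by (simp add: I[of u] I[of v] U_def V_def SUP_mult_left_ennreal SUP_mult_right_ennreal)
qed

section \<open>Tensorization and Gaussian concentration\<close>

text \<open>Slices at \<open>t\<close> and \<open>t'\<close> in the new coordinate fall under the
  induction hypothesis, the cost of that coordinate being a constant factor. The integrals of the
  slices then satisfy the one-coordinate hypothesis with exactly this cost, and Fubini
  concludes.\<close>

lemma midpoint_ineq_PiM:
  fixes N :: "'i \<Rightarrow> 'b measure"
  assumes sf: "product_sigma_finite N" and fin: "finite I"
    and sp: "\<And>i. space (N i) = UNIV"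
    and mid: "\<And>i. i \<in> I \<Longrightarrow> midpoint_ineq (N i) m c"
  shows "midpoint_ineq (Pi\<^sub>M I N) (\<lambda>x y. \<lambda>i\<in>I. m (x i) (y i)) (\<lambda>x y. \<Sum>i\<in>I. c (x i) (y i))"
  using fin mid
proof (induction I)
  case empty
  interpret product_sigma_finite N by (rule sf)
  show ?case
    unfolding midpoint_ineq_def by (auto simp: PiM_empty nn_integral_count_space_finite restrict_def)
next
  case (insert i I)
  interpret product_sigma_finite N by (rule sf)
  have IH: "midpoint_ineq (Pi\<^sub>M I N) (\<lambda>x y. \<lambda>j\<in>I. m (x j) (y j)) (\<lambda>x y. \<Sum>j\<in>I. c (x j) (y j))"
    using insert by blast
  show ?case
    unfolding midpoint_ineq_def
  proof (intro ballI impI)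
    fix u v w :: "('i \<Rightarrow> 'b) \<Rightarrow> ennreal"
    assume uvw[measurable]: "u \<in> borel_measurable (Pi\<^sub>M (insert i I) N)" "v \<in> borel_measurable (Pi\<^sub>M (insert i I) N)"
        "w \<in> borel_measurable (Pi\<^sub>M (insert i I) N)"
      and le: "\<forall>x\<in>space (Pi\<^sub>M (insert i I) N). \<forall>y\<in>space (Pi\<^sub>M (insert i I) N).
        u x * v y \<le> (w (\<lambda>j\<in>insert i I. m (x j) (y j)))\<^sup>2 * ennreal (exp (\<Sum>j\<in>insert i I. c (x j) (y j)))"
    define U where "U u t = (\<integral>\<^sup>+x. u (x(i := t)) \<partial>Pi\<^sub>M I N)" for u :: "('i \<Rightarrow> 'b) \<Rightarrow> ennreal" and t
    interpret I: finite_product_sigma_finite N I using insert by unfold_locales auto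
    have meas1: "(\<lambda>x. f (x(i := t))) \<in> borel_measurable (Pi\<^sub>M I N)"
      if [measurable]: "f \<in> borel_measurable (Pi\<^sub>M (insert i I) N)" for f :: "('i \<Rightarrow> 'b) \<Rightarrow> ennreal" and t
    proof -
      have [measurable]: "t \<in> space (N i)" by (simp add: sp)
      show ?thesis by measurable
    qed
    have measU: "U f \<in> borel_measurable (N i)"
      if [measurable]: "f \<in> borel_measurable (Pi\<^sub>M (insert i I) N)" for f
      unfolding U_def by measurable
    have "U u t * U v t' \<le> (U w (m t t'))\<^sup>2 * ennreal (exp (c t t'))" for t t'
    proof -
      \<comment> \<open>The cost of the new coordinate is moved into \<open>w\<close>, with half the
        exponent because \<open>w\<close> enters squared.\<close>
      define e where "e = ennreal (exp (c t t' / 2))"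
      have e2: "e\<^sup>2 = ennreal (exp (c t t'))"
        by (simp add: e_def ennreal_power exp_double[symmetric])
      have "(\<integral>\<^sup>+x. u (x(i := t)) \<partial>Pi\<^sub>M I N) * (\<integral>\<^sup>+x. v (x(i := t')) \<partial>Pi\<^sub>M I N)
          \<le> (\<integral>\<^sup>+x. e * w (x(i := m t t')) \<partial>Pi\<^sub>M I N)\<^sup>2"
      proof (rule midpoint_ineqD[OF IH])
        fix x y assume xy: "x \<in> space (Pi\<^sub>M I N)" "y \<in> space (Pi\<^sub>M I N)"
        have ext: "x(i := t) \<in> space (Pi\<^sub>M (insert i I) N)" "y(i := t') \<in> space (Pi\<^sub>M (insert i I) N)"
          using xy by (auto simp: space_PiM sp PiE_def extensional_def)
        have m: "(\<lambda>j\<in>insert i I. m ((x(i := t)) j) ((y(i := t')) j)) = (\<lambda>j\<in>I. m (x j) (y j))(i := m t t')"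
          using insert(2) by (auto simp: fun_eq_iff restrict_def)
        have "(\<Sum>j\<in>I. c ((x(i := t)) j) ((y(i := t')) j)) = (\<Sum>j\<in>I. c (x j) (y j))"
          using insert(2) by (intro sum.cong) auto
        then have s: "(\<Sum>j\<in>insert i I. c ((x(i := t)) j) ((y(i := t')) j)) = c t t' + (\<Sum>j\<in>I. c (x j) (y j))"
          using insert(1,2) by simp
        have "u (x(i := t)) * v (y(i := t')) \<le> (w ((\<lambda>j\<in>I. m (x j) (y j))(i := m t t')))\<^sup>2
            * ennreal (exp (c t t' + (\<Sum>j\<in>I. c (x j) (y j))))"
          using le[rule_format, OF ext] unfolding m s .
        also have "\<dots> = (e * w ((\<lambda>j\<in>I. m (x j) (y j))(i := m t t')))\<^sup>2 * ennreal (exp (\<Sum>j\<in>I. c (x j) (y j)))"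
          by (simp add: power_mult_distrib e2 exp_add ennreal_mult mult_ac)
        finally show "u (x(i := t)) * v (y(i := t')) \<le> (e * w ((\<lambda>j\<in>I. m (x j) (y j))(i := m t t')))\<^sup>2
            * ennreal (exp (\<Sum>j\<in>I. c (x j) (y j)))" .
      qed (use meas1[OF uvw(1)] meas1[OF uvw(2)] meas1[OF uvw(3)] in measurable)
      also have "(\<integral>\<^sup>+x. e * w (x(i := m t t')) \<partial>Pi\<^sub>M I N) = e * U w (m t t')"
        unfolding U_def by (intro nn_integral_cmult meas1 uvw)
      finally show ?thesis
        by (simp add: U_def fun_upd_def power_mult_distrib e2 mult_ac)
    qed
    then have "(\<integral>\<^sup>+t. U u t \<partial>N i) * (\<integral>\<^sup>+t. U v t \<partial>N i) \<le> (\<integral>\<^sup>+t. U w t \<partial>N i)\<^sup>2"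
      by (intro midpoint_ineqD[of "N i" m c] insert(4) measU uvw) auto
    then show "(\<integral>\<^sup>+x. u x \<partial>Pi\<^sub>M (insert i I) N) * (\<integral>\<^sup>+x. v x \<partial>Pi\<^sub>M (insert i I) N)
        \<le> (\<integral>\<^sup>+x. w x \<partial>Pi\<^sub>M (insert i I) N)\<^sup>2"
      unfolding U_def by (simp add: product_nn_integral_insert_rev[OF insert(1,2)] uvw)
  qed
qed

lemma midpoint_ineq_distr:
  assumes N: "midpoint_ineq N m c" and g[measurable]: "g \<in> measurable N N'"
    and m: "\<And>x y. x \<in> space N \<Longrightarrow> y \<in> space N \<Longrightarrow> m' (g x) (g y) = g (m x y)"
    and c: "\<And>x y. x \<in> space N \<Longrightarrow> y \<in> space N \<Longrightarrow> c' (g x) (g y) = c x y"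
  shows "midpoint_ineq (distr N N' g) m' c'"
  unfolding midpoint_ineq_def
proof (intro ballI impI)
  fix u v w :: "_ \<Rightarrow> ennreal"
  assume [measurable]: "u \<in> borel_measurable (distr N N' g)" "v \<in> borel_measurable (distr N N' g)" "w \<in> borel_measurable (distr N N' g)"
    and le: "\<forall>x\<in>space (distr N N' g). \<forall>y\<in>space (distr N N' g). u x * v y \<le> (w (m' x y))\<^sup>2 * ennreal (exp (c' x y))"
  have "(\<integral>\<^sup>+x. u (g x) \<partial>N) * (\<integral>\<^sup>+x. v (g x) \<partial>N) \<le> (\<integral>\<^sup>+x. w (g x) \<partial>N)\<^sup>2"
  proof (rule midpoint_ineqD[OF N])
    fix x y assume xy: "x \<in> space N" "y \<in> space N"
    have "g x \<in> space N'" "g y \<in> space N'" using measurable_space[OF g] xy by auto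
    then show "u (g x) * v (g y) \<le> (w (g (m x y)))\<^sup>2 * ennreal (exp (c x y))"
      using le m[OF xy] c[OF xy] by (metis space_distr)
  qed auto
  then show "(\<integral>\<^sup>+x. u x \<partial>distr N N' g) * (\<integral>\<^sup>+x. v x \<partial>distr N N' g) \<le> (\<integral>\<^sup>+x. w x \<partial>distr N N' g)\<^sup>2"
    by (simp add: nn_integral_distr)
qed

text \<open>The density is multiplied into all three functions. The assumption on
  \<open>\<rho>\<close> quantifies its log-concavity at midpoints, and this surplus buys the passage
  from the cost \<open>c0\<close> to the cost \<open>c\<close>.\<close>

lemma midpoint_ineq_density:
  assumes N: "midpoint_ineq N m c0" and [measurable]: "\<rho> \<in> borel_measurable N"
    and \<rho>: "\<And>x y. x \<in> space N \<Longrightarrow> y \<in> space N \<Longrightarrow>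
      \<rho> x * \<rho> y * ennreal (exp (c x y)) \<le> (\<rho> (m x y))\<^sup>2 * ennreal (exp (c0 x y))"
  shows "midpoint_ineq (density N \<rho>) m c"
  unfolding midpoint_ineq_def
proof (intro ballI impI)
  fix u v w :: "_ \<Rightarrow> ennreal"
  assume uvw: "u \<in> borel_measurable (density N \<rho>)" "v \<in> borel_measurable (density N \<rho>)" "w \<in> borel_measurable (density N \<rho>)"
    and le: "\<forall>x\<in>space (density N \<rho>). \<forall>y\<in>space (density N \<rho>). u x * v y \<le> (w (m x y))\<^sup>2 * ennreal (exp (c x y))"
  note [measurable] = uvw[simplified]
  have "(\<integral>\<^sup>+x. \<rho> x * u x \<partial>N) * (\<integral>\<^sup>+x. \<rho> x * v x \<partial>N) \<le> (\<integral>\<^sup>+x. \<rho> x * w x \<partial>N)\<^sup>2"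
  proof (rule midpoint_ineqD[OF N])
    fix x y assume xy: "x \<in> space N" "y \<in> space N"
    have "\<rho> x * u x * (\<rho> y * v y) = \<rho> x * \<rho> y * (u x * v y)" by (simp add: mult_ac)
    also have "\<dots> \<le> \<rho> x * \<rho> y * ((w (m x y))\<^sup>2 * ennreal (exp (c x y)))"
      using le xy by (intro mult_left_mono) auto
    also have "\<dots> = (\<rho> x * \<rho> y * ennreal (exp (c x y))) * (w (m x y))\<^sup>2" by (simp add: mult_ac)
    also have "\<dots> \<le> ((\<rho> (m x y))\<^sup>2 * ennreal (exp (c0 x y))) * (w (m x y))\<^sup>2"
      by (intro mult_right_mono \<rho> xy) auto
    finally show "\<rho> x * u x * (\<rho> y * v y) \<le> (\<rho> (m x y) * w (m x y))\<^sup>2 * ennreal (exp (c0 x y))"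
      by (simp add: power_mult_distrib mult_ac)
  qed auto
  then show "(\<integral>\<^sup>+x. u x \<partial>density N \<rho>) * (\<integral>\<^sup>+x. v x \<partial>density N \<rho>) \<le> (\<integral>\<^sup>+x. w x \<partial>density N \<rho>)\<^sup>2"
    by (simp add: nn_integral_density)
qed

section \<open>Standard Gaussian measures\<close>

definition std_gauss :: "real measure" where
  "std_gauss = density lborel (\<lambda>x. ennreal (std_normal_density x))"

lemma midpoint_ineq_std_gauss:
  "midpoint_ineq std_gauss (\<lambda>x y. (x + y) / 2) (\<lambda>x y. (x - y)\<^sup>2 / 4)"
  unfolding std_gauss_def
proof (rule midpoint_ineq_density[OF midpoint_ineq_lborel])
  fix x y :: real
  have "- x\<^sup>2 / 2 + - y\<^sup>2 / 2 + (x - y)\<^sup>2 / 4 = - ((x + y) / 2)\<^sup>2 / 2 + - ((x + y) / 2)\<^sup>2 / 2"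
    by (simp add: power2_eq_square field_simps)
  then have "exp (- x\<^sup>2 / 2) * exp (- y\<^sup>2 / 2) * exp ((x - y)\<^sup>2 / 4) = (exp (- ((x + y) / 2)\<^sup>2 / 2))\<^sup>2"
    by (simp add: exp_add[symmetric] power2_eq_square[of "exp _"])
  then have "std_normal_density x * std_normal_density y * exp ((x - y)\<^sup>2 / 4) = (std_normal_density ((x + y) / 2))\<^sup>2"
    unfolding std_normal_density_def by (simp add: power_mult_distrib power_divide mult_ac)
  then show "ennreal (std_normal_density x) * ennreal (std_normal_density y) * ennreal (exp ((x - y)\<^sup>2 / 4))
      \<le> (ennreal (std_normal_density ((x + y) / 2)))\<^sup>2 * ennreal (exp 0)"
    by (simp add: ennreal_mult[symmetric] ennreal_power)
qed simp

lemma prob_space_std_gauss: "prob_space std_gauss"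
  unfolding std_gauss_def by (rule prob_space_normal_density) simp

lemma space_std_gauss [simp]: "space std_gauss = UNIV"
  by (simp add: std_gauss_def)

lemma sets_std_gauss [simp, measurable_cong]: "sets std_gauss = sets borel"
  by (simp add: std_gauss_def)

text \<open>Built from independent coordinates, so that tensorization and moments can be treated
  coordinatewise; \<open>std_gauss_vec_density\<close> supplies the density for the comparison with
  \<open>mvn\<close>.\<close>

definition std_gauss_vec :: "'v::euclidean_space measure" where
  "std_gauss_vec = distr (Pi\<^sub>M Basis (\<lambda>_. std_gauss)) borel (\<lambda>f. \<Sum>b\<in>Basis. f b *\<^sub>R b)"

lemma product_sigma_finite_std_gauss: "product_sigma_finite (\<lambda>_. std_gauss)"
  by (intro product_sigma_finite.intro prob_space_imp_sigma_finite prob_space_std_gauss)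

lemma prob_space_std_gauss_vec: "prob_space (std_gauss_vec :: 'v::euclidean_space measure)"
  unfolding std_gauss_vec_def
  by (intro prob_space.prob_space_distr prob_space_PiM prob_space_std_gauss) measurable

lemma space_std_gauss_vec [simp]: "space std_gauss_vec = UNIV"
  by (simp add: std_gauss_vec_def)

lemma sets_std_gauss_vec [simp, measurable_cong]: "sets std_gauss_vec = sets borel"
  by (simp add: std_gauss_vec_def)

lemma midpoint_ineq_std_gauss_vec:
  "midpoint_ineq (std_gauss_vec :: 'v::euclidean_space measure) (\<lambda>x y. (1/2) *\<^sub>R (x + y)) (\<lambda>x y. (norm (x - y))\<^sup>2 / 4)"
  unfolding std_gauss_vec_def
proof (rule midpoint_ineq_distr)
  show "midpoint_ineq (Pi\<^sub>M Basis (\<lambda>_::'v. std_gauss)) (\<lambda>x y. \<lambda>i\<in>Basis. (x i + y i) / 2) (\<lambda>x y. \<Sum>i\<in>Basis. (x i - y i)\<^sup>2 / 4)"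
    by (intro midpoint_ineq_PiM product_sigma_finite_std_gauss midpoint_ineq_std_gauss) auto
  fix x y :: "'v \<Rightarrow> real"
  show "(1/2) *\<^sub>R ((\<Sum>b\<in>Basis. x b *\<^sub>R b) + (\<Sum>b\<in>Basis. y b *\<^sub>R b)) = (\<Sum>b\<in>Basis. (\<lambda>i\<in>Basis. (x i + y i) / 2) b *\<^sub>R b)"
    by (simp add: sum.distrib[symmetric] scaleR_sum_right scaleR_add_left[symmetric])
  have "(norm ((\<Sum>b\<in>Basis. x b *\<^sub>R b) - (\<Sum>b\<in>Basis. y b *\<^sub>R b)))\<^sup>2 = (norm (\<Sum>b\<in>Basis. (x b - y b) *\<^sub>R b))\<^sup>2"
    by (simp add: sum_subtractf scaleR_diff_left)
  also have "\<dots> = (\<Sum>b\<in>Basis. (x b - y b)\<^sup>2)"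
    by (subst norm_sum_Pythagorean) (auto simp: pairwise_def orthogonal_def inner_Basis)
  finally show "(norm ((\<Sum>b\<in>Basis. x b *\<^sub>R b) - (\<Sum>b\<in>Basis. y b *\<^sub>R b)))\<^sup>2 / 4 = (\<Sum>i\<in>Basis. (x i - y i)\<^sup>2 / 4)"
    by (simp add: sum_divide_distrib)
qed measurable


section \<open>Exponential moments and Gaussian tails\<close>

text \<open>The midpoint inequality for \<open>u\<close> = exp (sigma f), \<open>v\<close> = 1 and
  \<open>w\<close> = exp (sigma^2 / 8) exp (sigma f / 2). The Lipschitz hypothesis compares
  \<open>x\<close> only with the midpoint: for the Gaussian cost, \<open>sqrt (c x y)\<close> is the
  distance from \<open>x\<close> to \<open>m x y\<close>.\<close>

lemma midpoint_ineq_exp_halving: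
  fixes f :: "'b \<Rightarrow> real"
  assumes N: "midpoint_ineq N m c" and ps: "prob_space N" and [measurable]: "f \<in> borel_measurable N"
    and c: "\<And>x y. 0 \<le> c x y"
    and lip: "\<And>x y. x \<in> space N \<Longrightarrow> y \<in> space N \<Longrightarrow> f x \<le> f (m x y) + sqrt (c x y)"
    and \<sigma>: "0 \<le> \<sigma>"
  shows "(\<integral>\<^sup>+x. ennreal (exp (\<sigma> * f x)) \<partial>N) \<le> ennreal (exp (\<sigma>\<^sup>2 / 4)) * (\<integral>\<^sup>+x. ennreal (exp (\<sigma> / 2 * f x)) \<partial>N)\<^sup>2"
proof -
  interpret prob_space N by (rule ps)
  have "(\<integral>\<^sup>+x. ennreal (exp (\<sigma> * f x)) \<partial>N) * (\<integral>\<^sup>+x. 1 \<partial>N)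
      \<le> (\<integral>\<^sup>+x. ennreal (exp (\<sigma>\<^sup>2 / 8)) * ennreal (exp (\<sigma> / 2 * f x)) \<partial>N)\<^sup>2"
  proof (rule midpoint_ineqD[OF N])
    fix x y assume xy: "x \<in> space N" "y \<in> space N"
    \<comment> \<open>Young's inequality: the square of sigma / 2 - sqrt c is nonnegative.\<close>
    have "\<sigma> * sqrt (c x y) \<le> \<sigma>\<^sup>2 / 4 + c x y"
      using zero_le_power2[of "\<sigma> / 2 - sqrt (c x y)"] c[of x y] by (simp add: power2_eq_square algebra_simps)
    moreover have "\<sigma> * f x \<le> \<sigma> * (f (m x y) + sqrt (c x y))" by (intro mult_left_mono lip xy \<sigma>)
    ultimately have "\<sigma> * f x \<le> 2 * (\<sigma>\<^sup>2 / 8) + 2 * (\<sigma> / 2 * f (m x y)) + c x y"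
      by (simp add: algebra_simps)
    then have "exp (\<sigma> * f x) \<le> (exp (\<sigma>\<^sup>2 / 8) * exp (\<sigma> / 2 * f (m x y)))\<^sup>2 * exp (c x y)"
      unfolding power_mult_distrib exp_double[symmetric] exp_add[symmetric] exp_le_cancel_iff by simp
    then show "ennreal (exp (\<sigma> * f x)) * 1
        \<le> (ennreal (exp (\<sigma>\<^sup>2 / 8)) * ennreal (exp (\<sigma> / 2 * f (m x y))))\<^sup>2 * ennreal (exp (c x y))"
      by (simp add: ennreal_mult[symmetric] ennreal_power)
  qed auto
  also have "(\<integral>\<^sup>+x. ennreal (exp (\<sigma>\<^sup>2 / 8)) * ennreal (exp (\<sigma> / 2 * f x)) \<partial>N)
      = ennreal (exp (\<sigma>\<^sup>2 / 8)) * (\<integral>\<^sup>+x. ennreal (exp (\<sigma> / 2 * f x)) \<partial>N)"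
    by (rule nn_integral_cmult) measurable
  also have "\<dots>\<^sup>2 = ennreal (exp (\<sigma>\<^sup>2 / 4)) * (\<integral>\<^sup>+x. ennreal (exp (\<sigma> / 2 * f x)) \<partial>N)\<^sup>2"
    by (simp add: power_mult_distrib ennreal_power exp_double[symmetric])
  finally show ?thesis by (simp add: emeasure_space_1)
qed

text \<open>Iterated halving leaves the 2^k-th power of the exponential moment at sigma / 2^k. For
  such small parameters only the mean of \<open>f\<close> matters, and the bound \<open>K\<close>
  makes the Taylor remainder uniform.\<close>

lemma midpoint_ineq_mgf:
  fixes f :: "'b \<Rightarrow> real"
  assumes N: "midpoint_ineq N m c" and ps: "prob_space N" and [measurable]: "f \<in> borel_measurable N"
    and c: "\<And>x y. 0 \<le> c x y"
    and lip: "\<And>x y. x \<in> space N \<Longrightarrow> y \<in> space N \<Longrightarrow> f x \<le> f (m x y) + sqrt (c x y)"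
    and bd: "\<And>x. 0 \<le> f x" "\<And>x. f x \<le> K"
    and \<sigma>: "0 \<le> \<sigma>"
  shows "(\<integral>x. exp (\<sigma> * f x) \<partial>N) \<le> exp (\<sigma> * (\<integral>x. f x \<partial>N) + \<sigma>\<^sup>2 / 2)"
proof -
  interpret prob_space N by (rule ps)
  have K: "0 \<le> K" using bd order_trans by blast
  define A where "A \<tau> = (\<integral>x. exp (\<tau> * f x) \<partial>N)" for \<tau>
  define E where "E = (\<integral>x. f x \<partial>N)"
  have int_exp: "integrable N (\<lambda>x. exp (\<tau> * f x))" if "0 \<le> \<tau>" for \<tau>
    using bd that by (intro integrable_const_bound[where B="exp (\<tau> * K)"]) (auto intro!: mult_left_mono)
  have int_f: "integrable N f"
    using bd by (intro integrable_const_bound[where B=K]) auto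
  have A0: "0 \<le> A \<tau>" for \<tau> unfolding A_def by (rule integral_nonneg_AE) auto
  have halve: "A \<tau> \<le> exp (\<tau>\<^sup>2 / 4) * (A (\<tau> / 2))\<^sup>2" if t: "0 \<le> \<tau>" for \<tau>
  proof -
    have nn: "(\<integral>\<^sup>+x. ennreal (exp (\<tau> * f x)) \<partial>N) = ennreal (A \<tau>)" if "0 \<le> \<tau>" for \<tau>
      unfolding A_def by (rule nn_integral_eq_integral[OF int_exp[OF that]]) auto
    have "ennreal (A \<tau>) \<le> ennreal (exp (\<tau>\<^sup>2 / 4)) * (ennreal (A (\<tau> / 2)))\<^sup>2"
    proof -
      have h: "(\<integral>\<^sup>+x. ennreal (exp (\<tau> * f x)) \<partial>N)
          \<le> ennreal (exp (\<tau>\<^sup>2 / 4)) * (\<integral>\<^sup>+x. ennreal (exp (\<tau> / 2 * f x)) \<partial>N)\<^sup>2"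
        by (rule midpoint_ineq_exp_halving[where m=m and c=c])
          (fact N | fact ps | fact assms(3) | fact c | fact lip | fact t)+
      have t2: "0 \<le> \<tau> / 2" using t by simp
      show ?thesis using h unfolding nn[OF t] nn[OF t2] .
    qed
    then show ?thesis by (simp add: ennreal_power ennreal_mult[symmetric] A0)
  qed
  \<comment> \<open>Stage k contributes 2^k * (sigma / 2^k)^2 / 4 = sigma^2 / 2^(k + 2) to the
    exponent, a geometric series with sum sigma^2 / 2.\<close>
  have iter: "A \<sigma> \<le> exp (\<sigma>\<^sup>2 / 2 * (1 - 1 / 2 ^ k)) * A (\<sigma> / 2 ^ k) ^ (2 ^ k)" for k
  proof (induction k)
    case (Suc k)
    have "A (\<sigma> / 2 ^ k) ^ (2 ^ k) \<le> (exp ((\<sigma> / 2 ^ k)\<^sup>2 / 4) * (A (\<sigma> / 2 ^ k / 2))\<^sup>2) ^ (2 ^ k)"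
      using \<sigma> by (intro power_mono halve A0) auto
    also have "\<dots> = exp (2 ^ k * ((\<sigma> / 2 ^ k)\<^sup>2 / 4)) * A (\<sigma> / 2 ^ Suc k) ^ (2 ^ Suc k)"
      using exp_of_nat_mult[of "2 ^ k" "(\<sigma> / 2 ^ k)\<^sup>2 / 4"]
      by (simp add: power_mult_distrib power_mult[symmetric] mult.commute)
    finally have "A \<sigma> \<le> exp (\<sigma>\<^sup>2 / 2 * (1 - 1 / 2 ^ k)) *
        (exp (2 ^ k * ((\<sigma> / 2 ^ k)\<^sup>2 / 4)) * A (\<sigma> / 2 ^ Suc k) ^ (2 ^ Suc k))"
      using Suc by (meson mult_left_mono order_trans exp_ge_zero)
    also have "\<dots> = exp (\<sigma>\<^sup>2 / 2 * (1 - 1 / 2 ^ k) + 2 ^ k * ((\<sigma> / 2 ^ k)\<^sup>2 / 4)) * A (\<sigma> / 2 ^ Suc k) ^ (2 ^ Suc k)"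
      by (simp add: exp_add)
    also have "\<sigma>\<^sup>2 / 2 * (1 - 1 / 2 ^ k) + 2 ^ k * ((\<sigma> / 2 ^ k)\<^sup>2 / 4) = \<sigma>\<^sup>2 / 2 * (1 - 1 / 2 ^ Suc k)"
      by (simp add: power_divide power2_eq_square field_simps)
    finally show ?case .
  qed (simp add: A_def)
  \<comment> \<open>The remainder tau^2 K^2, at tau = sigma / 2^k and after raising to the power
    2^k, becomes sigma^2 K^2 / 2^k and vanishes in the limit.\<close>
  have small: "A \<tau> \<le> exp (\<tau> * E + \<tau>\<^sup>2 * K\<^sup>2)" if t: "0 \<le> \<tau>" "\<tau> * K \<le> 1" for \<tau>
  proof -
    have "exp (\<tau> * f x) \<le> 1 + \<tau> * f x + \<tau>\<^sup>2 * K\<^sup>2" for x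
    proof -
      have "\<tau> * f x \<le> \<tau> * K" using t bd by (intro mult_left_mono) auto
      then have "exp (\<tau> * f x) \<le> 1 + \<tau> * f x + (\<tau> * f x)\<^sup>2" using t bd by (intro exp_bound) auto
      moreover have "(\<tau> * f x)\<^sup>2 \<le> (\<tau> * K)\<^sup>2" using t bd by (intro power_mono mult_left_mono) auto
      ultimately show ?thesis by (simp add: power_mult_distrib)
    qed
    then have "A \<tau> \<le> (\<integral>x. 1 + \<tau> * f x + \<tau>\<^sup>2 * K\<^sup>2 \<partial>N)"
      unfolding A_def using t int_f by (intro integral_mono int_exp) auto
    also have "\<dots> = 1 + (\<tau> * E + \<tau>\<^sup>2 * K\<^sup>2)" using int_f by (simp add: prob_space E_def)
    also have "\<dots> \<le> exp (\<tau> * E + \<tau>\<^sup>2 * K\<^sup>2)" by (rule exp_ge_add_one_self)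
    finally show ?thesis .
  qed
  have lim0: "(\<lambda>k. 1 / 2 ^ k :: real) \<longlonglongrightarrow> 0" by real_asymp
  have "\<forall>\<^sub>F k in sequentially. A \<sigma> \<le> exp (\<sigma>\<^sup>2 / 2 * (1 - 1 / 2 ^ k) + (\<sigma> * E + \<sigma>\<^sup>2 * K\<^sup>2 * (1 / 2 ^ k)))"
  proof -
    have "(\<lambda>k. \<sigma> * K * (1 / 2 ^ k)) \<longlonglongrightarrow> \<sigma> * K * 0" by (intro tendsto_intros lim0)
    then have "\<forall>\<^sub>F k in sequentially. \<sigma> * K * (1 / 2 ^ k) < 1" by (intro order_tendstoD) auto
    then show ?thesis
    proof eventually_elim
      case (elim k)
      have "A (\<sigma> / 2 ^ k) \<le> exp (\<sigma> / 2 ^ k * E + (\<sigma> / 2 ^ k)\<^sup>2 * K\<^sup>2)"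
        using elim \<sigma> by (intro small) auto
      then have "A (\<sigma> / 2 ^ k) ^ (2 ^ k) \<le> exp (\<sigma> / 2 ^ k * E + (\<sigma> / 2 ^ k)\<^sup>2 * K\<^sup>2) ^ (2 ^ k)"
        by (intro power_mono A0)
      also have "\<dots> = exp (2 ^ k * (\<sigma> / 2 ^ k * E + (\<sigma> / 2 ^ k)\<^sup>2 * K\<^sup>2))"
        using exp_of_nat_mult[of "2 ^ k" "\<sigma> / 2 ^ k * E + (\<sigma> / 2 ^ k)\<^sup>2 * K\<^sup>2"] by simp
      also have "2 ^ k * (\<sigma> / 2 ^ k * E + (\<sigma> / 2 ^ k)\<^sup>2 * K\<^sup>2) = \<sigma> * E + \<sigma>\<^sup>2 * K\<^sup>2 * (1 / 2 ^ k)"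
        by (simp add: power2_eq_square field_simps)
      finally have "A (\<sigma> / 2 ^ k) ^ (2 ^ k) \<le> exp (\<sigma> * E + \<sigma>\<^sup>2 * K\<^sup>2 * (1 / 2 ^ k))" .
      then show ?case
        unfolding exp_add[of "\<sigma>\<^sup>2 / 2 * (1 - 1 / 2 ^ k)"]
        by (meson iter mult_left_mono order_trans exp_ge_zero)
    qed
  qed
  moreover have "(\<lambda>k. exp (\<sigma>\<^sup>2 / 2 * (1 - 1 / 2 ^ k) + (\<sigma> * E + \<sigma>\<^sup>2 * K\<^sup>2 * (1 / 2 ^ k))))
      \<longlonglongrightarrow> exp (\<sigma>\<^sup>2 / 2 * (1 - 0) + (\<sigma> * E + \<sigma>\<^sup>2 * K\<^sup>2 * 0))"
    by (intro tendsto_intros lim0)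
  ultimately have "A \<sigma> \<le> exp (\<sigma>\<^sup>2 / 2 * (1 - 0) + (\<sigma> * E + \<sigma>\<^sup>2 * K\<^sup>2 * 0))"
    by (intro tendsto_lowerbound) auto
  then show ?thesis by (simp add: A_def E_def add.commute)
qed

text \<open>Chernoff's bound with parameter \<open>t\<close>, the minimizer of s^2 / 2 - s t.
  Truncating \<open>f\<close> at \<open>\<mu> + t\<close> provides the boundedness for
  \<open>midpoint_ineq_mgf\<close>, keeps the Lipschitz property, does not raise the mean and leaves
  the event unchanged.\<close>

lemma midpoint_ineq_tail:
  fixes f :: "'b \<Rightarrow> real"
  assumes N: "midpoint_ineq N m c" and ps: "prob_space N" and [measurable]: "f \<in> borel_measurable N"
    and c: "\<And>x y. 0 \<le> c x y"
    and lip: "\<And>x y. x \<in> space N \<Longrightarrow> y \<in> space N \<Longrightarrow> f x \<le> f (m x y) + sqrt (c x y)"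
    and nonneg: "\<And>x. 0 \<le> f x" and int: "integrable N f" and mean: "(\<integral>x. f x \<partial>N) \<le> \<mu>" and t: "0 \<le> t"
  shows "measure N {x\<in>space N. \<mu> + t \<le> f x} \<le> exp (- t\<^sup>2 / 2)"
proof -
  interpret prob_space N by (rule ps)
  define a where "a = \<mu> + t"
  define g where "g x = min (f x) a" for x
  have [measurable]: "g \<in> borel_measurable N" unfolding g_def by measurable
  have "0 \<le> (\<integral>x. f x \<partial>N)" by (intro integral_nonneg_AE) (auto simp: nonneg)
  then have a: "0 \<le> a" using mean t by (simp add: a_def)
  have g: "0 \<le> g x" "g x \<le> a" for x using nonneg a by (auto simp: g_def)
  have glip: "g x \<le> g (m x y) + sqrt (c x y)" if "x \<in> space N" "y \<in> space N" for x y
    using lip[OF that] real_sqrt_ge_zero[OF c[of x y]] unfolding g_def by linarith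
  have ge: "(\<integral>x. g x \<partial>N) \<le> \<mu>"
  proof -
    have "(\<integral>x. g x \<partial>N) \<le> (\<integral>x. f x \<partial>N)"
      by (intro integral_mono int integrable_const_bound[where B=a]) (use g in \<open>auto simp: g_def\<close>)
    then show ?thesis using mean by simp
  qed
  have "(\<integral>x. exp (t * g x) \<partial>N) \<le> exp (t * (\<integral>x. g x \<partial>N) + t\<^sup>2 / 2)"
  proof (rule midpoint_ineq_mgf[where m=m and c=c and K=a and f=g and \<sigma>=t])
    show "midpoint_ineq N m c" "prob_space N" "0 \<le> t" by fact+
    show "g \<in> borel_measurable N" by measurable
    show "0 \<le> c x y" for x y by (rule c)
    show "g x \<le> g (m x y) + sqrt (c x y)" if "x \<in> space N" "y \<in> space N" for x y by (rule glip[OF that])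
    show "0 \<le> g x" "g x \<le> a" for x by (rule g)+
  qed
  also have "\<dots> \<le> exp (t * \<mu> + t\<^sup>2 / 2)" using ge t by (simp add: mult_left_mono)
  finally have mgf: "(\<integral>x. exp (t * g x) \<partial>N) \<le> exp (t * \<mu> + t\<^sup>2 / 2)" .
  have "measure N {x\<in>space N. \<mu> + t \<le> f x} \<le> measure N {x\<in>space N. exp (t * a) \<le> exp (t * g x)}"
    by (rule finite_measure_mono) (use t in \<open>auto simp: g_def a_def min_def mult_left_mono\<close>)
  also have "\<dots> \<le> (\<integral>x. exp (t * g x) \<partial>N) / exp (t * a)"
  proof (rule integral_Markov_inequality_measure[where A="{}"])
    show "integrable N (\<lambda>x. exp (t * g x))"
      using g t by (intro integrable_const_bound[where B="exp (t * a)"]) (auto intro!: mult_left_mono)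
  qed auto
  also have "\<dots> \<le> exp (t * \<mu> + t\<^sup>2 / 2) / exp (t * a)"
    by (intro divide_right_mono mgf) auto
  also have "\<dots> = exp (- t\<^sup>2 / 2)"
    by (simp add: exp_diff[symmetric] a_def power2_eq_square algebra_simps)
  finally show ?thesis .
qed

section \<open>Matrices and the least squares estimator\<close>

lemma power2_norm_rows: "(norm (A :: real^'m^'n))\<^sup>2 = (\<Sum>i\<in>UNIV. (norm (A $ i))\<^sup>2)"
  by (simp add: power2_norm_eq_inner inner_vec_def)

lemma power2_norm_vec: "(norm (x :: real^'n))\<^sup>2 = (\<Sum>i\<in>UNIV. (x $ i)\<^sup>2)"
  unfolding power2_norm_eq_inner inner_vec_def by (simp add: power2_eq_square)

lemma norm_transpose: "norm (transpose (A :: real^'m^'n)) = norm A"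
proof -
  have "(norm (transpose A))\<^sup>2 = (norm A)\<^sup>2"
    unfolding power2_norm_eq_inner inner_vec_def transpose_def by (simp, rule sum.swap)
  then show ?thesis by simp
qed

lemma norm_matrix_vector_mult_le: "norm (A *v x) \<le> norm (A :: real^'m^'n) * norm x"
proof -
  have "(norm (A *v x))\<^sup>2 = (\<Sum>i\<in>UNIV. (A $ i \<bullet> x)\<^sup>2)"
    unfolding power2_norm_eq_inner inner_vec_def[of "A *v x"]
    by (simp add: matrix_vector_mult_def inner_vec_def power2_eq_square)
  also have "\<dots> \<le> (\<Sum>i\<in>UNIV. (norm (A $ i))\<^sup>2 * (norm x)\<^sup>2)"
    by (intro sum_mono) (metis Cauchy_Schwarz_ineq power2_norm_eq_inner)
  also have "\<dots> = (norm A * norm x)\<^sup>2"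
    by (simp add: power_mult_distrib power2_norm_rows sum_distrib_right)
  finally show ?thesis by (rule power2_le_imp_le) simp
qed

lemma abs_quadratic_form_le: "\<bar>x \<bullet> (A *v x)\<bar> \<le> norm (A :: real^'n^'n) * (norm x)\<^sup>2"
proof -
  have "\<bar>x \<bullet> (A *v x)\<bar> \<le> norm x * norm (A *v x)" by (rule Cauchy_Schwarz_ineq2)
  also have "\<dots> \<le> norm x * (norm A * norm x)"
    by (intro mult_left_mono norm_matrix_vector_mult_le) simp
  finally show ?thesis by (simp add: power2_eq_square mult_ac)
qed

lemma outer_mult_vec: "outer u w *v x = (w \<bullet> x) *\<^sub>R u"
  by (simp add: vec_eq_iff outer_def matrix_vector_mult_def inner_vec_def sum_distrib_left sum_distrib_right mult_ac)

lemma transpose_outer: "transpose (outer u w) = outer w u"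
  by (simp add: vec_eq_iff outer_def transpose_def)

lemma norm_outer: "norm (outer u w) = norm u * norm w"
proof -
  have "(norm (outer u w))\<^sup>2 = (norm u * norm w)\<^sup>2"
    unfolding power2_norm_rows power_mult_distrib power2_norm_eq_inner inner_vec_def[of u] sum_distrib_right
    by (intro sum.cong refl) (simp add: inner_vec_def outer_def sum_distrib_left mult_ac)
  then show ?thesis by simp
qed

lemma matrix_sum_mult_vec: "(\<Sum>i\<in>I. A i) *v x = (\<Sum>i\<in>I. A i *v (x :: real^'m))"
  by (induction I rule: infinite_finite_induct) (auto simp: matrix_vector_mult_add_rdistrib)

lemma transpose_sum: "transpose (\<Sum>i\<in>I. A i) = (\<Sum>i\<in>I. transpose (A i :: real^'m^'n))"
  by (simp add: vec_eq_iff transpose_def)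

text \<open>The bound of a Frobenius norm of a product by operator norm times Frobenius norm:
  \<open>C\<close> bounds the operator norm of the family \<open>c\<close>, and each row of the sum
  is the adjoint of that family applied to one coordinate of the \<open>d i\<close>.\<close>

lemma norm_sum_outer_le:
  fixes c d :: "'i \<Rightarrow> real^'p::finite"
  assumes C: "0 \<le> C" "\<And>x. (\<Sum>i\<in>I. (c i \<bullet> x)\<^sup>2) \<le> C\<^sup>2 * (norm x)\<^sup>2"
  shows "norm (\<Sum>i\<in>I. outer (d i) (c i)) \<le> C * sqrt (\<Sum>i\<in>I. (norm (d i))\<^sup>2)"
proof -
  have row: "(norm (\<Sum>i\<in>I. d i $ b *\<^sub>R c i))\<^sup>2 \<le> C\<^sup>2 * (\<Sum>i\<in>I. (d i $ b)\<^sup>2)" for b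
  proof -
    \<comment> \<open>The adjoint is bounded by duality: Cauchy-Schwarz with \<open>z\<close> itself
      as test vector, then one factor |z|^2 cancels.\<close>
    define z where "z = (\<Sum>i\<in>I. d i $ b *\<^sub>R c i)"
    have "(norm z)\<^sup>2 = (\<Sum>i\<in>I. d i $ b * (c i \<bullet> z))"
      unfolding power2_norm_eq_inner by (subst (1) z_def) (simp add: inner_sum_left)
    then have "((norm z)\<^sup>2)\<^sup>2 \<le> (\<Sum>i\<in>I. (d i $ b)\<^sup>2) * (\<Sum>i\<in>I. (c i \<bullet> z)\<^sup>2)"
      using Cauchy_Schwarz_ineq_sum[of "\<lambda>i. d i $ b" "\<lambda>i. c i \<bullet> z" I] by simp
    also have "\<dots> \<le> (\<Sum>i\<in>I. (d i $ b)\<^sup>2) * (C\<^sup>2 * (norm z)\<^sup>2)"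
      by (intro mult_left_mono C sum_nonneg) auto
    finally have "(norm z)\<^sup>2 * (norm z)\<^sup>2 \<le> (C\<^sup>2 * (\<Sum>i\<in>I. (d i $ b)\<^sup>2)) * (norm z)\<^sup>2"
      by (simp add: power2_eq_square mult_ac)
    moreover have "0 \<le> C\<^sup>2 * (\<Sum>i\<in>I. (d i $ b)\<^sup>2)" by (intro mult_nonneg_nonneg sum_nonneg) auto
    ultimately have "(norm z)\<^sup>2 \<le> C\<^sup>2 * (\<Sum>i\<in>I. (d i $ b)\<^sup>2)"
      by (cases "z = 0") (auto intro: mult_right_le_imp_le[where c="(norm z)\<^sup>2"])
    then show ?thesis by (simp add: z_def)
  qed
  have "(norm (\<Sum>i\<in>I. outer (d i) (c i)))\<^sup>2 = (\<Sum>b\<in>UNIV. (norm (\<Sum>i\<in>I. d i $ b *\<^sub>R c i))\<^sup>2)"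
    unfolding power2_norm_rows
    by (intro sum.cong refl arg_cong[where f="\<lambda>x. (norm x)\<^sup>2"]) (simp add: vec_eq_iff outer_def)
  also have "\<dots> \<le> (\<Sum>b\<in>UNIV. C\<^sup>2 * (\<Sum>i\<in>I. (d i $ b)\<^sup>2))" by (intro sum_mono row)
  also have "\<dots> = C\<^sup>2 * (\<Sum>i\<in>I. (norm (d i))\<^sup>2)"
    unfolding sum_distrib_left[symmetric]
    by (subst sum.swap) (simp add: power2_norm_vec)
  also have "\<dots> = (C * sqrt (\<Sum>i\<in>I. (norm (d i))\<^sup>2))\<^sup>2"
    by (simp add: power_mult_distrib sum_nonneg)
  finally show ?thesis by (rule power2_le_imp_le) (use C in \<open>auto intro!: mult_nonneg_nonneg sum_nonneg\<close>)
qed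

lemma norm_sum_outer_le':
  fixes c d :: "'i \<Rightarrow> real^'p::finite"
  assumes "0 \<le> C" "\<And>x. (\<Sum>i\<in>I. (c i \<bullet> x)\<^sup>2) \<le> C\<^sup>2 * (norm x)\<^sup>2"
  shows "norm (\<Sum>i\<in>I. outer (c i) (d i)) \<le> C * sqrt (\<Sum>i\<in>I. (norm (d i))\<^sup>2)"
  using norm_sum_outer_le[OF assms, of d] norm_transpose[of "\<Sum>i\<in>I. outer (d i) (c i)"]
  by (simp add: transpose_sum transpose_outer)

text \<open>The \<open>norm\<close> of \<open>real^'p^'p\<close> is the Euclidean norm of the
  entries, hence the Frobenius norm.\<close>

definition gram_dev :: "'i set \<Rightarrow> ('i \<Rightarrow> real^'p::finite) \<Rightarrow> real" where
  "gram_dev I a = norm ((\<Sum>i\<in>I. outer (a i) (a i)) - mat 1)"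

lemma gram_dev_nonneg [simp]: "0 \<le> gram_dev I a"
  by (simp add: gram_dev_def)

text \<open>The left side is the quadratic form of the Gram matrix, and a quadratic form is at most
  the Frobenius norm of its matrix times |x|^2. So the family has operator norm at most
  \<open>sqrt (1 + gram_dev I a)\<close>.\<close>

lemma sum_inner_power2_le:
  "(\<Sum>i\<in>I. (a i \<bullet> x)\<^sup>2) \<le> (1 + gram_dev I a) * (norm x)\<^sup>2"
proof -
  define A where "A = (\<Sum>i\<in>I. outer (a i) (a i))"
  have "(\<Sum>i\<in>I. (a i \<bullet> x)\<^sup>2) = x \<bullet> (A *v x)"
    by (simp add: A_def matrix_sum_mult_vec outer_mult_vec inner_sum_right power2_eq_square inner_commute)
  also have "\<dots> = (norm x)\<^sup>2 + x \<bullet> ((A - mat 1) *v x)"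
    by (simp add: matrix_vector_mult_diff_rdistrib inner_diff_right power2_norm_eq_inner)
  also have "\<dots> \<le> (norm x)\<^sup>2 + gram_dev I a * (norm x)\<^sup>2"
    using abs_quadratic_form_le[of x "A - mat 1"] by (simp add: gram_dev_def A_def)
  finally show ?thesis by (simp add: algebra_simps)
qed

text \<open>Taking the square root turns the quadratic dependence of the Gram matrix on the family
  into a Lipschitz one, because the operator norm of the family is at most the square root of
  one plus the deviation.\<close>

lemma gram_dev_sqrt_lipschitz:
  fixes a b :: "'i \<Rightarrow> real^'p::finite"
  shows "\<bar>sqrt (1 + gram_dev I a) - sqrt (1 + gram_dev I b)\<bar> \<le> sqrt (\<Sum>i\<in>I. (norm (a i - b i))\<^sup>2)"
proof -
  define s where "s = sqrt (1 + gram_dev I a)"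
  define t where "t = sqrt (1 + gram_dev I b)"
  have st: "0 < s" "0 < t" "s\<^sup>2 = 1 + gram_dev I a" "t\<^sup>2 = 1 + gram_dev I b"
    by (auto simp: s_def t_def add_pos_nonneg)
  define c where "c i = a i + b i" for i
  define d where "d i = a i - b i" for i
  have C: "(\<Sum>i\<in>I. (c i \<bullet> x)\<^sup>2) \<le> (s + t)\<^sup>2 * (norm x)\<^sup>2" for x
  proof -
    have "L2_set (\<lambda>i. a i \<bullet> x) I \<le> s * norm x"
      unfolding L2_set_def using sum_inner_power2_le[of a x I] st
      by (intro real_le_lsqrt) (auto simp: power_mult_distrib intro!: sum_nonneg)
    moreover have "L2_set (\<lambda>i. b i \<bullet> x) I \<le> t * norm x"
      unfolding L2_set_def using sum_inner_power2_le[of b x I] st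
      by (intro real_le_lsqrt) (auto simp: power_mult_distrib intro!: sum_nonneg)
    moreover have "L2_set (\<lambda>i. a i \<bullet> x + b i \<bullet> x) I \<le> L2_set (\<lambda>i. a i \<bullet> x) I + L2_set (\<lambda>i. b i \<bullet> x) I"
      by (rule L2_set_triangle_ineq)
    ultimately have "L2_set (\<lambda>i. c i \<bullet> x) I \<le> (s + t) * norm x"
      by (simp add: c_def inner_add_left algebra_simps)
    then have "(L2_set (\<lambda>i. c i \<bullet> x) I)\<^sup>2 \<le> ((s + t) * norm x)\<^sup>2"
      by (intro power_mono) auto
    then show ?thesis by (simp add: L2_set_def sum_nonneg power_mult_distrib)
  qed
  define D where "D = sqrt (\<Sum>i\<in>I. (norm (d i))\<^sup>2)"
  define A where "A = (\<Sum>i\<in>I. outer (a i) (a i))"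
  define B where "B = (\<Sum>i\<in>I. outer (b i) (b i))"
  \<comment> \<open>Polarization: each product contains the difference \<open>d\<close>, measured in
    Frobenius norm, and the sum \<open>c\<close>, measured in operator norm by s + t.\<close>
  have "A - B = (1/2) *\<^sub>R ((\<Sum>i\<in>I. outer (d i) (c i)) + (\<Sum>i\<in>I. outer (c i) (d i)))"
    unfolding A_def B_def sum_subtractf[symmetric] sum.distrib[symmetric] scaleR_sum_right
    by (intro sum.cong refl) (simp add: vec_eq_iff outer_def c_def d_def algebra_simps)
  then have "norm (A - B) = (1/2) * norm ((\<Sum>i\<in>I. outer (d i) (c i)) + (\<Sum>i\<in>I. outer (c i) (d i)))"
    by simp
  also have "\<dots> \<le> (1/2) * ((s + t) * D + (s + t) * D)"
    unfolding D_def using st C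
    by (intro mult_left_mono order_trans[OF norm_triangle_ineq] add_mono norm_sum_outer_le norm_sum_outer_le') auto
  finally have "norm (A - B) \<le> (s + t) * D" by (simp add: mult.commute)
  moreover have "\<bar>gram_dev I a - gram_dev I b\<bar> \<le> norm (A - B)"
    unfolding gram_dev_def A_def[symmetric] B_def[symmetric]
    using norm_triangle_ineq3[of "A - mat 1" "B - mat 1"] by simp
  ultimately have "\<bar>s\<^sup>2 - t\<^sup>2\<bar> \<le> (s + t) * D" by (simp add: st)
  \<comment> \<open>The factor s + t cancels against the operator norm bound of \<open>c\<close>,
    which leaves Lipschitz constant 1.\<close>
  moreover have "\<bar>s\<^sup>2 - t\<^sup>2\<bar> = (s + t) * \<bar>s - t\<bar>"
  proof -
    have "s\<^sup>2 - t\<^sup>2 = (s + t) * (s - t)" by (simp add: power2_eq_square algebra_simps)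
    then show ?thesis using st(1,2) by (simp add: abs_mult)
  qed
  ultimately have "\<bar>s - t\<bar> \<le> D" using st by simp
  then show ?thesis by (simp add: s_def t_def D_def d_def)
qed


section \<open>Least squares as an orthogonal projection\<close>

lemma trace_mult_sym:
  assumes "sym_mat B"
  shows "trace (A ** B) = A \<bullet> B"
proof -
  have "B $ k $ i = B $ i $ k" for i k
    using assms unfolding sym_mat_def by (metis transpose_def vec_lambda_beta)
  then show ?thesis
    by (simp add: trace_def matrix_matrix_mult_def inner_vec_def)
qed

lemma sym_mat_add: "sym_mat A \<Longrightarrow> sym_mat B \<Longrightarrow> sym_mat (A + B)"
  and sym_mat_diff: "sym_mat A \<Longrightarrow> sym_mat B \<Longrightarrow> sym_mat (A - B)"
  and sym_mat_scaleR: "sym_mat A \<Longrightarrow> sym_mat (c *\<^sub>R A)"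
  and sym_mat_sum: "(\<And>i. i \<in> I \<Longrightarrow> sym_mat (f i)) \<Longrightarrow> sym_mat (\<Sum>i\<in>I. f i)"
  unfolding sym_mat_def by (auto simp: vec_eq_iff transpose_def)

lemma sym_mat_outer: "sym_mat (outer u u)"
  by (simp add: sym_mat_def transpose_outer)

lemma sym_mat_sample_cov: "sym_mat (sample_cov n x)"
  unfolding sample_cov_def by (intro sym_mat_scaleR sym_mat_sum sym_mat_outer)

lemma sym_mat_Sigma_of: "LGCM G r \<Longrightarrow> sym_mat (Sigma_of G r v)"
  unfolding Sigma_of_def LGCM_def by (intro sym_mat_add sym_mat_scaleR sym_mat_sum) auto

text \<open>Two solutions differ by a matrix that lies in the span of the \<open>G j\<close> and is
  orthogonal to each of them, hence is zero; linear independence then equates the coefficients.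
  Outside \<open>{1..r}\<close> the definition of \<open>lse\<close> pins the value 0.\<close>

lemma lse_eqI:
  assumes G: "LGCM G r"
    and v: "\<And>j. j \<in> {1..r} \<Longrightarrow> ((\<Sum>i=1..r. v i *\<^sub>R G i) - S) \<bullet> G j = 0" "\<And>i. i \<notin> {1..r} \<Longrightarrow> v i = 0"
  shows "lse G r S = v"
  unfolding lse_def
proof (rule the_equality)
  have sym: "sym_mat (G j)" if "j \<in> {1..r}" for j using G that by (auto simp: LGCM_def)
  have eq: "(\<Sum>i=1..r. w i * trace (G i ** G j)) = trace (S ** G j) \<longleftrightarrow> ((\<Sum>i=1..r. w i *\<^sub>R G i) - S) \<bullet> G j = 0"
    if "j \<in> {1..r}" for j w
    using sym[OF that] by (simp add: trace_mult_sym inner_diff_left inner_sum_left)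
  show "(\<forall>j\<in>{1..r}. (\<Sum>i=1..r. v i * trace (G i ** G j)) = trace (S ** G j)) \<and> (\<forall>i. i \<notin> {1..r} \<longrightarrow> v i = 0)"
    using eq v by blast
  fix w assume w: "(\<forall>j\<in>{1..r}. (\<Sum>i=1..r. w i * trace (G i ** G j)) = trace (S ** G j)) \<and> (\<forall>i. i \<notin> {1..r} \<longrightarrow> w i = 0)"
  have indep: "\<forall>i\<in>{1..r}. c i = 0" if "(\<Sum>i=1..r. c i *\<^sub>R G i) = 0" for c
    using G that unfolding LGCM_def by blast
  define D where "D = (\<Sum>i=1..r. (w i - v i) *\<^sub>R G i)"
  have "D \<bullet> G j = 0" if "j \<in> {1..r}" for j
    using w eq[OF that, of w] v(1)[OF that] that
    by (simp add: D_def scaleR_diff_left sum_subtractf inner_diff_left)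
  then have "D \<bullet> D = 0"
    by (subst (2) D_def) (simp add: inner_sum_right)
  then have "\<forall>i\<in>{1..r}. w i - v i = 0"
    using indep[of "\<lambda>i. w i - v i"] by (simp add: D_def)
  then show "w = v" using w v(2) by (auto simp: fun_eq_iff)
qed

text \<open>One orthonormal basis for all \<open>S\<close> makes the fitted matrix an explicit
  affine function of \<open>S\<close>. This serves the Pythagorean argument and also measurability,
  where the definite description in \<open>lse\<close> would be opaque.\<close>

lemma lse_projection:
  assumes G: "LGCM G r"
  obtains B where "finite B" "\<And>S. Sigma_of G r (lse G r S) = G 0 + (\<Sum>b\<in>B. (S \<bullet> b) *\<^sub>R b)"
    "\<And>S y. y \<in> span (G ` {1..r}) \<Longrightarrow> (S - (\<Sum>b\<in>B. (S \<bullet> b) *\<^sub>R b)) \<bullet> y = 0"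
    "\<And>S. (\<Sum>b\<in>B. (S \<bullet> b) *\<^sub>R b) \<in> span (G ` {1..r})"
proof -
  define V where "V = span (G ` {1..r})"
  obtain B where B: "B \<subseteq> V" "pairwise orthogonal B" "\<And>x. x \<in> B \<Longrightarrow> norm x = 1" "independent B" "span B = V"
    using orthonormal_basis_subspace[of V] unfolding V_def by (metis subspace_span)
  have fin: "finite B" using B(4) by (rule independent_imp_finite)
  define P where "P S = (\<Sum>b\<in>B. (S \<bullet> b) *\<^sub>R b)" for S
  have PV: "P S \<in> V" for S
    unfolding P_def B(5)[symmetric] by (intro span_sum span_scale span_base)
  have orth: "(S - P S) \<bullet> y = 0" if "y \<in> V" for S y
  proof -
    have "(S - P S) \<bullet> b = 0" if b: "b \<in> B" for b
    proof -
      have "P S \<bullet> b = (\<Sum>b'\<in>B. (S \<bullet> b') * (b' \<bullet> b))" by (simp add: P_def inner_sum_left)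
      also have "\<dots> = (\<Sum>b'\<in>B. if b' = b then S \<bullet> b else 0)"
        using B(2,3) b by (intro sum.cong refl) (auto simp: pairwise_def orthogonal_def norm_eq_1)
      also have "\<dots> = S \<bullet> b" using fin b by simp
      finally show ?thesis by (simp add: inner_diff_left)
    qed
    moreover have "y \<in> span B" using that B(5) by simp
    ultimately show ?thesis
      using orthogonal_to_span[of y B "S - P S"] by (auto simp: orthogonal_def)
  qed
  have "Sigma_of G r (lse G r S) = G 0 + P S" for S
  proof -
    \<comment> \<open>The span yields coefficients per matrix, the model has coefficients per index;
      independence of the indexed family rules out repetitions.\<close>
    have inj: "inj_on G {1..r}"
    proof (rule inj_onI)
      fix i j assume ij: "i \<in> {1..r}" "j \<in> {1..r}" "G i = G j"
      show "i = j"
      proof (rule ccontr)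
        assume ne: "i \<noteq> j"
        define c where "c k = (if k = i then 1 else if k = j then -1 else 0 :: real)" for k
        have "(\<Sum>k=1..r. c k *\<^sub>R G k) = (\<Sum>k=1..r. (if k = i then G i else 0) - (if k = j then G j else 0))"
          using ne by (intro sum.cong) (auto simp: c_def)
        also have "\<dots> = 0" using ij by (simp add: sum_subtractf)
        finally have "c i = 0" using G ij(1) unfolding LGCM_def by blast
        then show False by (simp add: c_def)
      qed
    qed
    have "P S \<in> range (\<lambda>u. \<Sum>v\<in>G ` {1..r}. u v *\<^sub>R v)"
      using PV[of S] unfolding V_def by (subst (asm) span_finite) auto
    then obtain u where "P S = (\<Sum>v\<in>G ` {1..r}. u v *\<^sub>R v)" by auto
    then have u: "P S = (\<Sum>i=1..r. u (G i) *\<^sub>R G i)" using sum.reindex[OF inj, of "\<lambda>v. u v *\<^sub>R v"] by simp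
    define v where "v i = (if i \<in> {1..r} then u (G i) else 0)" for i
    have Pv: "P S = (\<Sum>i=1..r. v i *\<^sub>R G i)" unfolding u v_def by (intro sum.cong) auto
    have "lse G r S = v"
    proof (rule lse_eqI[OF G])
      fix j assume "j \<in> {1..r}"
      then have "G j \<in> V" by (auto simp: V_def intro: span_base)
      then show "((\<Sum>i=1..r. v i *\<^sub>R G i) - S) \<bullet> G j = 0"
        using orth[of "G j" S] unfolding Pv[symmetric] by (simp add: inner_diff_left)
    qed (auto simp: v_def)
    then show ?thesis by (simp add: Sigma_of_def Pv)
  qed
  then show ?thesis
    using that[of B] fin orth PV unfolding P_def V_def by blast
qed

text \<open>S - Sigma splits into the residual \<open>z\<close> and the error \<open>y\<close>
  inside the model. As tr (G_0 G_i) = 0, the residual stays orthogonal to the span after subtracting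
  \<open>G 0\<close>, and by Pythagoras each leg is at most the hypotenuse.\<close>

lemma lse_contraction:
  assumes G: "LGCM G r"
  shows "norm (Sigma_of G r (lse G r S) - Sigma_of G r v) \<le> norm (S - Sigma_of G r v)"
    and "norm (S - Sigma_of G r (lse G r S)) \<le> norm (S - Sigma_of G r v)"
proof -
  obtain B where B: "finite B" "\<And>S. Sigma_of G r (lse G r S) = G 0 + (\<Sum>b\<in>B. (S \<bullet> b) *\<^sub>R b)"
    "\<And>S y. y \<in> span (G ` {1..r}) \<Longrightarrow> (S - (\<Sum>b\<in>B. (S \<bullet> b) *\<^sub>R b)) \<bullet> y = 0"
    "\<And>S. (\<Sum>b\<in>B. (S \<bullet> b) *\<^sub>R b) \<in> span (G ` {1..r})"
    using lse_projection[OF G] by blast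
  define P where "P S = (\<Sum>b\<in>B. (S \<bullet> b) *\<^sub>R b)" for S
  define y where "y = P S - (\<Sum>i=1..r. v i *\<^sub>R G i)"
  have y: "y \<in> span (G ` {1..r})"
    unfolding y_def P_def by (intro span_diff B span_sum span_scale span_base) auto
  have G0: "G 0 \<bullet> z = 0" if "z \<in> span (G ` {1..r})" for z
  proof -
    have "G 0 \<bullet> G i = 0" if "i \<in> {1..r}" for i
      using G that trace_mult_sym[of "G i" "G 0"] unfolding LGCM_def by (metis atLeastAtMost_iff le0)
    then have "orthogonal (G 0) y" if "y \<in> G ` {1..r}" for y
      using that by (auto simp: orthogonal_def)
    from orthogonal_to_span[OF that this] show ?thesis by (simp add: orthogonal_def)
  qed
  define z where "z = S - Sigma_of G r (lse G r S)"
  have z: "z = S - P S - G 0" by (simp add: z_def B(2) P_def)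
  have "z \<bullet> y = 0" using B(3)[OF y, of S] G0[OF y] by (simp add: z P_def inner_diff_left)
  then have pyth: "(norm (z + y))\<^sup>2 = (norm z)\<^sup>2 + (norm y)\<^sup>2"
    by (intro norm_add_Pythagorean) (simp add: orthogonal_def)
  have zy: "z + y = S - Sigma_of G r v" by (simp add: z y_def Sigma_of_def)
  have yy: "y = Sigma_of G r (lse G r S) - Sigma_of G r v"
    unfolding B(2) by (simp add: y_def P_def Sigma_of_def)
  show "norm (Sigma_of G r (lse G r S) - Sigma_of G r v) \<le> norm (S - Sigma_of G r v)"
    unfolding yy[symmetric] zy[symmetric] by (rule power2_le_imp_le) (auto simp: pyth)
  show "norm (S - Sigma_of G r (lse G r S)) \<le> norm (S - Sigma_of G r v)"
    unfolding z_def[symmetric] zy[symmetric] by (rule power2_le_imp_le) (auto simp: pyth)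
qed


section \<open>Whitening and positive definite matrices\<close>

lemma matrix_inner_swap: "x \<bullet> (A *v y) = (transpose A *v x) \<bullet> (y :: real^'m)"
  by (simp add: dot_lmul_matrix)

text \<open>Gram-Schmidt for the inner product x . S y, in place of a matrix square root. The span
  clause is carried through the induction to show that the next coordinate vector is new.\<close>

lemma pos_def_gram_schmidt:
  fixes S :: "real^'p::finite^'p"
  assumes S: "pos_def S" and "finite J"
  shows "\<exists>q. (\<forall>a\<in>J. q a \<in> span ((\<lambda>b. axis b 1) ` J)) \<and>
     (\<forall>a\<in>J. \<forall>b\<in>J. q a \<bullet> (S *v q b) = (if a = b then 1 else 0))"
  using \<open>finite J\<close>
proof (induction J)
  case (insert c J)
  have sym: "x \<bullet> (S *v y) = y \<bullet> (S *v x)" for x y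
    using S matrix_inner_swap[of x S y] by (simp add: pos_def_def sym_mat_def inner_commute)
  obtain q where q: "\<And>a. a \<in> J \<Longrightarrow> q a \<in> span ((\<lambda>b. axis b 1) ` J)"
    "\<And>a b. a \<in> J \<Longrightarrow> b \<in> J \<Longrightarrow> q a \<bullet> (S *v q b) = (if a = b then 1 else 0)"
    using insert.IH by blast
  define v where "v = (axis c 1 :: real^'p)"
  define u where "u = (\<Sum>a\<in>J. (q a \<bullet> (S *v v)) *\<^sub>R q a)"
  define w where "w = v - u"
  have u: "u \<in> span ((\<lambda>b. axis b 1) ` J)"
    unfolding u_def by (intro span_sum span_scale q)
  \<comment> \<open>The projection \<open>u\<close> involves only axes other than \<open>c\<close>,
    so \<open>w\<close> has coordinate 1 at \<open>c\<close> and cannot vanish.\<close>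
  have "u $ c = 0"
  proof -
    have "orthogonal v y" if "y \<in> (\<lambda>b. axis b 1) ` J" for y
      using that insert.hyps by (auto simp: orthogonal_def v_def inner_axis_axis)
    from orthogonal_to_span[OF u this] show ?thesis
      by (simp add: orthogonal_def v_def inner_axis' )
  qed
  then have "w $ c = 1" by (simp add: w_def v_def)
  then have "w \<noteq> 0" by auto
  then have pos: "0 < w \<bullet> (S *v w)" using S by (auto simp: pos_def_def)
  define d where "d = sqrt (w \<bullet> (S *v w))"
  have d: "0 < d" "d * d = w \<bullet> (S *v w)" using pos by (auto simp: d_def)
  have orth: "q b \<bullet> (S *v w) = 0" if b: "b \<in> J" for b
  proof -
    have "q b \<bullet> (S *v u) = (\<Sum>a\<in>J. (q a \<bullet> (S *v v)) * (q b \<bullet> (S *v q a)))"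
      unfolding u_def by (simp add: linear_sum[OF matrix_vector_mul_linear] matrix_vector_mult_scaleR inner_sum_right)
    also have "\<dots> = (\<Sum>a\<in>J. if a = b then q b \<bullet> (S *v v) else 0)"
      using b by (intro sum.cong refl) (auto simp: q)
    also have "\<dots> = q b \<bullet> (S *v v)" using insert.hyps b by simp
    finally show ?thesis by (simp add: w_def matrix_vector_mult_diff_distrib inner_diff_right)
  qed
  have orth': "w \<bullet> (S *v q b) = 0" if b: "b \<in> J" for b
    using orth[OF b] by (subst sym)
  define q' where "q' = q(c := (1 / d) *\<^sub>R w)"
  show ?case
  proof (intro exI[of _ q'] conjI ballI)
    fix a assume a: "a \<in> insert c J"
    have mono: "span ((\<lambda>b. axis b 1) ` J) \<subseteq> span ((\<lambda>b. axis b (1::real)) ` insert c J)"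
      by (intro span_mono) auto
    have "w \<in> span ((\<lambda>b. axis b 1) ` insert c J)"
      unfolding w_def v_def by (rule span_diff) (use mono u in \<open>auto intro: span_base\<close>)
    then show "q' a \<in> span ((\<lambda>b. axis b 1) ` insert c J)"
      using a q(1) mono by (auto simp: q'_def intro: span_scale)
    fix b assume b: "b \<in> insert c J"
    show "q' a \<bullet> (S *v q' b) = (if a = b then 1 else 0)"
      using a b insert.hyps(2) orth' d(1)
      by (auto simp: q'_def matrix_vector_mult_scaleR orth q(2) d(2)[symmetric])
  qed
qed auto

text \<open>The S-orthonormal vectors are the rows of \<open>Q\<close>, and \<open>R\<close> is S
  Q^T. A one-sided inverse of a square matrix is two-sided, which gives the factorization.\<close>

lemma pos_def_whitening:
  fixes S :: "real^'p::finite^'p"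
  assumes S: "pos_def S"
  obtains Q R :: "real^'p^'p" where "Q ** S ** transpose Q = mat 1" "Q ** R = mat 1" "R ** Q = mat 1" "S = R ** transpose R"
proof -
  obtain q :: "'p \<Rightarrow> real^'p" where q: "\<And>a b. q a \<bullet> (S *v q b) = (if a = b then 1 else 0)"
    using pos_def_gram_schmidt[OF S finite_class.finite_UNIV] by auto
  define Q :: "real^'p^'p" where "Q = (\<chi> a. q a)"
  have 1: "Q ** S ** transpose Q = mat 1"
  proof -
    have "(Q ** S ** transpose Q) $ a $ b = q a \<bullet> (S *v q b)" for a b
    proof -
      have "(Q ** S ** transpose Q) $ a $ b = (Q ** (S ** transpose Q)) $ a $ b"
        by (simp add: matrix_mul_assoc)
      also have "\<dots> = q a \<bullet> (S *v q b)"
        by (simp add: matrix_matrix_mult_def matrix_vector_mult_def inner_vec_def transpose_def Q_def)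
      finally show ?thesis .
    qed
    then show ?thesis by (simp add: vec_eq_iff mat_def q)
  qed
  define R where "R = S ** transpose Q"
  have 2: "Q ** R = mat 1" using 1 by (simp add: R_def matrix_mul_assoc)
  then have 3: "R ** Q = mat 1" by (simp add: matrix_left_right_inverse)
  have "transpose Q ** transpose R = mat 1"
    using arg_cong[OF 3, of transpose] by (simp add: matrix_transpose_mul transpose_mat)
  then have "S = R ** transpose R"
    by (simp add: R_def matrix_mul_assoc[symmetric])
  then show ?thesis by (rule that[OF 1 2 3])
qed

text \<open>The columns of the product are \<open>A\<close> applied to the columns of
  \<open>B\<close>; transposing makes them rows, over which the Frobenius norm is summed.\<close>

lemma norm_matrix_mult_le:
  fixes A B :: "real^'p::finite^'p"
  assumes "0 \<le> c" "\<And>x. norm (A *v x) \<le> c * norm x"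
  shows "norm (A ** B) \<le> c * norm B"
proof -
  have row: "transpose (A ** B) $ j = A *v (transpose B $ j)" for j
    by (simp add: vec_eq_iff transpose_def matrix_matrix_mult_def matrix_vector_mult_def)
  have "(norm (transpose (A ** B)))\<^sup>2 = (\<Sum>j\<in>UNIV. (norm (A *v (transpose B $ j)))\<^sup>2)"
    unfolding power2_norm_rows row ..
  also have "\<dots> \<le> (\<Sum>j\<in>UNIV. (c * norm (transpose B $ j))\<^sup>2)"
    by (intro sum_mono power_mono assms) auto
  also have "\<dots> = (c * norm (transpose B))\<^sup>2"
    by (simp add: power_mult_distrib power2_norm_rows sum_distrib_left)
  finally have "norm (transpose (A ** B)) \<le> c * norm (transpose B)"
    by (rule power2_le_imp_le) (use assms in auto)
  then show ?thesis by (simp add: norm_transpose)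
qed

lemma spec_norm_bound: "norm (A *v x) \<le> spec_norm A * norm x"
  unfolding spec_norm_def by (rule onorm) simp

lemma spec_norm_nonneg: "0 \<le> spec_norm A"
  unfolding spec_norm_def by (rule onorm_pos_le) simp

lemma matrix_inv_eqI:
  fixes A B :: "real^'p::finite^'p"
  assumes "A ** B = mat 1" "B ** A = mat 1"
  shows "matrix_inv A = B"
proof -
  have "\<exists>A'. A ** A' = mat 1 \<and> A' ** A = mat 1" using assms by blast
  then have "A ** matrix_inv A = mat 1 \<and> matrix_inv A ** A = mat 1"
    unfolding matrix_inv_def by (rule someI_ex)
  then have "matrix_inv A = (B ** A) ** matrix_inv A" "B ** (A ** matrix_inv A) = B"
    using assms by simp_all
  then show ?thesis by (simp add: matrix_mul_assoc)
qed

lemma transpose_inverse_pair: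
  fixes Q R :: "real^'p::finite^'p"
  assumes "Q ** R = mat 1" "R ** Q = mat 1"
  shows "transpose R ** transpose Q = mat 1" "transpose Q ** transpose R = mat 1"
  using arg_cong[OF assms(1), of transpose] arg_cong[OF assms(2), of transpose]
  by (simp_all add: matrix_transpose_mul transpose_mat)

lemma matrix_inv_factorization:
  fixes Q R :: "real^'p::finite^'p"
  assumes QR: "Q ** R = mat 1" "R ** Q = mat 1"
  shows "matrix_inv (R ** transpose R) = transpose Q ** Q"
proof (rule matrix_inv_eqI)
  have "(R ** transpose R) ** (transpose Q ** Q) = R ** (transpose R ** transpose Q) ** Q"
    by (simp add: matrix_mul_assoc)
  then show "(R ** transpose R) ** (transpose Q ** Q) = mat 1"
    by (simp add: transpose_inverse_pair[OF QR] QR)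
  have "(transpose Q ** Q) ** (R ** transpose R) = transpose Q ** (Q ** R) ** transpose R"
    by (simp add: matrix_mul_assoc)
  then show "(transpose Q ** Q) ** (R ** transpose R) = mat 1"
    by (simp add: transpose_inverse_pair[OF QR] QR)
qed

text \<open>The smallest-eigenvalue bound without eigenvalues: with S = R R^T and S^-1 = Q^T Q,
  |x|^2 is the inner product of R^T x and Q x, and Cauchy-Schwarz gives |x|^4 <= (x . S x) (x . S^-1
  x).\<close>

lemma pos_def_quadratic_lower:
  fixes S :: "real^'p::finite^'p"
  assumes S: "pos_def S"
  shows "(norm x)\<^sup>2 \<le> spec_norm (matrix_inv S) * (x \<bullet> (S *v x))"
proof (cases "x = 0")
  case False
  obtain Q R :: "real^'p^'p" where QR: "Q ** S ** transpose Q = mat 1" "Q ** R = mat 1" "R ** Q = mat 1" "S = R ** transpose R"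
    using pos_def_whitening[OF S] by blast
  have inv: "matrix_inv S = transpose Q ** Q"
    unfolding QR(4) by (rule matrix_inv_factorization[OF QR(2,3)])
  have "(norm x)\<^sup>2 = (transpose R *v x) \<bullet> (Q *v x)"
  proof -
    have "(transpose R *v x) \<bullet> (Q *v x) = x \<bullet> ((R ** Q) *v x)"
      by (simp only: matrix_inner_swap[symmetric] matrix_vector_mul_assoc)
    then show ?thesis by (simp add: QR power2_norm_eq_inner)
  qed
  also have "\<dots> \<le> norm (transpose R *v x) * norm (Q *v x)" by (rule norm_cauchy_schwarz)
  finally have "((norm x)\<^sup>2)\<^sup>2 \<le> (norm (transpose R *v x))\<^sup>2 * (norm (Q *v x))\<^sup>2"
    by (metis power_mono power_mult_distrib zero_le_power2)
  also have "(norm (transpose R *v x))\<^sup>2 = x \<bullet> (S *v x)"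
    unfolding power2_norm_eq_inner QR(4) by (simp only: matrix_inner_swap[symmetric] matrix_vector_mul_assoc)
  also have "(norm (Q *v x))\<^sup>2 = x \<bullet> (matrix_inv S *v x)"
    unfolding power2_norm_eq_inner inv
    using matrix_inner_swap[of x "transpose Q" "Q *v x"] by (simp add: matrix_vector_mul_assoc)
  finally have 1: "((norm x)\<^sup>2)\<^sup>2 \<le> (x \<bullet> (S *v x)) * (x \<bullet> (matrix_inv S *v x))" .
  have "x \<bullet> (matrix_inv S *v x) \<le> norm x * norm (matrix_inv S *v x)" by (rule norm_cauchy_schwarz)
  also have "\<dots> \<le> norm x * (spec_norm (matrix_inv S) * norm x)"
    by (intro mult_left_mono spec_norm_bound) auto
  finally have "x \<bullet> (matrix_inv S *v x) \<le> spec_norm (matrix_inv S) * (norm x)\<^sup>2"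
    by (simp add: power2_eq_square mult_ac)
  moreover have "0 \<le> x \<bullet> (S *v x)" using S False by (auto simp: pos_def_def less_imp_le)
  ultimately have "(x \<bullet> (S *v x)) * (x \<bullet> (matrix_inv S *v x)) \<le> (x \<bullet> (S *v x)) * (spec_norm (matrix_inv S) * (norm x)\<^sup>2)"
    by (intro mult_left_mono) auto
  with 1 have "(norm x)\<^sup>2 * (norm x)\<^sup>2 \<le> (spec_norm (matrix_inv S) * (x \<bullet> (S *v x))) * (norm x)\<^sup>2"
    by (simp add: power2_eq_square mult_ac)
  then show ?thesis by (rule mult_right_le_imp_le) (use False in simp)
qed simp


text \<open>Each side of the sandwich costs a factor sqrt (spec_norm S): the transpose of
  \<open>R\<close> because |R^T x|^2 = x . S x, then \<open>R\<close> itself by duality.\<close>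

lemma norm_sandwich_le:
  fixes R D S :: "real^'p::finite^'p"
  assumes S: "S = R ** transpose R"
  shows "norm (R ** D ** transpose R) \<le> spec_norm S * norm D"
proof -
  define c where "c = sqrt (spec_norm S)"
  have c: "0 \<le> c" "c * c = spec_norm S" by (auto simp: c_def spec_norm_nonneg)
  have qf: "(norm (transpose R *v x))\<^sup>2 = x \<bullet> (S *v x)" for x
    unfolding power2_norm_eq_inner S by (simp only: matrix_inner_swap[symmetric] matrix_vector_mul_assoc)
  have Rt: "norm (transpose R *v x) \<le> c * norm x" for x
  proof (rule power2_le_imp_le)
    have "x \<bullet> (S *v x) \<le> norm x * norm (S *v x)" by (rule norm_cauchy_schwarz)
    also have "\<dots> \<le> norm x * (spec_norm S * norm x)" by (intro mult_left_mono spec_norm_bound) auto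
    finally show "(norm (transpose R *v x))\<^sup>2 \<le> (c * norm x)\<^sup>2"
      unfolding qf by (simp add: power2_eq_square c(2)[symmetric] mult_ac)
  qed (use c in simp)
  have R: "norm (R *v x) \<le> c * norm x" for x
  proof (cases "R *v x = 0")
    case False
    have "(norm (R *v x))\<^sup>2 = x \<bullet> (transpose R *v (R *v x))"
      unfolding power2_norm_eq_inner
      using matrix_inner_swap[of x "transpose R" "R *v x"] by (simp only: transpose_transpose)
    also have "\<dots> \<le> norm x * norm (transpose R *v (R *v x))" by (rule norm_cauchy_schwarz)
    also have "\<dots> \<le> norm x * (c * norm (R *v x))" by (intro mult_left_mono Rt) auto
    finally have "norm (R *v x) * norm (R *v x) \<le> (c * norm x) * norm (R *v x)"
      by (simp add: power2_eq_square mult_ac)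
    then show ?thesis by (rule mult_right_le_imp_le) (use False in simp)
  qed (use c in simp)
  have "norm (R ** D ** transpose R) = norm (R ** (D ** transpose R))" by (simp add: matrix_mul_assoc)
  also have "\<dots> \<le> c * norm (D ** transpose R)" by (rule norm_matrix_mult_le[OF c(1) R])
  also have "norm (D ** transpose R) = norm (R ** transpose D)"
    using norm_transpose[of "D ** transpose R"] by (simp add: matrix_transpose_mul)
  also have "c * \<dots> \<le> c * (c * norm (transpose D))" by (intro mult_left_mono norm_matrix_mult_le[OF c(1) R] c)
  finally show ?thesis by (simp add: norm_transpose c(2)[symmetric] mult_ac)
qed

lemma matrix_mult_diff_ldistrib: "A ** (B - C) = A ** B - A ** (C :: real^'m^'n)"
  and matrix_mult_diff_rdistrib: "(D - E) ** B = D ** B - E ** (B :: real^'m^'n)"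
  by (simp_all add: vec_eq_iff matrix_matrix_mult_def right_diff_distrib left_diff_distrib sum_subtractf)

text \<open>The deterministic core. Errors are measured relative to q = x . Sigma x: those
  controlled through Frobenius distance lose kappa f q, while \<open>S\<close> itself, seen in
  whitened coordinates, loses only f q. The threshold says f + kappa f < 1.\<close>

lemma lse_pos_def:
  fixes G :: "nat \<Rightarrow> real^'p::finite^'p" and Q R S :: "real^'p^'p"
  assumes G: "LGCM G r" and pd: "pos_def (Sigma_of G r v)"
    and Q: "Q ** R = mat 1" "R ** Q = mat 1" "Sigma_of G r v = R ** transpose R"
    and sym: "sym_mat S"
    and F: "norm (Q ** S ** transpose Q - mat 1) < 1 / (1 + cond_num (Sigma_of G r v))"
  shows "pos_def (Sigma_of G r (lse G r S))" "pos_def (2 *\<^sub>R S - Sigma_of G r (lse G r S))"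
proof -
  define \<Sigma> where "\<Sigma> = Sigma_of G r v"
  define P where "P = Sigma_of G r (lse G r S)"
  define W where "W = Q ** S ** transpose Q"
  define f where "f = norm (W - mat 1)"
  define \<kappa> where "\<kappa> = cond_num \<Sigma>"
  have \<kappa>: "0 \<le> \<kappa>" by (simp add: \<kappa>_def cond_num_def spec_norm_nonneg)
  have f: "0 \<le> f" "f * (1 + \<kappa>) < 1"
    using F \<kappa> by (simp_all add: f_def W_def \<kappa>_def \<Sigma>_def field_simps)
  note QtRt = transpose_inverse_pair[OF Q(1,2)]
  have SW: "S = R ** W ** transpose R"
  proof -
    have "R ** W ** transpose R = (R ** Q) ** S ** (transpose Q ** transpose R)"
      by (simp add: W_def matrix_mul_assoc)
    then show ?thesis by (simp add: Q QtRt)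
  qed
  have "S - \<Sigma> = R ** (W - mat 1) ** transpose R"
    by (simp add: SW \<Sigma>_def Q(3) matrix_mult_diff_ldistrib matrix_mult_diff_rdistrib)
  then have dev: "norm (S - \<Sigma>) \<le> spec_norm \<Sigma> * f"
    using norm_sandwich_le[OF Q(3), of "W - mat 1"] by (simp add: f_def \<Sigma>_def)
  have dev1: "norm (P - \<Sigma>) \<le> spec_norm \<Sigma> * f" and dev2: "norm (S - P) \<le> spec_norm \<Sigma> * f"
    using lse_contraction[OF G, of S v] dev unfolding P_def \<Sigma>_def by linarith+
  have symP: "sym_mat P" unfolding P_def by (rule sym_mat_Sigma_of[OF G])
  have key: "0 < x \<bullet> (P *v x) \<and> 0 < x \<bullet> ((2 *\<^sub>R S - P) *v x)" if x: "x \<noteq> 0" for x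
  proof -
    define q where "q = x \<bullet> (\<Sigma> *v x)"
    have q: "0 < q" using pd x by (simp add: q_def pos_def_def \<Sigma>_def)
    \<comment> \<open>One factor of kappa is the spectral norm in the bound on \<open>A\<close>, the
      other enters when |x|^2 is replaced by \<open>q\<close>.\<close>
    have err: "\<bar>x \<bullet> (A *v x)\<bar> \<le> \<kappa> * f * q" if "norm A \<le> spec_norm \<Sigma> * f" for A :: "real^'p^'p"
    proof -
      have "\<bar>x \<bullet> (A *v x)\<bar> \<le> norm A * (norm x)\<^sup>2" by (rule abs_quadratic_form_le)
      also have "\<dots> \<le> (spec_norm \<Sigma> * f) * (spec_norm (matrix_inv \<Sigma>) * q)"
        using pos_def_quadratic_lower[OF pd, of x] that f spec_norm_nonneg[of \<Sigma>]
        by (intro mult_mono) (auto simp: q_def \<Sigma>_def)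
      finally show ?thesis by (simp add: \<kappa>_def cond_num_def mult_ac)
    qed
    have "x \<bullet> (P *v x) = q + x \<bullet> ((P - \<Sigma>) *v x)"
      by (simp add: q_def matrix_vector_mult_diff_rdistrib inner_diff_right)
    then have 1: "(1 - \<kappa> * f) * q \<le> x \<bullet> (P *v x)"
      using err[OF dev1] by (simp add: algebra_simps)
    define y where "y = transpose R *v x"
    have yy: "(norm y)\<^sup>2 = q"
      unfolding y_def q_def \<Sigma>_def power2_norm_eq_inner Q(3)
      by (simp only: matrix_inner_swap[symmetric] matrix_vector_mul_assoc)
    have "x \<bullet> (S *v x) = y \<bullet> (W *v y)"
      unfolding y_def SW by (simp only: matrix_inner_swap[symmetric] matrix_vector_mul_assoc matrix_mul_assoc)
    also have "\<dots> = (norm y)\<^sup>2 + y \<bullet> ((W - mat 1) *v y)"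
      by (simp add: matrix_vector_mult_diff_rdistrib inner_diff_right power2_norm_eq_inner)
    finally have 2: "(1 - f) * q \<le> x \<bullet> (S *v x)"
      using abs_quadratic_form_le[of y "W - mat 1"] yy by (simp add: f_def algebra_simps)
    \<comment> \<open>Grouping as S + (S - P) matters: expanding both terms around Sigma by the
      triangle inequality would cost 3 kappa f.\<close>
    have "x \<bullet> ((2 *\<^sub>R S - P) *v x) = x \<bullet> (S *v x) + x \<bullet> ((S - P) *v x)"
      by (simp add: matrix_vector_mult_diff_rdistrib inner_diff_right scaleR_matrix_vector_assoc[symmetric])
    then have 3: "(1 - f - \<kappa> * f) * q \<le> x \<bullet> ((2 *\<^sub>R S - P) *v x)"
      using err[OF dev2] 2 by (simp add: algebra_simps)
    have "0 < 1 - f - \<kappa> * f" "0 < 1 - \<kappa> * f"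
      using f by (simp_all add: algebra_simps)
    then have "0 < (1 - f - \<kappa> * f) * q" "0 < (1 - \<kappa> * f) * q"
      using q by simp_all
    then show ?thesis using 1 3 by linarith
  qed
  show "pos_def (Sigma_of G r (lse G r S))" "pos_def (2 *\<^sub>R S - Sigma_of G r (lse G r S))"
    unfolding P_def[symmetric] pos_def_def
    using key symP sym by (auto intro!: sym_mat_diff sym_mat_scaleR)
qed

lemma cond_num_ge_1:
  assumes "pos_def (S :: real^'p::finite^'p)"
  shows "1 \<le> cond_num S"
proof -
  define x :: "real^'p" where "x = axis undefined 1"
  have x: "norm x = 1" by (simp add: x_def)
  have "1 \<le> spec_norm (matrix_inv S) * (x \<bullet> (S *v x))"
    using pos_def_quadratic_lower[OF assms, of x] by (simp add: x)
  also have "x \<bullet> (S *v x) \<le> spec_norm S"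
    using norm_cauchy_schwarz[of x "S *v x"] spec_norm_bound[of S x] by (simp add: x)
  finally show ?thesis
    by (simp add: cond_num_def mult_left_mono spec_norm_nonneg)
qed

section \<open>The margin inequality\<close>

text \<open>Here s = sqrt p and u = 1 / sqrt n; \<open>\<delta>\<close> and \<open>f\<close> are the
  spectral and the Frobenius threshold, and \<open>pos\<close> is eps > 0. The gain sqrt (1 + f) -
  sqrt (1 + delta) must pay for the larger mean. It is zero at s = 1 and grows with s, hence the
  three cases.\<close>

lemma concentration_margin_real:
  fixes s \<kappa> u \<delta> f :: real
  assumes s: "s = 1 \<or> s\<^sup>2 = 2 \<or> s\<^sup>2 \<ge> 3" "1 \<le> s" and \<kappa>: "1 \<le> \<kappa>"
    and u: "0 \<le> u" "u\<^sup>2 \<le> 1/15"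
    and \<delta>: "\<delta> * (1 + \<kappa> * s) = 1" and f: "f * (1 + \<kappa>) = 1"
    and pos: "sqrt (1 - u\<^sup>2) + s * u < sqrt (1 + \<delta>)"
  shows "sqrt (1 + (s * u * sqrt (s\<^sup>2 + 1) + (s * u)\<^sup>2)) \<le> sqrt (1 + f) - sqrt (1 + \<delta>) + sqrt (1 - u\<^sup>2) + s * u"
proof -
  define x where "x = s * u"
  define a where "a = sqrt (s\<^sup>2 + 1)"
  define A where "A = sqrt (1 + \<delta>)"
  define B where "B = sqrt (1 - u\<^sup>2)"
  define m where "m = sqrt (1 + f)"
  have \<kappa>s: "1 \<le> \<kappa> * s" using s(2) \<kappa> mult_mono[of 1 \<kappa> 1 s] by simp
  have \<delta>eq: "\<delta> = 1 / (1 + \<kappa> * s)" and feq: "f = 1 / (1 + \<kappa>)"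
    using \<delta> f \<kappa> \<kappa>s by (simp_all add: field_simps)
  have \<delta>0: "0 < \<delta>" "\<delta> * (1 + s) \<le> 1"
  proof -
    show "0 < \<delta>" using \<kappa>s by (simp add: \<delta>eq)
    have "1 * s \<le> \<kappa> * s" using \<kappa> s by (intro mult_right_mono) auto
    then show "\<delta> * (1 + s) \<le> 1" using \<kappa>s by (simp add: \<delta>eq)
  qed
  have f0: "0 < f" "f \<le> 1/2" using \<kappa> by (simp_all add: feq field_simps)
  have \<delta>half: "\<delta> \<le> 1/2"
  proof -
    have "\<delta> * 2 \<le> \<delta> * (1 + s)" using \<delta>0 s(2) by (intro mult_left_mono) auto
    then show ?thesis using \<delta>0 by linarith
  qed
  \<comment> \<open>The ratio f / delta = (1 + kappa s) / (1 + kappa) is nondecreasing in kappa; the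
    bound is its value at kappa = 1.\<close>
  have f\<delta>: "\<delta> * (s + 1) / 2 \<le> f"
  proof -
    have e: "f * (1 + (s - 1) * \<delta>) = s * \<delta>"
    proof -
      have "\<kappa> * s * \<delta> = 1 - \<delta>" using \<delta> by (simp add: algebra_simps)
      then have "1 + (s - 1) * \<delta> = s * \<delta> * (1 + \<kappa>)" by (simp add: algebra_simps)
      then have "f * (1 + (s - 1) * \<delta>) = s * \<delta> * (f * (1 + \<kappa>))" by (simp only:) (simp only: mult_ac)
      then show ?thesis using f by simp
    qed
    have "(s + 1) * (1 + (s - 1) * \<delta>) \<le> 2 * s"
    proof -
      have "(s - 1) * (\<delta> * (1 + s)) \<le> (s - 1) * 1" using \<delta>0 s by (intro mult_left_mono) auto
      then show ?thesis by (simp add: algebra_simps)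
    qed
    then have "f * ((s + 1) * (1 + (s - 1) * \<delta>)) \<le> f * (2 * s)" using f0 by (intro mult_left_mono) auto
    then have "(s + 1) * (s * \<delta>) \<le> f * (2 * s)" by (metis e mult.left_commute)
    then have "s * ((s + 1) * \<delta>) \<le> s * (2 * f)" by (simp only: mult_ac)
    then show ?thesis using s(2) by (simp add: mult.commute)
  qed
  have A: "0 < A" "A\<^sup>2 = 1 + \<delta>" using \<delta>0 by (auto simp: A_def)
  have A_le: "A \<le> 1 + \<delta> / 2"
    unfolding A_def using \<delta>0 by (intro real_le_lsqrt) (auto simp: power2_eq_square algebra_simps)
  have m: "0 < m" "m\<^sup>2 = 1 + f" using f0 by (auto simp: m_def)
  have m_le: "m \<le> 1.225"
    unfolding m_def using f0 by (intro real_le_lsqrt) (auto simp: power2_eq_square)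
  have B: "0 \<le> B" "B\<^sup>2 = 1 - u\<^sup>2"
    unfolding B_def using u by auto
  \<comment> \<open>With 0.52 instead of 1/2 the Taylor polynomial is a lower bound as long as
    0.2704 u^2 <= 0.04, which u^2 <= 1/15 guarantees.\<close>
  have Bl: "1 - 0.52 * u\<^sup>2 \<le> B"
  proof (rule power2_le_imp_le)
    have "0.2704 * u\<^sup>2 * u\<^sup>2 \<le> 0.04 * u\<^sup>2" using u by (intro mult_right_mono) auto
    then show "(1 - 0.52 * u\<^sup>2)\<^sup>2 \<le> B\<^sup>2" unfolding B by (simp add: power2_eq_square algebra_simps)
  qed (rule B)
  have fge: "\<delta> \<le> f"
  proof -
    have "\<delta> * 2 \<le> \<delta> * (s + 1)" using \<delta>0 s(2) by (intro mult_left_mono) auto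
    then show ?thesis using f\<delta> by linarith
  qed
  have mA: "A \<le> m" unfolding A_def m_def using fge by simp
  have x0: "0 \<le> x" and xu: "x\<^sup>2 = s\<^sup>2 * u\<^sup>2" using s u by (auto simp: x_def power_mult_distrib)
  have h: "B + x < A" using pos by (simp add: A_def B_def x_def)
  have main: "x\<^sup>2 - u\<^sup>2 + 2 * x * B < \<delta>"
  proof -
    have "(B + x)\<^sup>2 < A\<^sup>2" using h B x0 by (intro power_strict_mono) auto
    then show ?thesis by (simp add: A B power2_sum algebra_simps)
  qed
  have a0: "0 \<le> a" "a\<^sup>2 = s\<^sup>2 + 1" by (auto simp: a_def)
  \<comment> \<open>The right side of the goal; the comparison is made between squares.\<close>
  define r where "r = m - A + B + x"
  have r0: "0 \<le> r" using mA B x0 by (simp add: r_def)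
  have x1: "x \<le> 1"
  proof -
    have "0.5 \<le> B" using Bl u by simp
    then show ?thesis using h A_le \<delta>half by simp
  qed
  \<comment> \<open>In \<open>main\<close>, the surplus x^2 - u^2 = (s^2 - 1) u^2 absorbs the defect
    2 x (1 - B) <= 1.04 x u^2 once 1.04 x <= s^2 - 1. For s^2 = 2 that is where x <= 0.9 is
    used.\<close>
  have x\<delta>: "2 * x \<le> \<delta>" if "s\<^sup>2 \<ge> 2"
  proof (cases "s\<^sup>2 \<ge> 3 \<or> x \<le> 0.9")
    case True
    have "(s\<^sup>2 - 1) * u\<^sup>2 \<ge> 1.04 * x * u\<^sup>2"
      using that True x1 by (intro mult_right_mono) auto
    moreover have "2 * x * (1 - 0.52 * u\<^sup>2) \<le> 2 * x * B" using Bl x0 by (intro mult_left_mono) auto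
    ultimately show ?thesis using main xu by (simp add: algebra_simps)
  next
    case False
    then have "s\<^sup>2 = 2" using s that by auto
    then have "x\<^sup>2 \<le> 2 / 15" using xu u by simp
    also have "\<dots> \<le> 0.9\<^sup>2" by (simp add: power2_eq_square)
    finally have "x \<le> 0.9" by (rule power2_le_imp_le) simp
    then show ?thesis using False by simp
  qed
  have "1 + (x * a + x\<^sup>2) \<le> r\<^sup>2"
    using s(1)
  proof (elim disjE)
    \<comment> \<open>Dimension one: the thresholds coincide and x = u, so r^2 = 1 + 2 x B and it
      suffices that a + x <= 2 B, with a = sqrt 2.\<close>
    assume s1: "s = 1"
    have ux: "u = x" using s1 by (simp add: x_def)
    have fd: "f = \<delta>" using \<delta>eq feq s1 by simp
    have r: "r = B + x" by (simp add: r_def fd A_def m_def)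
    have B96: "0.96 \<le> B" using Bl u by simp
    have "x * (24/25) \<le> x * B" using B96 x0 by (intro mult_left_mono) auto
    moreover have "2 * (x * B) < \<delta>" using main unfolding ux by simp
    ultimately have x3: "x \<le> 0.3" using \<delta>half by simp
    have "a \<le> 1.5" unfolding a_def s1 by (intro real_le_lsqrt) (auto simp: power2_eq_square)
    then have "x * a \<le> x * (2 * B - x)" using B96 x3 x0 by (intro mult_left_mono) auto
    then show ?thesis
      unfolding r power2_sum B ux by (simp add: power2_eq_square algebra_simps)
  next
    \<comment> \<open>Dimension two: \<open>r\<close> is bounded below linearly. The slope 1.114
      collects 1 from x, 0.1689 from m - A and -0.054 from B; its double exceeds a = sqrt 3 and its
      square exceeds 1.24.\<close>
    assume s2: "s\<^sup>2 = 2"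
    have sl: "1.414 \<le> s"
      by (rule power2_le_imp_le) (use s s2 in \<open>auto simp: power2_eq_square\<close>)
    have x2: "2 * x \<le> \<delta>" using x\<delta> s2 by simp
    have dl: "\<delta> \<le> 0.4143"
    proof -
      have "\<delta> * 2.414 \<le> 1"
        by (rule order_trans[OF _ \<delta>0(2)], rule mult_left_mono) (use sl \<delta>0 in auto)
      then show ?thesis by simp
    qed
    have mA': "(m - A) * (m + A) = f - \<delta>"
      using A m by (simp add: power2_eq_square algebra_simps)
    have "0.414 * x \<le> \<delta> * (s - 1) / 2"
    proof -
      have "2 * x * 0.414 \<le> \<delta> * (s - 1)" using x2 x0 sl \<delta>0 by (intro mult_mono) auto
      then show ?thesis by (simp add: field_simps)
    qed
    also have "\<dots> \<le> f - \<delta>" using f\<delta> by (simp add: field_simps)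
    also have "\<dots> \<le> (m - A) * 2.45"
      unfolding mA'[symmetric] using mA m_le A_le dl by (intro mult_left_mono) auto
    finally have 1: "0.1689 * x \<le> m - A" using x0 by simp
    have "u\<^sup>2 = x * x / 2" using xu s2 by (simp add: power2_eq_square)
    moreover have "x * x \<le> 0.2072 * x" using x2 dl x0 by (intro mult_right_mono) auto
    ultimately have "1 - 0.054 * x \<le> B" using Bl x0 by simp
    then have r: "1 + 1.114 * x \<le> r" using 1 x0 by (simp add: r_def)
    have a: "a \<le> 1.74" unfolding a_def s2 by (intro real_le_lsqrt) (auto simp: power2_eq_square)
    have "x * a \<le> x * 2.228" using a x0 by (intro mult_left_mono) auto
    moreover have "x\<^sup>2 \<le> 1.24 * x\<^sup>2" by simp
    ultimately have "1 + (x * a + x\<^sup>2) \<le> 1 + 2.228 * x + 1.24 * x\<^sup>2"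
      unfolding mult.commute[of "2.228 :: real"] by linarith
    also have "\<dots> \<le> (1 + 1.114 * x)\<^sup>2"
      by (simp add: power2_eq_square algebra_simps)
    also have "\<dots> \<le> r\<^sup>2" using r x0 by (intro power_mono) auto
    finally show ?thesis .
  next
    assume s3: "s\<^sup>2 \<ge> 3"
    have sl: "1.732 \<le> s"
      by (rule power2_le_imp_le) (use s s3 in \<open>auto simp: power2_eq_square\<close>)
    have x2: "2 * x \<le> \<delta>" using x\<delta> s3 by simp
    \<comment> \<open>Dimension at least three: t = - eps and r = m + t. Dropping t^2 and using 2 m
      <= 2.45 with t <= 0 leaves r^2 >= 1 + f + 2.45 t. Below, 13/75 is 0.52 / 3.\<close>
    define t where "t = B + x - A"
    have t: "t \<le> 0" "x - \<delta> / 2 - 0.52 * u\<^sup>2 \<le> t" using h Bl A_le by (auto simp: t_def)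
    have "3 * u\<^sup>2 \<le> x\<^sup>2" unfolding xu using s3 by (intro mult_right_mono) auto
    then have t': "x - \<delta> / 2 - (13/75) * x\<^sup>2 \<le> t" using t by simp
    have "r\<^sup>2 = m\<^sup>2 + 2 * m * t + t\<^sup>2"
      by (simp add: r_def t_def power2_eq_square algebra_simps)
    then have "m\<^sup>2 + 2 * m * t \<le> r\<^sup>2" by simp
    moreover have "2 * 1.225 * t \<le> 2 * m * t"
      using m_le t by (intro mult_right_mono_neg) auto
    ultimately have r: "1 + f + 2.45 * t \<le> r\<^sup>2" using m by simp
    have xx: "x\<^sup>2 \<le> \<delta> / 2 * x" using x2 x0 unfolding power2_eq_square by (intro mult_right_mono) auto
    have a1: "a \<le> 1 + s" unfolding a_def using s by (intro real_le_lsqrt) (auto simp: power2_eq_square algebra_simps)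
    have f2: "1.366 * \<delta> \<le> f"
    proof -
      have "\<delta> * 2.732 \<le> 2 * f"
        by (rule order_trans[of _ "\<delta> * (s + 1)"], rule mult_left_mono) (use \<delta>0 sl f\<delta> in auto)
      then show ?thesis by simp
    qed
    \<comment> \<open>The number 2137/3000 is half of 1 + 2.45 * 13/75, the half coming from x^2 <=
      delta x / 2. The expression is affine in x on [0, delta / 2], so the endpoints decide.\<close>
    have lin: "0 \<le> f - 1.225 * \<delta> + x * (2.45 - a - (2137/3000) * \<delta>)"
    proof (cases "0 \<le> 2.45 - a - (2137/3000) * \<delta>")
      case True
      then show ?thesis using f2 \<delta>0 x0 by (intro add_nonneg_nonneg mult_nonneg_nonneg) auto
    next
      case False
      then have "\<delta> / 2 * (2.45 - a - (2137/3000) * \<delta>) \<le> x * (2.45 - a - (2137/3000) * \<delta>)"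
        using x2 by (intro mult_right_mono_neg) auto
      moreover have "0 \<le> f - 1.225 * \<delta> + \<delta> / 2 * (2.45 - a - (2137/3000) * \<delta>)"
      proof -
        \<comment> \<open>The difference of squares gives 1 + s - a >= s / (1 + s) >= delta s,
          enough because s exceeds 2137/3000.\<close>
        have "2 * s = (1 + s)\<^sup>2 - a\<^sup>2" unfolding a0 by (simp add: power2_eq_square algebra_simps)
        also have "\<dots> = (1 + s - a) * (1 + s + a)" by (simp add: power2_eq_square algebra_simps)
        also have "\<dots> \<le> (1 + s - a) * (2 * (1 + s))" using a1 by (intro mult_left_mono) auto
        also have "\<dots> = 2 * ((1 + s - a) * (1 + s))" by (simp only: mult_ac)
        finally have "s \<le> (1 + s - a) * (1 + s)" by linarith
        then have "\<delta> * s \<le> \<delta> * ((1 + s - a) * (1 + s))" using \<delta>0 by (intro mult_left_mono) auto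
        also have "\<dots> = (1 + s - a) * (\<delta> * (1 + s))" by (simp only: mult_ac)
        also have "\<dots> \<le> (1 + s - a) * 1" using a1 \<delta>0 by (intro mult_left_mono) auto
        finally have "\<delta> * s \<le> 1 + s - a" by simp
        moreover have "\<delta> * (2137/3000) \<le> \<delta> * s" using sl \<delta>0 by (intro mult_left_mono) auto
        ultimately have "0 \<le> 1 + s - a - (2137/3000) * \<delta>" by simp
        then have "0 \<le> \<delta> / 2 * (1 + s - a - (2137/3000) * \<delta>)" using \<delta>0 by simp
        also have "\<dots> \<le> f - 1.225 * \<delta> + \<delta> / 2 * (2.45 - a - (2137/3000) * \<delta>)"
          using f\<delta> by (simp add: field_simps)
        finally show ?thesis .
      qed
      ultimately show ?thesis by linarith
    qed
    have "1 + (x * a + x\<^sup>2) \<le> 1 + f + 2.45 * (x - \<delta> / 2 - (13/75) * x\<^sup>2)"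
      using lin xx by (simp add: algebra_simps)
    also have "\<dots> \<le> 1 + f + 2.45 * t" using t' by simp
    finally show ?thesis using r by linarith
  qed
  then have "sqrt (1 + (x * a + x\<^sup>2)) \<le> r" using r0 by (intro real_le_lsqrt) auto
  then show ?thesis by (simp add: x_def a_def r_def m_def A_def B_def)
qed

lemma concentration_margin:
  fixes p n :: nat
  assumes p: "1 \<le> p" and \<kappa>: "1 \<le> \<kappa>" and n: "15 \<le> n" and pos: "0 < eps_n p \<kappa> n"
  shows "sqrt (1 + (sqrt (real (p * (p + 1)) / real n) + real p / real n)) + eps_n p \<kappa> n \<le> sqrt (1 + 1 / (1 + \<kappa>))"
proof -
  define s where "s = sqrt (real p)"
  define u where "u = 1 / sqrt (real n)"
  have s: "s\<^sup>2 = real p" "1 \<le> s" using p by (auto simp: s_def)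
  have u: "u\<^sup>2 = 1 / real n" "0 \<le> u" by (auto simp: u_def power_divide)
  have su: "sqrt (real p / real n) = s * u" "(s * u)\<^sup>2 = real p / real n"
    by (simp_all add: s_def u_def real_sqrt_divide power_divide)
  have sua: "sqrt (real (p * (p + 1)) / real n) = s * u * sqrt (s\<^sup>2 + 1)"
    unfolding of_nat_mult real_sqrt_divide real_sqrt_mult by (simp add: s_def u_def add.commute)
  have n1: "(real n - 1) / real n = 1 - u\<^sup>2" using n by (simp add: u field_simps)
  have ks: "0 < 1 + \<kappa> * s" using \<kappa> s by (simp add: add_pos_nonneg)
  have d: "(2 + \<kappa> * s) / (1 + \<kappa> * s) = 1 + 1 / (1 + \<kappa> * s)" using ks by (simp add: field_simps)
  have e: "eps_n p \<kappa> n = sqrt (1 + 1 / (1 + \<kappa> * s)) - sqrt (1 - u\<^sup>2) - s * u"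
    unfolding eps_n_def su(1) n1 s_def[symmetric] d ..
  have "s = 1 \<or> s\<^sup>2 = 2 \<or> s\<^sup>2 \<ge> 3"
  proof -
    have "p = 1 \<or> p = 2 \<or> 3 \<le> p" using p by linarith
    then show ?thesis by (auto simp: s_def)
  qed
  moreover have "u\<^sup>2 \<le> 1 / 15" using n by (simp add: u frac_le)
  ultimately have "sqrt (1 + (s * u * sqrt (s\<^sup>2 + 1) + (s * u)\<^sup>2))
      \<le> sqrt (1 + 1 / (1 + \<kappa>)) - sqrt (1 + 1 / (1 + \<kappa> * s)) + sqrt (1 - u\<^sup>2) + s * u"
    using s u \<kappa> ks pos unfolding e by (intro concentration_margin_real[where \<kappa>=\<kappa>]) auto
  then show ?thesis unfolding e sua su(2) by linarith
qed

section \<open>Standard Gaussian vectors\<close>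

lemma nn_integral_lborel_shift:
  fixes f :: "'v::euclidean_space \<Rightarrow> ennreal"
  assumes [measurable]: "f \<in> borel_measurable borel"
  shows "(\<integral>\<^sup>+x. f (x + t) \<partial>lborel) = (\<integral>\<^sup>+x. f x \<partial>lborel)"
proof -
  have "(\<integral>\<^sup>+x. f x \<partial>lborel) = (\<integral>\<^sup>+x. f x \<partial>distr lborel borel ((+) t))"
    by (simp add: lborel_distr_plus)
  also have "\<dots> = (\<integral>\<^sup>+x. f (x + t) \<partial>lborel)"
    by (subst nn_integral_distr) (auto simp: add.commute)
  finally show ?thesis ..
qed

text \<open>Uniqueness of Haar measure for the image of Lebesgue measure under an affine bijection:
  it is a multiple of Lebesgue measure. The factor is fixed later by normalization, so that no
  determinant has to be computed.\<close>

lemma distr_lborel_affine: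
  fixes g k :: "'v::euclidean_space \<Rightarrow> 'v"
  assumes [measurable]: "g \<in> borel_measurable borel"
    and shift: "\<And>y z. g (z + k y) = g z + y"
  shows "\<exists>c. distr lborel borel g = density lborel (\<lambda>_. c)"
proof -
  \<comment> \<open>The translates of a set of measure 1 can be inserted as a factor 1. After
    Fubini, shifting z by \<open>k y\<close> moves the variable y from \<open>U\<close> to
    \<open>A\<close> and decouples the two factors.\<close>
  define U where "U = box (0::'v) One"
  have U1: "emeasure lborel U = 1" by (simp add: U_def)
  have [measurable]: "U \<in> sets borel" by (simp add: U_def)
  define c where "c = (\<integral>\<^sup>+z. indicator U (- g z) \<partial>lborel)"
  have "emeasure (distr lborel borel g) A = c * emeasure lborel A" if [measurable]: "A \<in> sets borel" for A
  proof -
    have iA: "(\<integral>\<^sup>+y. indicator A (y + t) \<partial>lborel) = emeasure lborel A" for t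
      by (subst nn_integral_lborel_shift) auto
    have iU: "(\<integral>\<^sup>+y. indicator U (y + t) \<partial>lborel) = 1" for t
      by (subst nn_integral_lborel_shift) (auto simp: U1)
    have "emeasure (distr lborel borel g) A = (\<integral>\<^sup>+z. indicator A z \<partial>distr lborel borel g)" by simp
    also have "\<dots> = (\<integral>\<^sup>+z. indicator A (g z) \<partial>lborel)" by (rule nn_integral_distr) auto
    also have "\<dots> = (\<integral>\<^sup>+z. \<integral>\<^sup>+y. indicator A (g z) * indicator U (y + - g z) \<partial>lborel \<partial>lborel)"
      by (intro nn_integral_cong, subst nn_integral_cmult) (simp_all only: iU mult_1_right, measurable)
    also have "\<dots> = (\<integral>\<^sup>+y. \<integral>\<^sup>+z. indicator A (g z) * indicator U (y + - g z) \<partial>lborel \<partial>lborel)"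
      by (rule lborel_pair.Fubini') measurable
    also have "\<dots> = (\<integral>\<^sup>+y. \<integral>\<^sup>+z. indicator U (- g z) * indicator A (y + g z) \<partial>lborel \<partial>lborel)"
    proof (rule nn_integral_cong)
      fix y
      have "(\<integral>\<^sup>+z. indicator A (g z) * indicator U (y + - g z) \<partial>lborel)
          = (\<integral>\<^sup>+z. indicator A (g (z + k y)) * indicator U (y + - g (z + k y)) \<partial>lborel)"
        by (rule nn_integral_lborel_shift[symmetric, where f="\<lambda>z. indicator A (g z) * indicator U (y + - g z)"]) measurable
      then show "(\<integral>\<^sup>+z. indicator A (g z) * indicator U (y + - g z) \<partial>lborel)
          = (\<integral>\<^sup>+z. indicator U (- g z) * indicator A (y + g z) \<partial>lborel)"
        by (simp add: shift mult.commute add.commute)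
    qed
    also have "\<dots> = (\<integral>\<^sup>+z. \<integral>\<^sup>+y. indicator U (- g z) * indicator A (y + g z) \<partial>lborel \<partial>lborel)"
      by (rule lborel_pair.Fubini') measurable
    also have "\<dots> = (\<integral>\<^sup>+z. indicator U (- g z) * emeasure lborel A \<partial>lborel)"
      by (intro nn_integral_cong, subst nn_integral_cmult) (simp_all only: iA, measurable)
    also have "\<dots> = c * emeasure lborel A"
      by (subst nn_integral_multc) (auto simp: c_def)
    finally show ?thesis .
  qed
  then have "distr lborel borel g = density lborel (\<lambda>_. c)"
    by (intro measure_eqI) (auto simp: emeasure_density_const)
  then show ?thesis ..
qed

lemma std_gauss_vec_density:
  "(std_gauss_vec :: 'v::euclidean_space measure)
    = density lborel (\<lambda>y. ennreal (exp (- (norm y)\<^sup>2 / 2) / sqrt (2 * pi) ^ DIM('v)))"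
proof -
  interpret product_sigma_finite "\<lambda>_::'v. lborel :: real measure" ..
  interpret G: product_sigma_finite "\<lambda>_::'v. std_gauss" by (rule product_sigma_finite_std_gauss)
  have PiM_sets: "sets (Pi\<^sub>M Basis (\<lambda>_::'v. std_gauss)) = sets (Pi\<^sub>M Basis (\<lambda>_::'v. lborel :: real measure))"
    by (intro sets_PiM_cong) auto
  have prod_dens: "(\<Prod>b\<in>Basis. std_normal_density (y \<bullet> b)) = exp (- (norm y)\<^sup>2 / 2) / sqrt (2 * pi) ^ DIM('v)" for y :: 'v
  proof -
    have "(norm y)\<^sup>2 = (\<Sum>b\<in>Basis. (y \<bullet> b)\<^sup>2)"
      unfolding power2_norm_eq_inner by (subst euclidean_inner) (simp add: power2_eq_square)
    then have "exp (- (norm y)\<^sup>2 / 2) = (\<Prod>b\<in>Basis. exp (- (y \<bullet> b)\<^sup>2 / 2))"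
      by (simp add: exp_sum[symmetric] sum_divide_distrib sum_negf)
    then show ?thesis
      by (simp add: std_normal_density_def prod_dividef power_one_over[symmetric])
  qed
  have "density (Pi\<^sub>M Basis (\<lambda>_::'v. lborel)) (\<lambda>f. ennreal (\<Prod>b\<in>Basis. std_normal_density (f b)))
      = Pi\<^sub>M Basis (\<lambda>_::'v. std_gauss)"
  proof (rule G.PiM_eqI)
    fix A :: "'v \<Rightarrow> real set" assume A: "\<And>i. i \<in> Basis \<Longrightarrow> A i \<in> sets std_gauss"
    then have [measurable]: "\<And>i. i \<in> Basis \<Longrightarrow> A i \<in> sets borel" by simp
    have "emeasure (density (Pi\<^sub>M Basis (\<lambda>_::'v. lborel)) (\<lambda>f. ennreal (\<Prod>b\<in>Basis. std_normal_density (f b)))) (Pi\<^sub>E Basis A)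
        = (\<integral>\<^sup>+f. ennreal (\<Prod>b\<in>Basis. std_normal_density (f b)) * indicator (Pi\<^sub>E Basis A) f \<partial>Pi\<^sub>M Basis (\<lambda>_::'v. lborel))"
      by (rule emeasure_density) (auto intro!: sets_PiM_I_finite)
    also have "\<dots> = (\<integral>\<^sup>+f. (\<Prod>b\<in>Basis. ennreal (std_normal_density (f b)) * indicator (A b) (f b)) \<partial>Pi\<^sub>M Basis (\<lambda>_::'v. lborel))"
      by (intro nn_integral_cong)
         (auto simp: prod_ennreal prod.distrib indicator_def space_PiM PiE_def Pi_def if_distrib prod_zero_iff)
    also have "\<dots> = (\<Prod>b\<in>Basis. \<integral>\<^sup>+x. ennreal (std_normal_density x) * indicator (A b) x \<partial>lborel)"
      by (rule product_nn_integral_prod) auto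
    also have "\<dots> = (\<Prod>b\<in>Basis. emeasure std_gauss (A b))"
      unfolding std_gauss_def by (intro prod.cong refl emeasure_density[symmetric]) auto
    finally show "emeasure (density (Pi\<^sub>M Basis (\<lambda>_::'v. lborel)) (\<lambda>f. ennreal (\<Prod>b\<in>Basis. std_normal_density (f b)))) (Pi\<^sub>E Basis A)
        = (\<Prod>b\<in>Basis. emeasure std_gauss (A b))" .
  qed (simp_all add: PiM_sets)
  then have "std_gauss_vec = distr (density (Pi\<^sub>M Basis (\<lambda>_::'v. lborel)) (\<lambda>f. ennreal (\<Prod>b\<in>Basis. std_normal_density (f b))))
      borel (\<lambda>f. \<Sum>b\<in>Basis. f b *\<^sub>R b)"
    by (simp add: std_gauss_vec_def)
  also have "\<dots> = distr (density (Pi\<^sub>M Basis (\<lambda>_::'v. lborel)) (\<lambda>f. (\<lambda>y. ennreal (\<Prod>b\<in>Basis. std_normal_density (y \<bullet> b))) (\<Sum>b\<in>Basis. f b *\<^sub>R b)))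
      borel (\<lambda>f. \<Sum>b\<in>Basis. f b *\<^sub>R b)"
    by simp
  also have "\<dots> = density (distr (Pi\<^sub>M Basis (\<lambda>_::'v. lborel)) borel (\<lambda>f. \<Sum>b\<in>Basis. f b *\<^sub>R b))
      (\<lambda>y. ennreal (\<Prod>b\<in>Basis. std_normal_density (y \<bullet> b)))"
    by (rule density_distr[symmetric]) measurable
  also have "\<dots> = density lborel (\<lambda>y. ennreal (\<Prod>b\<in>Basis. std_normal_density (y \<bullet> b)))"
    by (subst lborel_eq[symmetric]) simp
  finally show ?thesis by (simp only: prod_dens)
qed

text \<open>Whitening turns the quadratic form into |y|^2, so the image has density proportional to
  exp (- |y|^2 / 2). Probability measures with proportional densities agree, hence the constant
  containing \<open>det S\<close> is never evaluated.\<close>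

lemma distr_mvn_whitened:
  fixes S Q R :: "real^'p::finite^'p"
  assumes QR: "Q ** R = mat 1" "R ** Q = mat 1" "S = R ** transpose R"
    and ps: "prob_space (mvn mu S)"
  shows "distr (mvn mu S) borel (\<lambda>x. Q *v (x - mu)) = std_gauss_vec"
proof -
  have inv: "matrix_inv S = transpose Q ** Q"
    unfolding QR(3) by (rule matrix_inv_factorization[OF QR(1,2)])
  have quad: "z \<bullet> (matrix_inv S *v z) = (norm (Q *v z))\<^sup>2" for z
    unfolding power2_norm_eq_inner inv
    using matrix_inner_swap[of z "transpose Q" "Q *v z"] by (simp add: matrix_vector_mul_assoc)
  have mQ[measurable]: "(\<lambda>x. Q *v x) \<in> borel_measurable borel"
    by (intro borel_measurable_continuous_onI linear_continuous_on matrix_vector_mul_bounded_linear)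
  define e where "e y = ennreal (exp (- (norm (y :: real^'p))\<^sup>2 / 2))" for y
  have [measurable]: "e \<in> borel_measurable borel" unfolding e_def by measurable
  define C where "C = ennreal (1 / sqrt ((2 * pi) ^ CARD('p) * det S))"
  define K where "K = ennreal (1 / sqrt (2 * pi) ^ CARD('p))"
  define T where "T x = Q *v (x - mu)" for x
  have [measurable]: "T \<in> borel_measurable borel" unfolding T_def by measurable
  have std: "std_gauss_vec = density lborel (\<lambda>y::real^'p. K * e y)"
    unfolding std_gauss_vec_density K_def e_def by (simp add: ennreal_mult'[symmetric])
  have "mvn mu S = density lborel (\<lambda>x. C * e (T x))"
    unfolding mvn_def mvn_density_def quad C_def e_def T_def by (simp add: ennreal_mult''[symmetric])
  then have "distr (mvn mu S) borel T = density (distr lborel borel T) (\<lambda>y. C * e y)"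
    by (simp add: density_distr)
  also obtain c where "distr lborel borel T = density lborel (\<lambda>_. c)"
  proof -
    have "T (z + R *v y) = T z + y" for y z
      by (simp add: T_def matrix_vector_mult_diff_distrib matrix_vector_right_distrib matrix_vector_mul_assoc QR)
    then show ?thesis using distr_lborel_affine[of T "\<lambda>y. R *v y"] that by auto
  qed
  also have "density (density lborel (\<lambda>_. c)) (\<lambda>y. C * e y) = density lborel (\<lambda>y. (c * C) * e y)"
    by (subst density_density_eq) (auto simp: mult.assoc)
  finally have law: "distr (mvn mu S) borel T = density lborel (\<lambda>y. (c * C) * e y)" .
  define I where "I = (\<integral>\<^sup>+y. e y \<partial>(lborel :: (real^'p) measure))"
  have mass: "a * I = 1" if "prob_space (density (lborel :: (real^'p) measure) (\<lambda>y. a * e y))" for a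
  proof -
    have "1 = emeasure (density (lborel :: (real^'p) measure) (\<lambda>y. a * e y)) UNIV"
      using prob_space.emeasure_space_1[OF that] by simp
    also have "\<dots> = a * I" by (simp add: emeasure_density I_def nn_integral_cmult)
    finally show ?thesis ..
  qed
  have "(c * C) * I = 1"
    by (rule mass, subst law[symmetric], rule prob_space.prob_space_distr[OF ps]) (simp add: mvn_def)
  moreover have "K * I = 1"
    by (rule mass, subst std[symmetric], rule prob_space_std_gauss_vec)
  \<comment> \<open>Both constants are inverse to the same mass \<open>I\<close>, and inverses are
    unique; this avoids a cancellation in \<open>ennreal\<close>.\<close>
  ultimately have "c * C = K" by (metis mult.assoc mult.commute mult_1_right)
  moreover have "T = (\<lambda>x. Q *v (x - mu))" by (simp add: T_def fun_eq_iff)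
  ultimately show ?thesis using law std by simp
qed


section \<open>Moments of Gaussian vectors and samples\<close>

lemma PiM_integral_single:
  fixes g :: "'b \<Rightarrow> real"
  assumes N: "prob_space N" and i: "i \<in> I" and g: "integrable N g"
  shows "integrable (Pi\<^sub>M I (\<lambda>_. N)) (\<lambda>x. g (x i))" "(\<integral>x. g (x i) \<partial>Pi\<^sub>M I (\<lambda>_. N)) = integral\<^sup>L N g"
proof -
  have d: "distr (Pi\<^sub>M I (\<lambda>_. N)) N (\<lambda>x. x i) = N" using N i by (intro distr_PiM_component) auto
  have m: "(\<lambda>x. x i) \<in> measurable (Pi\<^sub>M I (\<lambda>_. N)) N" using i by measurable
  show "integrable (Pi\<^sub>M I (\<lambda>_. N)) (\<lambda>x. g (x i))"
    using integrable_distr[OF m, of g] g by (simp add: d)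
  show "(\<integral>x. g (x i) \<partial>Pi\<^sub>M I (\<lambda>_. N)) = integral\<^sup>L N g"
    using integral_distr[OF m, of g] g by (simp add: d)
qed

text \<open>The pair is read as a product over all of \<open>I\<close> whose other factors are the
  constant 1.\<close>

lemma PiM_integral_pair:
  fixes g h :: "'b \<Rightarrow> real"
  assumes N: "prob_space N" and I: "finite I" and ij: "i \<in> I" "j \<in> I" "i \<noteq> j"
    and gh: "integrable N g" "integrable N h"
  shows "integrable (Pi\<^sub>M I (\<lambda>_. N)) (\<lambda>x. g (x i) * h (x j))"
    "(\<integral>x. g (x i) * h (x j) \<partial>Pi\<^sub>M I (\<lambda>_. N)) = integral\<^sup>L N g * integral\<^sup>L N h"
proof -
  interpret N: prob_space N by (rule N)
  interpret product_sigma_finite "\<lambda>_. N" by (intro product_sigma_finite.intro N.sigma_finite_measure_axioms)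
  define F where "F k = (if k = i then g else if k = j then h else (\<lambda>_. 1))" for k
  define J where "J = I - {i, j}"
  have IJ: "I = insert i (insert j J)" "i \<notin> insert j J" "j \<notin> J" "finite J"
    using ij I by (auto simp: J_def)
  have J1: "(\<Prod>k\<in>J. F k (x k)) = 1" for x by (rule prod.neutral) (auto simp: F_def J_def)
  have J2: "(\<Prod>k\<in>J. integral\<^sup>L N (F k)) = 1" by (rule prod.neutral) (auto simp: F_def J_def N.prob_space)
  have p: "(\<Prod>k\<in>I. F k (x k)) = g (x i) * h (x j)" for x
    using IJ ij(3) by (simp add: J1) (simp add: F_def)
  have q: "(\<Prod>k\<in>I. integral\<^sup>L N (F k)) = integral\<^sup>L N g * integral\<^sup>L N h"
    using IJ ij(3) by (simp add: J2) (simp add: F_def)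
  have int: "integrable N (F k)" for k using gh by (simp add: F_def)
  show "integrable (Pi\<^sub>M I (\<lambda>_. N)) (\<lambda>x. g (x i) * h (x j))"
    using product_integrable_prod[OF I, of F] int by (simp add: p)
  show "(\<integral>x. g (x i) * h (x j) \<partial>Pi\<^sub>M I (\<lambda>_. N)) = integral\<^sup>L N g * integral\<^sup>L N h"
    using product_integral_prod[OF I, of F] int by (simp add: p q)
qed

lemma PiM_integral_sum_square:
  fixes g :: "'b \<Rightarrow> real"
  assumes N: "prob_space N" and I: "finite I"
    and g: "integrable N g" "integral\<^sup>L N g = 0" "integrable N (\<lambda>x. (g x)\<^sup>2)"
  shows "integrable (Pi\<^sub>M I (\<lambda>_. N)) (\<lambda>x. (\<Sum>i\<in>I. g (x i))\<^sup>2)"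
    "(\<integral>x. (\<Sum>i\<in>I. g (x i))\<^sup>2 \<partial>Pi\<^sub>M I (\<lambda>_. N)) = real (card I) * (\<integral>x. (g x)\<^sup>2 \<partial>N)"
proof -
  have sq: "(\<Sum>i\<in>I. g (x i))\<^sup>2 = (\<Sum>i\<in>I. \<Sum>j\<in>I. g (x i) * g (x j))" for x
    by (simp add: power2_eq_square sum_product)
  have int: "integrable (Pi\<^sub>M I (\<lambda>_. N)) (\<lambda>x. g (x i) * g (x j))"
    and val: "(\<integral>x. g (x i) * g (x j) \<partial>Pi\<^sub>M I (\<lambda>_. N)) = (if i = j then \<integral>x. (g x)\<^sup>2 \<partial>N else 0)"
    if "i \<in> I" "j \<in> I" for i j
    using PiM_integral_pair[OF N I that, of g g] PiM_integral_single[OF N that(1) g(3)] g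
    by (cases "i = j"; simp add: power2_eq_square)+
  show "integrable (Pi\<^sub>M I (\<lambda>_. N)) (\<lambda>x. (\<Sum>i\<in>I. g (x i))\<^sup>2)"
    unfolding sq by (intro Bochner_Integration.integrable_sum int)
  have "(\<integral>x. (\<Sum>i\<in>I. g (x i))\<^sup>2 \<partial>Pi\<^sub>M I (\<lambda>_. N)) = (\<Sum>i\<in>I. \<Sum>j\<in>I. if i = j then \<integral>x. (g x)\<^sup>2 \<partial>N else 0)"
    unfolding sq by (simp add: Bochner_Integration.integral_sum int val cong: sum.cong)
  then show "(\<integral>x. (\<Sum>i\<in>I. g (x i))\<^sup>2 \<partial>Pi\<^sub>M I (\<lambda>_. N)) = real (card I) * (\<integral>x. (g x)\<^sup>2 \<partial>N)"
    using I by simp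
qed

lemma std_gauss_moment:
  "integrable std_gauss (\<lambda>x. x ^ k)"
  "(\<integral>x. x \<partial>std_gauss) = 0" "(\<integral>x. x\<^sup>2 \<partial>std_gauss) = 1" "(\<integral>x. x ^ 4 \<partial>std_gauss) = 3"
proof -
  show "integrable std_gauss (\<lambda>x. x ^ k)"
    unfolding std_gauss_def by (subst integrable_density) (auto simp: integrable_std_normal_moment)
  show "(\<integral>x. x \<partial>std_gauss) = 0"
    unfolding std_gauss_def using integral_std_normal_moment_odd[of 0] by (subst integral_density) auto
  show "(\<integral>x. x\<^sup>2 \<partial>std_gauss) = 1"
    unfolding std_gauss_def using integral_std_normal_moment_even[of 1]
    by (subst integral_density) (auto simp: fact_numeral)
  show "(\<integral>x. x ^ 4 \<partial>std_gauss) = 3"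
    unfolding std_gauss_def using integral_std_normal_moment_even[of 2]
    by (subst integral_density) (auto simp: fact_numeral)
qed

text \<open>\<open>H\<close> expresses \<open>F\<close> through its coordinates, so that integrals
  move to the product over \<open>Basis\<close>, where coordinate \<open>a\<close> has the index
  \<open>axis a 1\<close>.\<close>

lemma std_gauss_vec_nth_integral:
  fixes F :: "real^'p::finite \<Rightarrow> real"
  assumes F: "\<And>y. F y = H (\<lambda>a. y $ a)"
    and meas: "F \<in> borel_measurable borel"
    and int: "integrable (Pi\<^sub>M Basis (\<lambda>_::real^'p. std_gauss)) (\<lambda>f. H (\<lambda>a. f (axis a 1)))"
    and val: "(\<integral>f. H (\<lambda>a. f (axis a 1)) \<partial>Pi\<^sub>M Basis (\<lambda>_::real^'p. std_gauss)) = v"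
  shows "integrable std_gauss_vec F \<and> integral\<^sup>L std_gauss_vec F = v"
proof -
  have nth: "(\<Sum>b\<in>Basis. f b *\<^sub>R b) $ a = f (axis a 1)" for f :: "real^'p \<Rightarrow> real" and a
    unfolding cart_eq_inner_axis by (simp add: axis_in_Basis_iff)
  have m: "(\<lambda>f. \<Sum>b\<in>Basis. f b *\<^sub>R b) \<in> measurable (Pi\<^sub>M Basis (\<lambda>_::real^'p. std_gauss)) borel"
    by measurable
  show ?thesis
    unfolding std_gauss_vec_def integrable_distr_eq[OF m meas] integral_distr[OF m meas]
    using int val unfolding F nth by blast
qed

lemma std_gauss_vec_nth_single:
  fixes g :: "real \<Rightarrow> real" and a :: "'p::finite"
  assumes g: "integrable std_gauss g"
  shows "integrable std_gauss_vec (\<lambda>y :: real^'p. g (y $ a)) \<and> integral\<^sup>L std_gauss_vec (\<lambda>y :: real^'p. g (y $ a)) = integral\<^sup>L std_gauss g"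
proof -
  have [measurable]: "g \<in> borel_measurable borel" using borel_measurable_integrable[OF g] by simp
  have ax: "axis a (1::real) \<in> Basis" by (simp add: axis_in_Basis_iff)
  show ?thesis
  proof (rule std_gauss_vec_nth_integral[where H="\<lambda>y. g (y a)"])
    show "(\<lambda>y :: real^'p. g (y $ a)) \<in> borel_measurable borel" by measurable
  qed (rule refl PiM_integral_single[OF prob_space_std_gauss ax g])+
qed

lemma std_gauss_vec_nth_pair:
  fixes g h :: "real \<Rightarrow> real" and a b :: "'p::finite"
  assumes g: "integrable std_gauss g" and h: "integrable std_gauss h" and "a \<noteq> b"
  shows "integrable std_gauss_vec (\<lambda>y :: real^'p. g (y $ a) * h (y $ b)) \<and>
    integral\<^sup>L std_gauss_vec (\<lambda>y :: real^'p. g (y $ a) * h (y $ b)) = integral\<^sup>L std_gauss g * integral\<^sup>L std_gauss h"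
proof -
  have [measurable]: "g \<in> borel_measurable borel" "h \<in> borel_measurable borel"
    using borel_measurable_integrable[OF g] borel_measurable_integrable[OF h] by simp_all
  have ax: "axis a (1::real) \<in> Basis" "axis b (1::real) \<in> Basis" "axis a (1::real) \<noteq> axis b 1"
    using assms by (auto simp: axis_in_Basis_iff axis_eq_axis)
  show ?thesis
  proof (rule std_gauss_vec_nth_integral[where H="\<lambda>y. g (y a) * h (y b)"])
    show "(\<lambda>y :: real^'p. g (y $ a) * h (y $ b)) \<in> borel_measurable borel" by measurable
  qed (rule refl PiM_integral_pair[OF prob_space_std_gauss finite_Basis ax g h])+
qed

lemma std_gauss_vec_nth_moment:
  fixes a :: "'p::finite"
  shows "integrable std_gauss_vec (\<lambda>y :: real^'p. y $ a)" "integral\<^sup>L std_gauss_vec (\<lambda>y :: real^'p. y $ a) = 0"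
    "integrable std_gauss_vec (\<lambda>y :: real^'p. (y $ a)\<^sup>2)" "integral\<^sup>L std_gauss_vec (\<lambda>y :: real^'p. (y $ a)\<^sup>2) = 1"
    "integrable std_gauss_vec (\<lambda>y :: real^'p. (y $ a) ^ 4)" "integral\<^sup>L std_gauss_vec (\<lambda>y :: real^'p. (y $ a) ^ 4) = 3"
  using std_gauss_vec_nth_single[of "\<lambda>x. x" a] std_gauss_vec_nth_single[of "\<lambda>x. x\<^sup>2" a]
    std_gauss_vec_nth_single[of "\<lambda>x. x ^ 4" a] std_gauss_moment(1)[of 1] std_gauss_moment(1)[of 2]
    std_gauss_moment(1)[of 4] std_gauss_moment(2-4)
  by simp_all

lemma std_gauss_vec_nth_mixed_moment:
  fixes a b :: "'p::finite"
  assumes ab: "a \<noteq> b"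
  shows "integrable std_gauss_vec (\<lambda>y :: real^'p. y $ a * y $ b)" "integral\<^sup>L std_gauss_vec (\<lambda>y :: real^'p. y $ a * y $ b) = 0"
    "integrable std_gauss_vec (\<lambda>y :: real^'p. (y $ a * y $ b)\<^sup>2)" "integral\<^sup>L std_gauss_vec (\<lambda>y :: real^'p. (y $ a * y $ b)\<^sup>2) = 1"
  using std_gauss_vec_nth_pair[of "\<lambda>x. x" "\<lambda>x. x", OF _ _ ab] std_gauss_vec_nth_pair[of "\<lambda>x. x\<^sup>2" "\<lambda>x. x\<^sup>2", OF _ _ ab]
    std_gauss_moment(1)[of 1] std_gauss_moment(1)[of 2] std_gauss_moment(2-3)
  by (simp_all add: power_mult_distrib)

text \<open>The variances 2 on the diagonal and 1 off it add up to 2 p + p (p - 1) = p (p + 1), the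
  origin of the number under the root in the mean bound.\<close>

lemma std_gauss_vec_covariance_entry:
  fixes a b :: "'p::finite"
  defines "g \<equiv> \<lambda>y :: real^'p. y $ a * y $ b - (if a = b then 1 else 0)"
  shows "integrable std_gauss_vec g" "integral\<^sup>L std_gauss_vec g = 0"
    "integrable std_gauss_vec (\<lambda>y. (g y)\<^sup>2)" "(\<integral>y. (g y)\<^sup>2 \<partial>std_gauss_vec) = (if a = b then 2 else 1)"
proof -
  interpret V: prob_space "std_gauss_vec :: (real^'p) measure" by (rule prob_space_std_gauss_vec)
  have "integrable std_gauss_vec g \<and> integral\<^sup>L std_gauss_vec g = 0 \<and>
    integrable std_gauss_vec (\<lambda>y. (g y)\<^sup>2) \<and> (\<integral>y. (g y)\<^sup>2 \<partial>std_gauss_vec) = (if a = b then 2 else 1)"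
  proof (cases "a = b")
    case True
    have g: "g = (\<lambda>y. (y $ a)\<^sup>2 - 1)" by (auto simp: g_def True power2_eq_square)
    have g2: "(\<lambda>y. (g y)\<^sup>2) = (\<lambda>y. (y $ a) ^ 4 - 2 * (y $ a)\<^sup>2 + 1)"
      unfolding g by (auto simp: fun_eq_iff power2_eq_square power4_eq_xxxx algebra_simps)
    show ?thesis
      unfolding g2 unfolding g using True std_gauss_vec_nth_moment[of a] by (simp add: V.prob_space[simplified])
  next
    case False
    then show ?thesis using std_gauss_vec_nth_mixed_moment[OF False] by (simp add: g_def)
  qed
  then show "integrable std_gauss_vec g" "integral\<^sup>L std_gauss_vec g = 0"
    "integrable std_gauss_vec (\<lambda>y. (g y)\<^sup>2)" "(\<integral>y. (g y)\<^sup>2 \<partial>std_gauss_vec) = (if a = b then 2 else 1)"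
    by blast+
qed

section \<open>Concentration of the sample covariance\<close>

lemma sample_cov_cong:
  assumes "\<And>i. i < n \<Longrightarrow> x i = y i"
  shows "sample_cov n x = sample_cov n y"
proof -
  have "sample_mean n x = sample_mean n y" unfolding sample_mean_def using assms by simp
  then show ?thesis unfolding sample_cov_def using assms by simp
qed

text \<open>Centring removes the shift \<open>mu\<close>. This identifies the whitened sample
  covariance with the sample covariance of the whitened data.\<close>

lemma sample_cov_affine:
  fixes Q :: "real^'p::finite^'p"
  assumes n: "0 < n"
  shows "sample_cov n (\<lambda>i. Q *v (x i - mu)) = Q ** sample_cov n x ** transpose Q"
proof -
  have "sample_mean n (\<lambda>i. Q *v (x i - mu)) = Q *v (sample_mean n x - mu)"
    using n by (simp add: sample_mean_def linear_sum[OF matrix_vector_mul_linear, symmetric] sum_subtractf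
        matrix_vector_mult_scaleR[symmetric] scaleR_diff_right sum_constant_scaleR del: sum_constant)
  then have diff: "Q *v (x i - mu) - sample_mean n (\<lambda>i. Q *v (x i - mu)) = Q *v (x i - sample_mean n x)" for i
    by (simp add: matrix_vector_mult_diff_distrib)
  have outer: "outer (Q *v u) (Q *v w) = Q ** outer u w ** transpose Q" for u w
    by (simp add: vec_eq_iff outer_def matrix_vector_mult_def matrix_matrix_mult_def transpose_def
        sum_product sum_distrib_left sum_distrib_right mult_ac)
  have add_r: "(A + B) ** C = A ** C + B ** C" for A B C :: "real^'p^'p"
    by (simp add: vec_eq_iff matrix_matrix_mult_def distrib_right sum.distrib)
  have sum: "(\<Sum>i<n. Q ** A i ** transpose Q) = Q ** (\<Sum>i<n. A i) ** transpose Q" for A :: "nat \<Rightarrow> real^'p^'p"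
    by (induction n) (auto simp: matrix_add_ldistrib add_r)
  have scale: "Q ** (c *\<^sub>R A) ** B = c *\<^sub>R (Q ** A ** B)" for c and A B :: "real^'p^'p"
    by (simp add: vec_eq_iff matrix_matrix_mult_def sum_distrib_left sum_distrib_right mult_ac)
  show ?thesis
    unfolding sample_cov_def diff outer sum scale ..
qed

lemma sample_cov_eq_gram:
  assumes n: "0 < n"
  shows "sample_cov n y = (\<Sum>i<n. outer ((1 / sqrt (real n)) *\<^sub>R (y i - sample_mean n y)) ((1 / sqrt (real n)) *\<^sub>R (y i - sample_mean n y)))"
  unfolding sample_cov_def scaleR_sum_right using n by (simp add: vec_eq_iff outer_def)

definition cov_dev :: "nat \<Rightarrow> (nat \<Rightarrow> real^'p::finite) \<Rightarrow> real" where
  "cov_dev n y = norm (sample_cov n y - mat 1)"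

lemma cov_dev_nonneg [simp]: "0 \<le> cov_dev n y"
  by (simp add: cov_dev_def)

text \<open>Centring is an orthogonal projection: the sum drops by exactly n times the squared norm
  of the mean.\<close>

lemma sum_norm_centered_le:
  fixes d :: "nat \<Rightarrow> 'v::real_inner"
  assumes n: "0 < n"
  shows "(\<Sum>i<n. (norm (d i - (1 / real n) *\<^sub>R (\<Sum>i<n. d i)))\<^sup>2) \<le> (\<Sum>i<n. (norm (d i))\<^sup>2)"
proof -
  define m where "m = (1 / real n) *\<^sub>R (\<Sum>i<n. d i)"
  have s: "(\<Sum>i<n. d i) = real n *\<^sub>R m" using n by (simp add: m_def)
  have "(\<Sum>i<n. (norm (d i - m))\<^sup>2) = (\<Sum>i<n. (norm (d i))\<^sup>2 - 2 * (d i \<bullet> m) + (norm m)\<^sup>2)"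
    by (intro sum.cong refl) (simp add: power2_norm_eq_inner inner_diff_left inner_diff_right inner_commute)
  also have "\<dots> = (\<Sum>i<n. (norm (d i))\<^sup>2) - 2 * ((\<Sum>i<n. d i) \<bullet> m) + real n * (norm m)\<^sup>2"
    by (simp add: sum.distrib sum_subtractf sum_distrib_left inner_sum_left)
  also have "\<dots> = (\<Sum>i<n. (norm (d i))\<^sup>2) - real n * (norm m)\<^sup>2"
    by (simp add: s power2_norm_eq_inner)
  finally show ?thesis by (simp add: m_def)
qed

text \<open>The factor sqrt n undoes the scaling of the Gram vectors, so the Lipschitz constant is
  the 1 that \<open>midpoint_ineq_tail\<close> expects; centring does not increase
  distances.\<close>

lemma cov_dev_sqrt_lipschitz:
  fixes y z :: "nat \<Rightarrow> real^'p::finite"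
  assumes n: "0 < n"
  shows "sqrt (real n) * sqrt (1 + cov_dev n y) \<le> sqrt (real n) * sqrt (1 + cov_dev n z) + sqrt (\<Sum>i<n. (norm (y i - z i))\<^sup>2)"
proof -
  define a where "a y i = (1 / sqrt (real n)) *\<^sub>R (y i - sample_mean n y)" for y :: "nat \<Rightarrow> real^'p" and i
  have dev: "cov_dev n y = gram_dev {..<n} (a y)" for y
    unfolding cov_dev_def gram_dev_def a_def sample_cov_eq_gram[OF n] ..
  define d where "d i = y i - z i" for i
  have ad: "a y i - a z i = (1 / sqrt (real n)) *\<^sub>R (d i - (1 / real n) *\<^sub>R (\<Sum>i<n. d i))" for i
    by (simp add: a_def d_def sample_mean_def sum_subtractf scaleR_diff_right)
  have "(\<Sum>i<n. (norm (a y i - a z i))\<^sup>2) = (1 / real n) * (\<Sum>i<n. (norm (d i - (1 / real n) *\<^sub>R (\<Sum>i<n. d i)))\<^sup>2)"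
    unfolding ad by (simp add: power_divide sum_divide_distrib)
  also have "\<dots> \<le> (1 / real n) * (\<Sum>i<n. (norm (d i))\<^sup>2)"
    by (intro mult_left_mono sum_norm_centered_le[OF n]) auto
  finally have le: "(\<Sum>i<n. (norm (a y i - a z i))\<^sup>2) \<le> (1 / real n) * (\<Sum>i<n. (norm (d i))\<^sup>2)" .
  have "sqrt (1 + cov_dev n y) - sqrt (1 + cov_dev n z) \<le> sqrt (\<Sum>i<n. (norm (a y i - a z i))\<^sup>2)"
    using gram_dev_sqrt_lipschitz[of "{..<n}" "a y" "a z"] by (simp add: dev)
  also have "\<dots> \<le> sqrt ((1 / real n) * (\<Sum>i<n. (norm (d i))\<^sup>2))"
    using le by (rule real_sqrt_le_mono)
  finally have "sqrt (real n) * (sqrt (1 + cov_dev n y) - sqrt (1 + cov_dev n z))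
      \<le> sqrt (real n) * sqrt ((1 / real n) * (\<Sum>i<n. (norm (d i))\<^sup>2))"
    by (rule mult_left_mono) simp
  also have "\<dots> = sqrt (\<Sum>i<n. (norm (d i))\<^sup>2)"
    using n by (simp add: real_sqrt_mult[symmetric])
  finally show ?thesis by (simp add: d_def algebra_simps)
qed

text \<open>Splitting off the sample mean m leaves an average of independent terms. The correction
  is the outer square of m, of norm |m|^2, and is the source of the term p / n.\<close>

lemma cov_dev_le:
  fixes y :: "nat \<Rightarrow> real^'p::finite"
  assumes n: "0 < n"
  shows "cov_dev n y \<le> norm ((1 / real n) *\<^sub>R (\<Sum>i<n. outer (y i) (y i)) - mat 1) + (norm (sample_mean n y))\<^sup>2"
proof -
  define m where "m = sample_mean n y"
  have s: "(\<Sum>i<n. y i) = real n *\<^sub>R m" using n by (simp add: m_def sample_mean_def)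
  have "(\<Sum>i<n. outer (y i - m) (y i - m)) = (\<Sum>i<n. outer (y i) (y i)) - outer (\<Sum>i<n. y i) m - outer m (\<Sum>i<n. y i) + real n *\<^sub>R outer m m"
    by (simp add: vec_eq_iff outer_def sum_distrib_left sum_distrib_right algebra_simps sum.distrib sum_subtractf)
  also have "\<dots> = (\<Sum>i<n. outer (y i) (y i)) - real n *\<^sub>R outer m m"
    unfolding s by (simp add: vec_eq_iff outer_def algebra_simps)
  finally have "sample_cov n y - mat 1 = ((1 / real n) *\<^sub>R (\<Sum>i<n. outer (y i) (y i)) - mat 1) - outer m m"
    using n by (simp add: sample_cov_def m_def[symmetric] scaleR_diff_right)
  then have "cov_dev n y \<le> norm ((1 / real n) *\<^sub>R (\<Sum>i<n. outer (y i) (y i)) - mat 1) + norm (outer m m)"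
    unfolding cov_dev_def by (metis norm_triangle_ineq4)
  then show ?thesis by (simp add: norm_outer m_def power2_eq_square)
qed

section \<open>Measurability of the events\<close>

lemma measurable_mat:
  fixes f :: "'a \<Rightarrow> real^'m^'n"
  assumes "\<And>a b. (\<lambda>x. f x $ a $ b) \<in> borel_measurable M"
  shows "f \<in> borel_measurable M"
  unfolding borel_measurable_euclidean_space[of f]
proof
  fix i :: "real^'m^'n" assume "i \<in> Basis"
  then obtain a b where "i = axis a (axis b 1)" by (auto simp: Basis_vec_def)
  then show "(\<lambda>x. f x \<bullet> i) \<in> borel_measurable M" using assms by (simp add: inner_axis)
qed

lemma measurable_sample_cov:
  fixes X :: "nat \<Rightarrow> 'a \<Rightarrow> real^'p::finite"
  assumes X: "\<And>i. i < n \<Longrightarrow> X i \<in> borel_measurable M"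
  shows "(\<lambda>\<omega>. sample_cov n (\<lambda>i. X i \<omega>)) \<in> borel_measurable M"
proof (rule measurable_mat)
  fix a b :: 'p
  have c: "(\<lambda>\<omega>. X i \<omega> $ a) \<in> borel_measurable M" if "i < n" for i a
  proof -
    have "(\<lambda>y :: real^'p. y $ a) \<in> borel_measurable borel" by measurable
    from measurable_compose[OF X[OF that] this] show ?thesis .
  qed
  have "(\<lambda>\<omega>. (1 / real n) * (\<Sum>i<n. (X i \<omega> $ a - (1 / real n) * (\<Sum>i<n. X i \<omega> $ a)) * (X i \<omega> $ b - (1 / real n) * (\<Sum>i<n. X i \<omega> $ b))))
      \<in> borel_measurable M"
    by (intro borel_measurable_times borel_measurable_sum borel_measurable_diff borel_measurable_const c) auto
  then show "(\<lambda>\<omega>. sample_cov n (\<lambda>i. X i \<omega>) $ a $ b) \<in> borel_measurable M"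
    by (simp add: sample_cov_def sample_mean_def outer_def)
qed

text \<open>Positivity at every \<open>x\<close> is an uncountable intersection of conditions;
  openness makes it a Borel set. The minimum of the form over the unit sphere is the radius of an
  admissible Frobenius ball.\<close>

lemma open_pos_quadratic: "open {A :: real^'p::finite^'p. \<forall>x. x \<noteq> 0 \<longrightarrow> 0 < x \<bullet> (A *v x)}"
  unfolding open_dist
proof safe
  fix A :: "real^'p^'p" assume A: "\<forall>x. x \<noteq> 0 \<longrightarrow> 0 < x \<bullet> (A *v x)"
  have "continuous_on (sphere 0 1) (\<lambda>x. x \<bullet> (A *v x))"
    by (intro continuous_intros linear_continuous_on matrix_vector_mul_bounded_linear)
  moreover have "sphere (0 :: real^'p) 1 \<noteq> {}" by (simp add: sphere_eq_empty)
  ultimately obtain x0 where x0: "x0 \<in> sphere 0 1" "\<And>x. x \<in> sphere 0 1 \<Longrightarrow> x0 \<bullet> (A *v x0) \<le> x \<bullet> (A *v x)"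
    using continuous_attains_inf[of "sphere (0 :: real^'p) 1" "\<lambda>x. x \<bullet> (A *v x)"] by auto
  define c where "c = x0 \<bullet> (A *v x0)"
  have "x0 \<noteq> 0" using x0(1) by auto
  then have c: "0 < c" using A by (simp add: c_def)
  have low: "c * (norm x)\<^sup>2 \<le> x \<bullet> (A *v x)" for x
  proof (cases "x = 0")
    case False
    have "c \<le> ((1 / norm x) *\<^sub>R x) \<bullet> (A *v ((1 / norm x) *\<^sub>R x))"
      unfolding c_def using False by (intro x0) auto
    also have "\<dots> = (x \<bullet> (A *v x)) / (norm x)\<^sup>2"
      by (simp add: matrix_vector_mult_scaleR power2_eq_square)
    finally show ?thesis using False by (simp add: field_simps)
  qed simp
  have "\<forall>x. x \<noteq> 0 \<longrightarrow> 0 < x \<bullet> (B *v x)" if B: "dist B A < c" for B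
  proof (intro allI impI)
    fix x :: "real^'p" assume x: "x \<noteq> 0"
    have "norm (B - A) * (norm x)\<^sup>2 < c * (norm x)\<^sup>2"
      using B x by (simp add: dist_norm)
    moreover have "x \<bullet> (B *v x) = x \<bullet> (A *v x) + x \<bullet> ((B - A) *v x)"
      by (simp add: matrix_vector_mult_diff_rdistrib inner_diff_right)
    ultimately show "0 < x \<bullet> (B *v x)"
      using low[of x] abs_quadratic_form_le[of x "B - A"] by linarith
  qed
  then show "\<exists>e>0. \<forall>B. dist B A < e \<longrightarrow> B \<in> {A. \<forall>x. x \<noteq> 0 \<longrightarrow> 0 < x \<bullet> (A *v x)}"
    using c by blast
qed

lemma sets_pos_def:
  fixes f :: "'a \<Rightarrow> real^'p::finite^'p"
  assumes [measurable]: "f \<in> borel_measurable M" and sym: "\<And>\<omega>. sym_mat (f \<omega>)"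
  shows "{\<omega>\<in>space M. pos_def (f \<omega>)} \<in> sets M"
proof -
  have [measurable]: "{A :: real^'p^'p. \<forall>x. x \<noteq> 0 \<longrightarrow> 0 < x \<bullet> (A *v x)} \<in> sets borel"
    using open_pos_quadratic by (rule borel_open)
  have "{\<omega>\<in>space M. pos_def (f \<omega>)} = f -` {A. \<forall>x. x \<noteq> 0 \<longrightarrow> 0 < x \<bullet> (A *v x)} \<inter> space M"
    using sym by (auto simp: pos_def_def)
  also have "\<dots> \<in> sets M" by (rule measurable_sets[OF assms(1)]) simp
  finally show ?thesis .
qed

lemma measurable_Sigma_of_lse:
  fixes S :: "'a \<Rightarrow> real^'p::finite^'p"
  assumes G: "LGCM G r" and [measurable]: "S \<in> borel_measurable M"
  shows "(\<lambda>\<omega>. Sigma_of G r (lse G r (S \<omega>))) \<in> borel_measurable M"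
proof -
  obtain B where "finite B" and B: "\<And>S. Sigma_of G r (lse G r S) = G 0 + (\<Sum>b\<in>B. (S \<bullet> b) *\<^sub>R b)"
    and "\<And>S y. y \<in> span (G ` {1..r}) \<Longrightarrow> (S - (\<Sum>b\<in>B. (S \<bullet> b) *\<^sub>R b)) \<bullet> y = 0"
    and "\<And>S. (\<Sum>b\<in>B. (S \<bullet> b) *\<^sub>R b) \<in> span (G ` {1..r})"
    using lse_projection[OF G] by blast
  show ?thesis unfolding B by measurable
qed

lemma cov_dev_measurable:
  fixes X :: "nat \<Rightarrow> 'a \<Rightarrow> real^'p::finite"
  assumes "\<And>i. i < n \<Longrightarrow> X i \<in> borel_measurable M"
  shows "(\<lambda>\<omega>. cov_dev n (\<lambda>i. X i \<omega>)) \<in> borel_measurable M"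
proof -
  have [measurable]: "(\<lambda>\<omega>. sample_cov n (\<lambda>i. X i \<omega>)) \<in> borel_measurable M"
    by (rule measurable_sample_cov) (rule assms)
  show ?thesis unfolding cov_dev_def by measurable
qed

text \<open>Jensen's inequality in elementary form, by integrating 2 c f <= f^2 + c^2 at c = sqrt
  v.\<close>

lemma expectation_le_sqrt:
  fixes f :: "'b \<Rightarrow> real"
  assumes ps: "prob_space N" and [measurable]: "f \<in> borel_measurable N"
    and sq: "integrable N (\<lambda>x. (f x)\<^sup>2)" "(\<integral>x. (f x)\<^sup>2 \<partial>N) \<le> v" and v: "0 < v"
  shows "integrable N f" "(\<integral>x. f x \<partial>N) \<le> sqrt v"
proof -
  interpret prob_space N by (rule ps)
  show int: "integrable N f"
  proof (rule Bochner_Integration.integrable_bound[where f="\<lambda>x. 1 + (f x)\<^sup>2"])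
    show "integrable N (\<lambda>x. 1 + (f x)\<^sup>2)" using sq(1) by simp
    have "\<bar>f x\<bar> \<le> 1 + (f x)\<^sup>2" for x
      using zero_le_power2[of "\<bar>f x\<bar> - 1/2"] by (simp add: power2_eq_square algebra_simps)
    then show "AE x in N. norm (f x) \<le> norm (1 + (f x)\<^sup>2)" by simp
  qed simp
  define c where "c = sqrt v"
  have c: "0 < c" "c * c = v" using v by (auto simp: c_def)
  have "2 * c * (\<integral>x. f x \<partial>N) = (\<integral>x. 2 * c * f x \<partial>N)" by simp
  also have "\<dots> \<le> (\<integral>x. (f x)\<^sup>2 + v \<partial>N)"
  proof (rule integral_mono)
    show "2 * c * f x \<le> (f x)\<^sup>2 + v" for x
      using zero_le_power2[of "f x - c"] c by (simp add: power2_eq_square algebra_simps)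
  qed (use int sq in auto)
  also have "\<dots> \<le> v + v" using sq by (simp add: prob_space)
  also have "\<dots> = 2 * c * c" using c by simp
  finally show "(\<integral>x. f x \<partial>N) \<le> sqrt v" using c(1) by (simp add: c_def[symmetric])
qed

section \<open>The standard Gaussian sample\<close>

context
  fixes n :: nat and P :: "(nat \<Rightarrow> real^'p::finite) measure"
  assumes n: "0 < n"
  defines "P \<equiv> Pi\<^sub>M {..<n} (\<lambda>_. std_gauss_vec)"
begin

lemma prob_space_gauss_sample: "prob_space P"
  unfolding P_def by (intro prob_space_PiM prob_space_std_gauss_vec)

lemma gauss_sample_component: "i < n \<Longrightarrow> (\<lambda>y. y i) \<in> borel_measurable P"
  unfolding P_def using measurable_component_singleton[of i "{..<n}" "\<lambda>_. std_gauss_vec :: (real^'p) measure"]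
  by (simp cong: measurable_cong_sets)

lemma cov_dev_gauss_measurable: "cov_dev n \<in> borel_measurable P"
  using cov_dev_measurable[OF gauss_sample_component] by simp

text \<open>Each entry is an average of n independent centred variables, so its second moment is the
  variance from \<open>std_gauss_vec_covariance_entry\<close> divided by n.\<close>

lemma expectation_gram_dev_gauss:
  defines "D \<equiv> \<lambda>y. norm ((1 / real n) *\<^sub>R (\<Sum>i<n. outer (y i) (y i)) - mat 1 :: real^'p^'p)"
  shows "integrable P D" "integral\<^sup>L P D \<le> sqrt (real (CARD('p) * (CARD('p) + 1)) / real n)"
proof -
  define g where "g a b y = y $ a * y $ b - (if a = b then 1 else 0)" for a b and y :: "real^'p"
  have g: "integrable std_gauss_vec (g a b)" "integral\<^sup>L std_gauss_vec (g a b) = 0"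
    "integrable std_gauss_vec (\<lambda>y. (g a b y)\<^sup>2)" "(\<integral>y. (g a b y)\<^sup>2 \<partial>std_gauss_vec) = (if a = b then 2 else 1)" for a b
    using std_gauss_vec_covariance_entry[of a b] unfolding g_def by auto
  have D2: "(D y)\<^sup>2 = (\<Sum>a\<in>UNIV. \<Sum>b\<in>UNIV. (1 / real n)\<^sup>2 * (\<Sum>i<n. g a b (y i))\<^sup>2)" for y
    unfolding D_def power2_norm_rows power2_norm_vec power_mult_distrib[symmetric]
    using n by (intro sum.cong refl arg_cong[where f="\<lambda>x. x\<^sup>2"])
      (simp add: outer_def mat_def g_def sum_subtractf diff_divide_distrib)
  have one: "integrable P (\<lambda>y. (\<Sum>i<n. g a b (y i))\<^sup>2)"
    "(\<integral>y. (\<Sum>i<n. g a b (y i))\<^sup>2 \<partial>P) = real n * (if a = b then 2 else 1)" for a b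
    using PiM_integral_sum_square[OF prob_space_std_gauss_vec finite_lessThan[of n] g(1-3)[of a b]] g(4)[of a b]
    unfolding P_def by simp_all
  have int: "integrable P (\<lambda>y. (D y)\<^sup>2)"
    unfolding D2 by (intro Bochner_Integration.integrable_sum integrable_mult_right one)
  have "(\<integral>y. (D y)\<^sup>2 \<partial>P) = (\<Sum>a\<in>(UNIV::'p set). \<Sum>b\<in>(UNIV::'p set). (1 / real n)\<^sup>2 * (real n * (if a = b then 2 else 1)))"
    unfolding D2 by (simp add: Bochner_Integration.integral_sum one)
  also have "\<dots> = (\<Sum>a\<in>(UNIV::'p set). \<Sum>b\<in>(UNIV::'p set). 1 / real n + (if a = b then 1 / real n else 0))"
    using n by (intro sum.cong refl) (simp add: power2_eq_square)
  also have "\<dots> = real (CARD('p) * (CARD('p) + 1)) / real n"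
    by (simp add: sum.distrib add_divide_distrib distrib_left)
  finally have val: "(\<integral>y. (D y)\<^sup>2 \<partial>P) = real (CARD('p) * (CARD('p) + 1)) / real n" .
  have meas: "D \<in> borel_measurable P"
  proof -
    have [measurable]: "(\<lambda>y. (1 / real n) *\<^sub>R (\<Sum>i<n. outer (y i) (y i)) - mat 1 :: real^'p^'p) \<in> borel_measurable P"
    proof (rule measurable_mat)
      fix a b :: 'p
      have c: "(\<lambda>y. y i $ a) \<in> borel_measurable P" if "i < n" for i a
      proof -
        have "(\<lambda>y :: real^'p. y $ a) \<in> borel_measurable borel" by measurable
        from measurable_compose[OF gauss_sample_component[OF that] this] show ?thesis .
      qed
      have "(\<lambda>y. (1 / real n) * (\<Sum>i<n. y i $ a * y i $ b) - mat 1 $ a $ b) \<in> borel_measurable P"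
        by (intro borel_measurable_times borel_measurable_sum borel_measurable_diff borel_measurable_const c) auto
      then show "(\<lambda>y. ((1 / real n) *\<^sub>R (\<Sum>i<n. outer (y i) (y i)) - mat 1 :: real^'p^'p) $ a $ b) \<in> borel_measurable P"
        by (simp add: outer_def)
    qed
    show ?thesis unfolding D_def by measurable
  qed
  have pos: "0 < real (CARD('p) * (CARD('p) + 1)) / real n"
    unfolding of_nat_mult using n by (intro divide_pos_pos mult_pos_pos) (simp_all add: zero_less_card_finite)
  show "integrable P D" "integral\<^sup>L P D \<le> sqrt (real (CARD('p) * (CARD('p) + 1)) / real n)"
    using expectation_le_sqrt[OF prob_space_gauss_sample meas int _ pos] val by auto
qed

lemma expectation_sample_mean_gauss:
  "integrable P (\<lambda>y. (norm (sample_mean n y))\<^sup>2)"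
  "(\<integral>y. (norm (sample_mean n y))\<^sup>2 \<partial>P) = real CARD('p) / real n"
proof -
  have M2: "(norm (sample_mean n y))\<^sup>2 = (\<Sum>a\<in>UNIV. (1 / real n)\<^sup>2 * (\<Sum>i<n. y i $ a)\<^sup>2)" for y :: "nat \<Rightarrow> real^'p"
    unfolding power2_norm_vec power_mult_distrib[symmetric] by (simp add: sample_mean_def)
  have one: "integrable P (\<lambda>y. (\<Sum>i<n. y i $ a)\<^sup>2)" "(\<integral>y. (\<Sum>i<n. y i $ a)\<^sup>2 \<partial>P) = real n" for a
    using PiM_integral_sum_square[OF prob_space_std_gauss_vec finite_lessThan[of n] std_gauss_vec_nth_moment(1-3)[of a]]
      std_gauss_vec_nth_moment(4)[of a]
    unfolding P_def by simp_all
  show "integrable P (\<lambda>y. (norm (sample_mean n y))\<^sup>2)"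
    unfolding M2 by (intro Bochner_Integration.integrable_sum integrable_mult_right one)
  show "(\<integral>y. (norm (sample_mean n y))\<^sup>2 \<partial>P) = real CARD('p) / real n"
    unfolding M2 using n by (simp add: Bochner_Integration.integral_sum one) (simp add: power2_eq_square)
qed

lemma expectation_cov_dev_gauss:
  "integrable P (cov_dev n)"
  "integral\<^sup>L P (cov_dev n) \<le> sqrt (real (CARD('p) * (CARD('p) + 1)) / real n) + real CARD('p) / real n"
proof -
  define D where "D y = norm ((1 / real n) *\<^sub>R (\<Sum>i<n. outer (y i) (y i)) - mat 1 :: real^'p^'p)" for y
  have D: "integrable P D" "integral\<^sup>L P D \<le> sqrt (real (CARD('p) * (CARD('p) + 1)) / real n)"
    using expectation_gram_dev_gauss unfolding D_def by auto
  have le: "cov_dev n y \<le> D y + (norm (sample_mean n y))\<^sup>2" for y :: "nat \<Rightarrow> real^'p"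
    unfolding D_def by (rule cov_dev_le[OF n])
  have int: "integrable P (\<lambda>y. D y + (norm (sample_mean n y))\<^sup>2)"
    using D(1) expectation_sample_mean_gauss(1) by (rule Bochner_Integration.integrable_add)
  show "integrable P (cov_dev n)"
  proof (rule Bochner_Integration.integrable_bound[OF int cov_dev_gauss_measurable])
    show "AE y in P. norm (cov_dev n y) \<le> norm (D y + (norm (sample_mean n y))\<^sup>2)"
      using le by (intro AE_I2) (simp add: D_def)
  qed
  then have "integral\<^sup>L P (cov_dev n) \<le> (\<integral>y. D y + (norm (sample_mean n y))\<^sup>2 \<partial>P)"
    using int le by (rule integral_mono)
  also have "\<dots> = integral\<^sup>L P D + real CARD('p) / real n"
    using D(1) expectation_sample_mean_gauss by simp
  finally show "integral\<^sup>L P (cov_dev n) \<le> sqrt (real (CARD('p) * (CARD('p) + 1)) / real n) + real CARD('p) / real n"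
    using D(2) by linarith
qed

text \<open>\<open>midpoint_ineq_tail\<close> for sqrt n * sqrt (1 + F) at deviation sqrt n * t.
  Jensen bounds its mean through the mean of F, and the assumption \<open>f\<close> makes the event
  a subset of the tail event.\<close>

lemma cov_dev_gauss_tail:
  assumes t: "0 \<le> t"
    and f: "sqrt (1 + (sqrt (real (CARD('p) * (CARD('p) + 1)) / real n) + real CARD('p) / real n)) + t \<le> sqrt (1 + f)"
  shows "measure P {y\<in>space P. f \<le> cov_dev n y} \<le> exp (- real n * t\<^sup>2 / 2)"
proof -
  interpret P: prob_space P by (rule prob_space_gauss_sample)
  define \<phi> where "\<phi> = sqrt (real (CARD('p) * (CARD('p) + 1)) / real n) + real CARD('p) / real n"
  have \<phi>: "0 \<le> \<phi>" by (simp add: \<phi>_def)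
  define h where "h y = sqrt (real n) * sqrt (1 + cov_dev n y)" for y :: "nat \<Rightarrow> real^'p"
  note cov_dev_gauss_measurable[measurable]
  have h_meas[measurable]: "h \<in> borel_measurable P" unfolding h_def by measurable
  have sq: "integrable P (\<lambda>y. (sqrt (1 + cov_dev n y))\<^sup>2)" "(\<integral>y. (sqrt (1 + cov_dev n y))\<^sup>2 \<partial>P) \<le> 1 + \<phi>"
    using expectation_cov_dev_gauss by (simp_all add: \<phi>_def P.prob_space)
  have e: "integrable P (\<lambda>y. sqrt (1 + cov_dev n y))" "(\<integral>y. sqrt (1 + cov_dev n y) \<partial>P) \<le> sqrt (1 + \<phi>)"
    using expectation_le_sqrt[OF prob_space_gauss_sample _ sq] \<phi> by auto
  define m where "m x y = (\<lambda>i\<in>{..<n}. (1/2) *\<^sub>R (x i + y i))" for x y :: "nat \<Rightarrow> real^'p"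
  \<comment> \<open>This is the squared distance from \<open>x\<close> to \<open>m x y\<close> over
    the indices below \<open>n\<close>, so the Lipschitz bound has the form needed.\<close>
  define c where "c x y = (\<Sum>i<n. (norm (x i - y i))\<^sup>2 / 4)" for x y :: "nat \<Rightarrow> real^'p"
  have mi: "midpoint_ineq P m c"
    unfolding P_def m_def[abs_def] c_def[abs_def]
    by (intro midpoint_ineq_PiM midpoint_ineq_std_gauss_vec product_sigma_finite.intro
        prob_space_imp_sigma_finite prob_space_std_gauss_vec) auto
  have "measure P {y\<in>space P. sqrt (real n) * sqrt (1 + \<phi>) + sqrt (real n) * t \<le> h y} \<le> exp (- (sqrt (real n) * t)\<^sup>2 / 2)"
  proof (rule midpoint_ineq_tail[where m=m and c=c and f=h])
    show "midpoint_ineq P m c" "prob_space P" "h \<in> borel_measurable P"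
      by (rule mi prob_space_gauss_sample h_meas)+
    show "0 \<le> c x y" for x y unfolding c_def by (intro sum_nonneg) auto
    show "0 \<le> h y" for y by (simp add: h_def)
    show "integrable P h" unfolding h_def using e(1) by simp
    show "(\<integral>y. h y \<partial>P) \<le> sqrt (real n) * sqrt (1 + \<phi>)"
      unfolding h_def using e by (simp add: mult_left_mono)
    show "0 \<le> sqrt (real n) * t" using t by simp
    show "h x \<le> h (m x y) + sqrt (c x y)" for x y
    proof -
      have "x i - m x y i = (1/2) *\<^sub>R (x i - y i)" if "i < n" for i
      proof -
        have "x i = (1/2) *\<^sub>R x i + (1/2) *\<^sub>R x i" by (simp flip: scaleR_add_left)
        then show ?thesis using that by (simp add: m_def scaleR_add_right scaleR_diff_right)
      qed
      then have "(\<Sum>i<n. (norm (x i - m x y i))\<^sup>2) = c x y"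
        unfolding c_def by (intro sum.cong) (auto simp: power_divide)
      then show ?thesis
        unfolding h_def using cov_dev_sqrt_lipschitz[OF n, of x "m x y"] by simp
    qed
  qed
  also have "(sqrt (real n) * t)\<^sup>2 = real n * t\<^sup>2" by (simp add: power_mult_distrib)
  finally have tail: "measure P {y\<in>space P. sqrt (real n) * sqrt (1 + \<phi>) + sqrt (real n) * t \<le> h y} \<le> exp (- real n * t\<^sup>2 / 2)"
    by simp
  have "measure P {y\<in>space P. f \<le> cov_dev n y} \<le> measure P {y\<in>space P. sqrt (real n) * sqrt (1 + \<phi>) + sqrt (real n) * t \<le> h y}"
  proof (rule P.finite_measure_mono)
    have "sqrt (real n) * sqrt (1 + \<phi>) + sqrt (real n) * t \<le> h y" if "f \<le> cov_dev n y" for y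
    proof -
      have "sqrt (1 + f) \<le> sqrt (1 + cov_dev n y)" using that by simp
      then have "sqrt (1 + \<phi>) + t \<le> sqrt (1 + cov_dev n y)" using f unfolding \<phi>_def by linarith
      then have "sqrt (real n) * (sqrt (1 + \<phi>) + t) \<le> h y" unfolding h_def by (rule mult_left_mono) simp
      then show ?thesis by (simp add: distrib_left)
    qed
    then show "{y\<in>space P. f \<le> cov_dev n y} \<subseteq> {y\<in>space P. sqrt (real n) * sqrt (1 + \<phi>) + sqrt (real n) * t \<le> h y}"
      by auto
  qed measurable
  then show ?thesis using tail by linarith
qed

end

text \<open>The whitened observations are independent and standard normal, so their joint law is the
  product measure of the Gaussian tail bound, and the event is a preimage.\<close>

lemma cov_dev_whitened_tail:
  fixes X :: "nat \<Rightarrow> 'a \<Rightarrow> real^'p::finite" and Q R S :: "real^'p^'p"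
  assumes ps: "prob_space M" and n: "0 < n"
    and meas: "\<And>i. i < n \<Longrightarrow> X i \<in> borel_measurable M"
    and indep: "prob_space.indep_vars M (\<lambda>_. borel) X {..<n}"
    and distr: "\<And>i. i < n \<Longrightarrow> distr M borel (X i) = mvn mu S"
    and QR: "Q ** R = mat 1" "R ** Q = mat 1" "S = R ** transpose R"
    and t: "0 \<le> t"
    and f: "sqrt (1 + (sqrt (real (CARD('p) * (CARD('p) + 1)) / real n) + real CARD('p) / real n)) + t \<le> sqrt (1 + f)"
  shows "measure M {\<omega>\<in>space M. f \<le> cov_dev n (\<lambda>i. Q *v (X i \<omega> - mu))} \<le> exp (- real n * t\<^sup>2 / 2)"
proof -
  interpret prob_space M by (rule ps)
  define T where "T x = Q *v (x - mu)" for x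
  have T[measurable]: "T \<in> borel_measurable borel"
    unfolding T_def by (intro borel_measurable_continuous_onI continuous_intros
        linear_continuous_on_compose[OF _ matrix_vector_mul_linear])
  define Y where "Y = (\<lambda>i \<omega>. T (X i \<omega>))"
  have Y: "Y i \<in> borel_measurable M" if "i < n" for i
    unfolding Y_def using measurable_compose[OF meas[OF that] T] .
  \<comment> \<open>That \<open>mvn\<close> has mass 1 is read off from its being the law of
    \<open>X 0\<close>, which is available as n > 0.\<close>
  have "prob_space (mvn mu S)"
    using prob_space_distr[OF meas[OF n]] distr[OF n] by simp
  then have std: "distr (mvn mu S) borel T = std_gauss_vec"
    unfolding T_def by (rule distr_mvn_whitened[OF QR])
  have Yd: "distr M borel (Y i) = std_gauss_vec" if "i < n" for i
    using distr_distr[OF T meas[OF that]] distr[OF that] std by (simp add: Y_def comp_def)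
  have "indep_vars (\<lambda>_. borel) Y {..<n}"
    unfolding Y_def using indep_vars_compose2[OF indep, of "\<lambda>_. T" "\<lambda>_. borel"] T by simp
  then have law: "distr M (\<Pi>\<^sub>M i\<in>{..<n}. borel) (\<lambda>\<omega>. \<lambda>i\<in>{..<n}. Y i \<omega>) = (\<Pi>\<^sub>M i\<in>{..<n}. distr M borel (Y i))"
    using n Y by (subst (asm) indep_vars_iff_distr_eq_PiM') auto
  also have "\<dots> = (\<Pi>\<^sub>M i\<in>{..<n}. std_gauss_vec)" by (intro PiM_cong) (simp_all add: Yd)
  finally have law: "distr M (\<Pi>\<^sub>M i\<in>{..<n}. borel) (\<lambda>\<omega>. \<lambda>i\<in>{..<n}. Y i \<omega>) = (\<Pi>\<^sub>M i\<in>{..<n}. std_gauss_vec)" .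
  define P where "P = Pi\<^sub>M {..<n} (\<lambda>_. std_gauss_vec :: (real^'p) measure)"
  have PB: "sets P = sets (\<Pi>\<^sub>M i\<in>{..<n}. borel :: (real^'p) measure)"
    unfolding P_def by (intro sets_PiM_cong) auto
  have spP: "space P = space (\<Pi>\<^sub>M i\<in>{..<n}. borel :: (real^'p) measure)"
    using PB by (rule sets_eq_imp_space_eq)
  have mY: "(\<lambda>\<omega>. \<lambda>i\<in>{..<n}. Y i \<omega>) \<in> measurable M (\<Pi>\<^sub>M i\<in>{..<n}. borel)"
    using Y by (intro measurable_restrict) auto
  have "{y\<in>space P. f \<le> cov_dev n y} \<in> sets P"
    using cov_dev_gauss_measurable[OF n] unfolding P_def by measurable
  then have "measure P {y\<in>space P. f \<le> cov_dev n y}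
      = measure M ((\<lambda>\<omega>. \<lambda>i\<in>{..<n}. Y i \<omega>) -` {y\<in>space P. f \<le> cov_dev n y} \<inter> space M)"
    using measure_distr[OF mY, of "{y\<in>space P. f \<le> cov_dev n y}"] by (simp add: law P_def[symmetric] PB)
  also have "(\<lambda>\<omega>. \<lambda>i\<in>{..<n}. Y i \<omega>) -` {y\<in>space P. f \<le> cov_dev n y} \<inter> space M
      = {\<omega>\<in>space M. f \<le> cov_dev n (\<lambda>i. Y i \<omega>)}"
  proof -
    have "cov_dev n (\<lambda>i\<in>{..<n}. Y i \<omega>) = cov_dev n (\<lambda>i. Y i \<omega>)" for \<omega>
      unfolding cov_dev_def by (subst sample_cov_cong[of n _ "\<lambda>i. Y i \<omega>"]) auto
    moreover have "(\<lambda>i\<in>{..<n}. Y i \<omega>) \<in> space P" for \<omega> unfolding spP by (simp add: space_PiM)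
    ultimately show ?thesis by auto
  qed
  finally have "measure M {\<omega>\<in>space M. f \<le> cov_dev n (\<lambda>i. Y i \<omega>)} = measure P {y\<in>space P. f \<le> cov_dev n y}" ..
  also have "\<dots> \<le> exp (- real n * t\<^sup>2 / 2)"
    unfolding P_def by (rule cov_dev_gauss_tail[OF n t f])
  finally show ?thesis by (simp add: Y_def T_def)
qed

theorem mainTheorem7:
  fixes G :: "nat \<Rightarrow> real^'p::finite^'p" and r :: nat
    and vstar :: "nat \<Rightarrow> real" and mu :: "real^'p"
    and M :: "'a measure" and X :: "nat \<Rightarrow> 'a \<Rightarrow> real^'p" and n :: nat
  assumes model: "LGCM G r"
    and vstar: "pos_def (Sigma_of G r vstar)"
    and ps: "prob_space M"
    and meas: "\<And>i. i < n \<Longrightarrow> X i \<in> borel_measurable M"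
    and indep: "prob_space.indep_vars M (\<lambda>_. borel) X {..<n}"
    and distr: "\<And>i. i < n \<Longrightarrow> distr M borel (X i) = mvn mu (Sigma_of G r vstar)"
    and n15: "n \<ge> 15"
    and eps_pos: "eps_n CARD('p) (cond_num (Sigma_of G r vstar)) n > 0"
  shows "measure M {\<omega>\<in>space M. pos_def (2 *\<^sub>R sample_cov n (\<lambda>i. X i \<omega>)
                  - Sigma_of G r (lse G r (sample_cov n (\<lambda>i. X i \<omega>))))}
           \<ge> 1 - 2 * exp (- real n * (eps_n CARD('p) (cond_num (Sigma_of G r vstar)) n)\<^sup>2 / 2)
    \<and> measure M {\<omega>\<in>space M. pos_def (Sigma_of G r (lse G r (sample_cov n (\<lambda>i. X i \<omega>))))}
           \<ge> 1 - 2 * exp (- real n * (eps_n CARD('p) (cond_num (Sigma_of G r vstar)) n)\<^sup>2 / 2)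
    \<and> measure M {\<omega>\<in>space M. pos_def (Sigma_of G r (lse G r (sample_cov n (\<lambda>i. X i \<omega>))))
                  \<and> pos_def (2 *\<^sub>R sample_cov n (\<lambda>i. X i \<omega>)
                  - Sigma_of G r (lse G r (sample_cov n (\<lambda>i. X i \<omega>))))}
           \<ge> 1 - 4 * exp (- real n * (eps_n CARD('p) (cond_num (Sigma_of G r vstar)) n)\<^sup>2 / 2)"
proof -
  interpret prob_space M by (rule ps)
  define \<Sigma> where "\<Sigma> = Sigma_of G r vstar"
  define \<epsilon> where "\<epsilon> = eps_n CARD('p) (cond_num \<Sigma>) n"
  define f where "f = 1 / (1 + cond_num \<Sigma>)"
  define S where "S \<omega> = sample_cov n (\<lambda>i. X i \<omega>)" for \<omega>
  define P where "P \<omega> = Sigma_of G r (lse G r (S \<omega>))" for \<omega>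
  have n: "0 < n" using n15 by simp
  have pd: "pos_def \<Sigma>" using vstar by (simp add: \<Sigma>_def)
  obtain Q R :: "real^'p^'p" where QR: "Q ** \<Sigma> ** transpose Q = mat 1" "Q ** R = mat 1" "R ** Q = mat 1" "\<Sigma> = R ** transpose R"
    using pos_def_whitening[OF pd] by blast
  define F where "F \<omega> = cov_dev n (\<lambda>i. Q *v (X i \<omega> - mu))" for \<omega>
  have F: "F \<omega> = norm (Q ** S \<omega> ** transpose Q - mat 1)" for \<omega>
    unfolding F_def cov_dev_def S_def sample_cov_affine[OF n] ..
  \<comment> \<open>Purely deterministic: one event on F serves all three probabilities, without a
    union bound.\<close>
  have good: "pos_def (P \<omega>) \<and> pos_def (2 *\<^sub>R S \<omega> - P \<omega>)" if "F \<omega> < f" for \<omega>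
    using lse_pos_def[OF model vstar QR(2,3) _ _, of "S \<omega>"] QR(4) that
    by (simp add: F f_def \<Sigma>_def P_def S_def sym_mat_sample_cov)
  have margin: "sqrt (1 + (sqrt (real (CARD('p) * (CARD('p) + 1)) / real n) + real CARD('p) / real n)) + \<epsilon> \<le> sqrt (1 + f)"
    unfolding \<epsilon>_def f_def
    using concentration_margin[of "CARD('p)" "cond_num \<Sigma>" n] cond_num_ge_1[OF pd] n15 eps_pos
    by (simp add: \<Sigma>_def Suc_leI)
  have tail: "measure M {\<omega>\<in>space M. f \<le> F \<omega>} \<le> exp (- real n * \<epsilon>\<^sup>2 / 2)"
    unfolding F_def
  proof (rule cov_dev_whitened_tail[where S=\<Sigma> and R=R])
    show "0 \<le> \<epsilon>" using eps_pos by (simp add: \<epsilon>_def \<Sigma>_def)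
  qed (use ps n meas indep distr QR margin in \<open>auto simp: \<Sigma>_def\<close>)
  have S_meas[measurable]: "S \<in> borel_measurable M"
    unfolding S_def by (rule measurable_sample_cov) (rule meas)
  have P_meas[measurable]: "P \<in> borel_measurable M"
    unfolding P_def by (rule measurable_Sigma_of_lse[OF model S_meas])
  have F_meas[measurable]: "F \<in> borel_measurable M"
    unfolding F_def
  proof (rule cov_dev_measurable)
    fix i assume "i < n"
    have "(\<lambda>x. Q *v (x - mu)) \<in> borel_measurable borel"
      by (intro borel_measurable_continuous_onI continuous_intros
          linear_continuous_on_compose[OF _ matrix_vector_mul_linear])
    from measurable_compose[OF meas[OF \<open>i < n\<close>] this]
    show "(\<lambda>\<omega>. Q *v (X i \<omega> - mu)) \<in> borel_measurable M" .
  qed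
  have symP: "sym_mat (P \<omega>)" and symS: "sym_mat (S \<omega>)" for \<omega>
    by (simp_all add: P_def S_def sym_mat_Sigma_of[OF model] sym_mat_sample_cov)
  have ev1: "{\<omega>\<in>space M. pos_def (P \<omega>)} \<in> events"
    by (rule sets_pos_def[OF P_meas symP])
  have ev2: "{\<omega>\<in>space M. pos_def (2 *\<^sub>R S \<omega> - P \<omega>)} \<in> events"
    by (rule sets_pos_def) (simp, intro sym_mat_diff sym_mat_scaleR symP symS)
  have ev3: "{\<omega>\<in>space M. pos_def (P \<omega>) \<and> pos_def (2 *\<^sub>R S \<omega> - P \<omega>)} \<in> events"
    using sets.Int[OF ev1 ev2] by (rule back_subst) auto
  define e where "e = exp (- real n * \<epsilon>\<^sup>2 / 2)"
  have e0: "0 \<le> e" by (simp add: e_def)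
  have "prob {\<omega>\<in>space M. F \<omega> < f} = 1 - prob {\<omega>\<in>space M. f \<le> F \<omega>}"
    by (subst prob_compl[symmetric]) (auto intro!: arg_cong[where f=prob])
  then have base: "1 - e \<le> prob {\<omega>\<in>space M. F \<omega> < f}"
    using tail by (simp add: e_def)
  have bound: "1 - e \<le> prob A" if "A \<in> events" "{\<omega>\<in>space M. F \<omega> < f} \<subseteq> A" for A
    using finite_measure_mono[OF that(2,1)] base by linarith
  \<comment> \<open>The single one-sided tail gives 1 - e in each case; the stated bounds with 2 e
    and 4 e follow from e >= 0.\<close>
  have "1 - e \<le> prob {\<omega>\<in>space M. pos_def (2 *\<^sub>R S \<omega> - P \<omega>)}"
    "1 - e \<le> prob {\<omega>\<in>space M. pos_def (P \<omega>)}"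
    "1 - e \<le> prob {\<omega>\<in>space M. pos_def (P \<omega>) \<and> pos_def (2 *\<^sub>R S \<omega> - P \<omega>)}"
    using good by (auto intro!: bound ev1 ev2 ev3)
  then show ?thesis
    unfolding P_def[symmetric] S_def[symmetric] \<Sigma>_def[symmetric] \<epsilon>_def[symmetric] e_def[symmetric]
    using e0 unfolding P_def S_def by linarith
qed

end
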